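(* Let $f:X\to\mathbb{R}$ be Lipschitz with $f>0$. For each fixed $c>0$ and each continuous $g:X\to\mathbb{R}$, $$\lim_{N\to\infty}\int g\,d\pi_{c,N}=\lim_{N\to\infty}\int g\,d\eta_{c,N}=\int g\,d\mu_{cf},$$ where $\mu_{cf}$ is the Gibbs (equilibrium) state of $cf$.
   Context: $X=\{1,\dots,d\}^{\mathbb{N}}$ is the full Bernoulli space with shift $\sigma$ and metric $d(x,y)=\theta^{N}$, where $N$ is the first index with $x_N\ne y_N$ (and $d(x,x)=0$), $0<\theta<1$ fixed. Lipschitz is with respect to this metric. For $g:X\to\mathbb{R}$, $g^n(x)=g(x)+g(\sigma x)+\dots+g(\sigma^{n-1}x)$. $\mathrm{Fix}_n=\{x:\sigma^n(x)=x\}$. $P(\cdot)$ is topological pressure for $\sigma$. $\mu_{cf}$ is the unique $\sigma$-invariant equilibrium state of $cf$. For $c>0$, $N\in\mathbb{N}$, $\pi_{c,N},\eta_{c,N}$ are the $\sigma$-invariant probabilities given, for continuous $g$, by $$\int g\,d\pi_{c,N}=\frac{\sum_{n=1}^{N}\sum_{x\in \mathrm{Fix}_{n}}e^{cf^{n}(x)-nP(cf)}\frac{g^{n}(x)}{n}}{\sum_{n=1}^{N}\sum_{x\in \mathrm{Fix}_{n}}e^{cf^{n}(x)-nP(cf)}},\qquad \int g\,d\eta_{c,N}=\frac{\sum_{n=1}^{N}\sum_{x\in \mathrm{Fix}_{n}}e^{cf^{n}(x)}\frac{g^{n}(x)}{n}}{\sum_{n=1}^{N}\sum_{x\in \mathrm{Fix}_{n}}e^{cf^{n}(x)}}.$$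 *)

theory Defs
  imports "HOL-Probability.Probability"
begin

section \<open>Thermodynamic formalism on a compact metric space\<close>

definition birkhoff_sum :: "('a \<Rightarrow> 'a) \<Rightarrow> ('a \<Rightarrow> real) \<Rightarrow> nat \<Rightarrow> 'a \<Rightarrow> real" where
  "birkhoff_sum T g n x = (\<Sum>i<n. g ((T ^^ i) x))"

definition borel_of_metric :: "'a metric \<Rightarrow> 'a measure" where
  "borel_of_metric m = sigma (mspace m) {U. openin (mtopology_of m) U}"

definition invariant_prob :: "'a measure \<Rightarrow> ('a \<Rightarrow> 'a) \<Rightarrow> 'a measure \<Rightarrow> bool" where
  "invariant_prob B T \<mu> \<longleftrightarrow>
     prob_space \<mu> \<and> space \<mu> = space B \<and> sets \<mu> = sets B \<and>
     T \<in> measurable \<mu> \<mu> \<and> distr \<mu> \<mu> T = \<mu>"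

text \<open>Kolmogorov--Sinai entropy. Since \<open>ln 0 = 0\<close>, the convention \<open>0 ln 0 = 0\<close> is built in.\<close>

definition partition_entropy :: "'a measure \<Rightarrow> 'a set set \<Rightarrow> real" where
  "partition_entropy \<mu> \<xi> = - (\<Sum>A\<in>\<xi>. measure \<mu> A * ln (measure \<mu> A))"

text \<open>The nonempty atoms of the join of the partitions \<open>T\<^sup>-\<^sup>i \<xi>\<close>, \<open>i < n\<close>.\<close>

definition iterated_join :: "'a measure \<Rightarrow> ('a \<Rightarrow> 'a) \<Rightarrow> 'a set set \<Rightarrow> nat \<Rightarrow> 'a set set" where
  "iterated_join \<mu> T \<xi> n =
     (\<lambda>a. {x \<in> space \<mu>. \<forall>i<n. (T ^^ i) x \<in> a i}) ` ({..<n} \<rightarrow>\<^sub>E \<xi>) - {{}}"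

definition partition_entropy_rate :: "'a measure \<Rightarrow> ('a \<Rightarrow> 'a) \<Rightarrow> 'a set set \<Rightarrow> real" where
  "partition_entropy_rate \<mu> T \<xi> =
     lim (\<lambda>n. partition_entropy \<mu> (iterated_join \<mu> T \<xi> n) / real n)"

definition ks_entropy :: "'a measure \<Rightarrow> ('a \<Rightarrow> 'a) \<Rightarrow> ereal" where
  "ks_entropy \<mu> T =
     (SUP \<xi> \<in> {\<xi>. finite \<xi> \<and> \<xi> \<subseteq> sets \<mu> \<and> partition_on (space \<mu>) \<xi>}.
        ereal (partition_entropy_rate \<mu> T \<xi>))"

text \<open>
  Topological pressure in Bowen's definition by \<open>(n, \<epsilon>)\<close>-separated sets. The supremum in
  \<open>separated_sum\<close> is taken in the reals; on a compact space, with \<open>T\<close> and \<open>\<phi>\<close> continuous, the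
  set is bounded, because the cardinality of \<open>(n, \<epsilon>)\<close>-separated sets is.
\<close>

definition dyn_separated :: "'a metric \<Rightarrow> ('a \<Rightarrow> 'a) \<Rightarrow> nat \<Rightarrow> real \<Rightarrow> 'a set \<Rightarrow> bool" where
  "dyn_separated m T n \<epsilon> E \<longleftrightarrow>
     finite E \<and> E \<subseteq> mspace m \<and>
     (\<forall>x\<in>E. \<forall>y\<in>E. x \<noteq> y \<longrightarrow> (\<exists>i<n. mdist m ((T ^^ i) x) ((T ^^ i) y) > \<epsilon>))"

definition separated_sum ::
  "'a metric \<Rightarrow> ('a \<Rightarrow> 'a) \<Rightarrow> ('a \<Rightarrow> real) \<Rightarrow> nat \<Rightarrow> real \<Rightarrow> real" where
  "separated_sum m T \<phi> n \<epsilon> =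
     (SUP E \<in> {E. dyn_separated m T n \<epsilon> E}. \<Sum>x\<in>E. exp (birkhoff_sum T \<phi> n x))"

definition topological_pressure ::
  "'a metric \<Rightarrow> ('a \<Rightarrow> 'a) \<Rightarrow> ('a \<Rightarrow> real) \<Rightarrow> ereal" where
  "topological_pressure m T \<phi> =
     Lim (at_right 0) (\<lambda>\<epsilon>. limsup (\<lambda>n. ereal (ln (separated_sum m T \<phi> n \<epsilon>) / real n)))"

definition equilibrium_state ::
  "'a metric \<Rightarrow> ('a \<Rightarrow> 'a) \<Rightarrow> ('a \<Rightarrow> real) \<Rightarrow> 'a measure \<Rightarrow> bool" where
  "equilibrium_state m T \<phi> \<mu> \<longleftrightarrow>
     invariant_prob (borel_of_metric m) T \<mu> \<and>
     ks_entropy \<mu> T + ereal (\<integral>x. \<phi> x \<partial>\<mu>) = topological_pressure m T \<phi>"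


section \<open>The full Bernoulli space\<close>

definition bernoulli_space :: "nat \<Rightarrow> (nat \<Rightarrow> nat) set" where
  "bernoulli_space d = (UNIV \<rightarrow> {1..d})"

definition left_shift :: "(nat \<Rightarrow> nat) \<Rightarrow> nat \<Rightarrow> nat" where
  "left_shift x = (\<lambda>k. x (Suc k))"

text \<open>
  Coordinates are numbered from 0; numbering them from 1 multiplies the distance by the
  constant \<open>\<theta>\<close> and so changes neither the topology nor the class of Lipschitz functions.
\<close>

definition bernoulli_dist :: "real \<Rightarrow> (nat \<Rightarrow> nat) \<Rightarrow> (nat \<Rightarrow> nat) \<Rightarrow> real" where
  "bernoulli_dist \<theta> x y = (if x = y then 0 else \<theta> ^ (LEAST k. x k \<noteq> y k))"

definition bernoulli_metric :: "nat \<Rightarrow> real \<Rightarrow> (nat \<Rightarrow> nat) metric" where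
  "bernoulli_metric d \<theta> = metric (bernoulli_space d, bernoulli_dist \<theta>)"

definition fix_points :: "nat \<Rightarrow> nat \<Rightarrow> (nat \<Rightarrow> nat) set" where
  "fix_points d n = {x \<in> bernoulli_space d. (left_shift ^^ n) x = x}"

lemma bernoulli_dist_le_iff:
  assumes "0 < \<theta>" "\<theta> < 1"
  shows "bernoulli_dist \<theta> x y \<le> \<theta> ^ n \<longleftrightarrow> (\<forall>k<n. x k = y k)"
proof (cases "x = y")
  case True
  then show ?thesis using assms by (simp add: bernoulli_dist_def)
next
  case False
  then have ex: "\<exists>k. x k \<noteq> y k" by auto
  let ?l = "LEAST k. x k \<noteq> y k"
  have "x ?l \<noteq> y ?l" using ex by (rule LeastI_ex)
  moreover have "\<And>k. k < ?l \<Longrightarrow> x k = y k" using not_less_Least by blast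
  ultimately have "n \<le> ?l \<longleftrightarrow> (\<forall>k<n. x k = y k)"
    by (meson leI less_le_trans)
  then show ?thesis using False assms by (simp add: bernoulli_dist_def power_decreasing_iff)
qed

lemma Metric_space_bernoulli:
  assumes "0 < \<theta>" "\<theta> < 1"
  shows "Metric_space (bernoulli_space d) (bernoulli_dist \<theta>)"
proof
  show "0 \<le> bernoulli_dist \<theta> x y" for x y
    using assms by (simp add: bernoulli_dist_def)
  show "bernoulli_dist \<theta> x y = bernoulli_dist \<theta> y x" for x y
    by (simp add: bernoulli_dist_def eq_commute)
  show "bernoulli_dist \<theta> x y = 0 \<longleftrightarrow> x = y" for x y
    using assms by (simp add: bernoulli_dist_def)
  show "bernoulli_dist \<theta> x z \<le> bernoulli_dist \<theta> x y + bernoulli_dist \<theta> y z" for x y z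
  proof (cases "x = y \<or> y = z")
    case True
    then show ?thesis using assms by (auto simp: bernoulli_dist_def)
  next
    case False
    define a where "a = (LEAST k. x k \<noteq> y k)"
    define b where "b = (LEAST k. y k \<noteq> z k)"
    have xy: "bernoulli_dist \<theta> x y = \<theta> ^ a" and yz: "bernoulli_dist \<theta> y z = \<theta> ^ b"
      using False by (auto simp: bernoulli_dist_def a_def b_def)
    have "\<forall>k<a. x k = y k" "\<forall>k<b. y k = z k"
      unfolding a_def b_def using not_less_Least by blast+
    then have "bernoulli_dist \<theta> x z \<le> \<theta> ^ min a b"
      using bernoulli_dist_le_iff[OF assms] by auto
    also have "\<dots> \<le> \<theta> ^ a + \<theta> ^ b"
      using assms by (auto simp: min_def)
    finally show ?thesis by (simp add: xy yz)
  qed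
qed

lemma mspace_bernoulli_metric [simp]:
  "0 < \<theta> \<Longrightarrow> \<theta> < 1 \<Longrightarrow> mspace (bernoulli_metric d \<theta>) = bernoulli_space d"
  by (simp add: bernoulli_metric_def Metric_space_bernoulli Metric_space.mspace_metric)

lemma mdist_bernoulli_metric [simp]:
  "0 < \<theta> \<Longrightarrow> \<theta> < 1 \<Longrightarrow> mdist (bernoulli_metric d \<theta>) = bernoulli_dist \<theta>"
  by (simp add: bernoulli_metric_def Metric_space_bernoulli Metric_space.mdist_metric)

lemma space_borel_of_metric [simp]: "space (borel_of_metric m) = mspace m"
  by (simp add: borel_of_metric_def space_measure_of_conv)

lemma sets_borel_of_metric:
  "sets (borel_of_metric m) = sigma_sets (mspace m) {U. openin (mtopology_of m) U}"
  unfolding borel_of_metric_def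
  by (rule sets_measure_of) (use openin_subset in fastforce)

lemma continuous_map_borel_of_metric:
  assumes "continuous_map (mtopology_of m) euclidean g"
  shows "g \<in> measurable (borel_of_metric m) borel"
proof (rule borel_measurableI)
  fix S :: "'b set" assume "open S"
  then have "openin (mtopology_of m) {x \<in> mspace m. g x \<in> S}"
    using openin_continuous_map_preimage[OF assms, of S] by simp
  then show "g -` S \<inter> space (borel_of_metric m) \<in> sets (borel_of_metric m)"
    by (auto simp: sets_borel_of_metric vimage_def Int_def conj_commute intro: sigma_sets.Basic)
qed

lemma shift_in_bernoulli_space: "x \<in> bernoulli_space d \<Longrightarrow> left_shift x \<in> bernoulli_space d"
  by (auto simp: bernoulli_space_def left_shift_def)

lemma funpow_shift_in_bernoulli_space:
  "x \<in> bernoulli_space d \<Longrightarrow> (left_shift ^^ n) x \<in> bernoulli_space d"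
  by (induction n) (auto simp: shift_in_bernoulli_space)

lemma funpow_shift: "(left_shift ^^ n) x = (\<lambda>k. x (k + n))"
  by (induction n) (auto simp: left_shift_def)

lemma shift_measurable:
  assumes "0 < \<theta>" "\<theta> < 1"
  shows "left_shift \<in> measurable (borel_of_metric (bernoulli_metric d \<theta>))
                            (borel_of_metric (bernoulli_metric d \<theta>))"
proof -
  let ?m = "bernoulli_metric d \<theta>"
  have lip: "bernoulli_dist \<theta> (left_shift x) (left_shift y) \<le> (1 / \<theta>) * bernoulli_dist \<theta> x y" for x y
  proof (cases "x = y")
    case True
    then show ?thesis by (simp add: bernoulli_dist_def)
  next
    case False
    define a where "a = (LEAST k. x k \<noteq> y k)"
    have d: "bernoulli_dist \<theta> x y = \<theta> ^ a" using False by (simp add: bernoulli_dist_def a_def)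
    have a: "\<forall>k<a. x k = y k" unfolding a_def using not_less_Least by blast
    then have "\<forall>k<a - 1. left_shift x k = left_shift y k" by (auto simp: left_shift_def)
    then have "bernoulli_dist \<theta> (left_shift x) (left_shift y) \<le> \<theta> ^ (a - 1)"
      using bernoulli_dist_le_iff[OF assms] by blast
    also have "\<dots> \<le> (1 / \<theta>) * \<theta> ^ a" using assms by (cases a) auto
    finally show ?thesis by (simp add: d)
  qed
  have "Lipschitz_continuous_map ?m ?m left_shift"
    unfolding Lipschitz_continuous_map_def
    using lip assms shift_in_bernoulli_space by (auto intro!: exI[of _ "1 / \<theta>"])
  then have cont: "continuous_map (mtopology_of ?m) (mtopology_of ?m) left_shift"
    by (rule Lipschitz_continuous_imp_continuous_map)
  show ?thesis
  proof (rule measurable_sigma_sets[OF sets_borel_of_metric])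
    show "{U. openin (mtopology_of ?m) U} \<subseteq> Pow (mspace ?m)"
      using openin_subset by fastforce
    show "left_shift \<in> space (borel_of_metric ?m) \<rightarrow> mspace ?m"
      using assms shift_in_bernoulli_space by auto
    fix U assume "U \<in> {U. openin (mtopology_of ?m) U}"
    then have "openin (mtopology_of ?m) {x \<in> mspace ?m. left_shift x \<in> U}"
      using openin_continuous_map_preimage[OF cont, of U] by simp
    then show "left_shift -` U \<inter> space (borel_of_metric ?m) \<in> sets (borel_of_metric ?m)"
      by (auto simp: sets_borel_of_metric vimage_def Int_def conj_commute intro: sigma_sets.Basic)
  qed
qed

lemma finite_fix_points:
  assumes "n \<ge> 1"
  shows "finite (fix_points d n)"
proof (rule inj_on_finite)
  show "inj_on (\<lambda>x. restrict x {..<n}) (fix_points d n)"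
  proof (rule inj_onI)
    fix x y assume xy: "x \<in> fix_points d n" "y \<in> fix_points d n"
      and eq: "restrict x {..<n} = restrict y {..<n}"
    have per: "x (k + n) = x k" "y (k + n) = y k" for k
      using xy funpow_shift[of n] by (auto simp: fix_points_def fun_eq_iff)
    have "x k = y k" for k
    proof (induction k rule: less_induct)
      case (less k)
      show ?case
      proof (cases "k < n")
        case True
        then show ?thesis using eq by (metis lessThan_iff restrict_apply')
      next
        case False
        then show ?thesis using less[of "k - n"] per[of "k - n"] assms by simp
      qed
    qed
    then show "x = y" by auto
  qed
  show "(\<lambda>x. restrict x {..<n}) ` fix_points d n \<subseteq> {..<n} \<rightarrow>\<^sub>E {1..d}"
    by (auto simp: fix_points_def bernoulli_space_def PiE_def extensional_def)
  show "finite ({..<n} \<rightarrow>\<^sub>E {1..d} :: (nat \<Rightarrow> nat) set)"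
    by (intro finite_PiE) auto
qed


section \<open>Measures supported on periodic orbits\<close>

definition orbit_weight_total ::
  "nat \<Rightarrow> (nat \<Rightarrow> (nat \<Rightarrow> nat) \<Rightarrow> real) \<Rightarrow> nat \<Rightarrow> real" where
  "orbit_weight_total d w N = (\<Sum>n=1..N. \<Sum>x\<in>fix_points d n. w n x)"

text \<open>
  The point \<open>left_shift\<^sup>i x\<close>, with \<open>1 \<le> n \<le> N\<close>, \<open>x \<in> Fix\<^sub>n\<close> and \<open>i < n\<close>, carries mass proportional
  to \<open>w n x / n\<close>. This is the invariant probability whose integrals are the weighted averages of
  \<open>g\<^sup>n x / n\<close>; see \<open>integral_orbit_measure\<close> and \<open>invariant_prob_orbit_measure\<close>.
\<close>

definition orbit_index :: "nat \<Rightarrow> nat \<Rightarrow> (nat \<times> (nat \<Rightarrow> nat) \<times> nat) set" where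
  "orbit_index d N = (SIGMA n:{1..N}. fix_points d n \<times> {..<n})"

definition orbit_measure ::
  "nat \<Rightarrow> real \<Rightarrow> (nat \<Rightarrow> (nat \<Rightarrow> nat) \<Rightarrow> real) \<Rightarrow> nat \<Rightarrow> (nat \<Rightarrow> nat) measure" where
  "orbit_measure d \<theta> w N =
     distr (point_measure (orbit_index d N)
              (\<lambda>(n, x, i). ennreal (w n x / real n / orbit_weight_total d w N)))
           (borel_of_metric (bernoulli_metric d \<theta>))
           (\<lambda>(n, x, i). (left_shift ^^ i) x)"

definition zeta_measure_pi ::
  "nat \<Rightarrow> real \<Rightarrow> ((nat \<Rightarrow> nat) \<Rightarrow> real) \<Rightarrow> real \<Rightarrow> nat \<Rightarrow> (nat \<Rightarrow> nat) measure" where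
  "zeta_measure_pi d \<theta> f c N =
     orbit_measure d \<theta>
       (\<lambda>n x. exp (c * birkhoff_sum left_shift f n x -
          real n * real_of_ereal
            (topological_pressure (bernoulli_metric d \<theta>) left_shift (\<lambda>y. c * f y)))) N"

definition zeta_measure_eta ::
  "nat \<Rightarrow> real \<Rightarrow> ((nat \<Rightarrow> nat) \<Rightarrow> real) \<Rightarrow> real \<Rightarrow> nat \<Rightarrow> (nat \<Rightarrow> nat) measure" where
  "zeta_measure_eta d \<theta> f c N =
     orbit_measure d \<theta> (\<lambda>n x. exp (c * birkhoff_sum left_shift f n x)) N"

lemma finite_orbit_index: "finite (orbit_index d N)"
  unfolding orbit_index_def using finite_fix_points by (intro finite_SigmaI) auto

lemma sum_orbit_index:
  fixes h :: "nat \<Rightarrow> (nat \<Rightarrow> nat) \<Rightarrow> nat \<Rightarrow> real"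
  shows "(\<Sum>(n, x, i)\<in>orbit_index d N. h n x i) =
         (\<Sum>n=1..N. \<Sum>x\<in>fix_points d n. \<Sum>i<n. h n x i)"
proof -
  have "(\<Sum>n=1..N. \<Sum>x\<in>fix_points d n. \<Sum>i<n. h n x i) =
        (\<Sum>n=1..N. \<Sum>(x, i)\<in>fix_points d n \<times> {..<n}. h n x i)"
    by (simp add: sum.cartesian_product)
  also have "\<dots> = (\<Sum>(n, x, i)\<in>orbit_index d N. h n x i)"
    unfolding orbit_index_def
    by (subst sum.Sigma) (auto simp: finite_fix_points)
  finally show ?thesis ..
qed

lemma orbit_measure_map_measurable:
  assumes "0 < \<theta>" "\<theta> < 1"
  shows "(\<lambda>(n, x, i). (left_shift ^^ i) x)
           \<in> measurable (point_measure (orbit_index d N) W) (borel_of_metric (bernoulli_metric d \<theta>))"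
  using assms
  by (auto simp: orbit_index_def fix_points_def funpow_shift_in_bernoulli_space)

lemma orbit_weight_total_pos:
  assumes "d \<ge> 1" "N \<ge> 1" "\<And>n x. w n x > 0"
  shows "orbit_weight_total d w N > 0"
proof -
  have "(\<lambda>_. 1) \<in> fix_points d n" for n
    using assms by (auto simp: fix_points_def bernoulli_space_def funpow_shift)
  then have ne: "fix_points d n \<noteq> {}" for n
    by blast
  have "(\<Sum>x\<in>fix_points d n. w n x) > 0" if "n \<ge> 1" for n
    using that finite_fix_points[of n d] assms(3) ne[of n] by (intro sum_pos) auto
  then show ?thesis
    unfolding orbit_weight_total_def using assms(2) by (intro sum_pos[OF finite_atLeastAtMost]) auto
qed

lemma integral_orbit_measure_measurable:
  fixes g :: "(nat \<Rightarrow> nat) \<Rightarrow> real"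
  assumes "0 < \<theta>" "\<theta> < 1" "d \<ge> 1" "N \<ge> 1" "\<And>n x. w n x > 0"
    and g: "g \<in> borel_measurable (borel_of_metric (bernoulli_metric d \<theta>))"
  shows "(\<integral>x. g x \<partial>orbit_measure d \<theta> w N) =
         (\<Sum>n=1..N. \<Sum>x\<in>fix_points d n. w n x * (birkhoff_sum left_shift g n x / real n)) /
         (\<Sum>n=1..N. \<Sum>x\<in>fix_points d n. w n x)"
proof -
  let ?W = "orbit_weight_total d w N"
  let ?h = "\<lambda>(n, x, i). w n x / real n / ?W"
  have W: "?W > 0" by (rule orbit_weight_total_pos) (use assms in auto)
  have "(\<integral>x. g x \<partial>orbit_measure d \<theta> w N) =
        (\<integral>p. g ((\<lambda>(n, x, i). (left_shift ^^ i) x) p) \<partial>point_measure (orbit_index d N) (\<lambda>p. ennreal (?h p)))"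
    unfolding orbit_measure_def
    by (subst integral_distr[OF orbit_measure_map_measurable[OF assms(1,2)] g])
       (simp add: case_prod_unfold)
  also have "\<dots> = (\<Sum>p\<in>orbit_index d N. ?h p *\<^sub>R g ((\<lambda>(n, x, i). (left_shift ^^ i) x) p))"
    using W assms(5)
    by (intro lebesgue_integral_point_measure_finite finite_orbit_index)
       (auto simp: less_imp_le split: prod.split)
  also have "\<dots> = (\<Sum>(n, x, i)\<in>orbit_index d N. w n x / real n / ?W * g ((left_shift ^^ i) x))"
    by (simp add: case_prod_unfold)
  also have "\<dots> = (\<Sum>n=1..N. \<Sum>x\<in>fix_points d n. w n x * (birkhoff_sum left_shift g n x / real n)) / ?W"
    unfolding sum_orbit_index
    by (simp add: birkhoff_sum_def sum_distrib_left sum_divide_distrib ac_simps)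
  finally show ?thesis by (simp add: orbit_weight_total_def)
qed

lemma integral_orbit_measure:
  fixes g :: "(nat \<Rightarrow> nat) \<Rightarrow> real"
  assumes "0 < \<theta>" "\<theta> < 1" "d \<ge> 1" "N \<ge> 1" "\<And>n x. w n x > 0"
    and "continuous_map (mtopology_of (bernoulli_metric d \<theta>)) euclidean g"
  shows "(\<integral>x. g x \<partial>orbit_measure d \<theta> w N) =
         (\<Sum>n=1..N. \<Sum>x\<in>fix_points d n. w n x * (birkhoff_sum left_shift g n x / real n)) /
         (\<Sum>n=1..N. \<Sum>x\<in>fix_points d n. w n x)"
  using assms by (intro integral_orbit_measure_measurable continuous_map_borel_of_metric) auto

lemma invariant_prob_orbit_measure:
  assumes "0 < \<theta>" "\<theta> < 1" "d \<ge> 1" "N \<ge> 1" "\<And>n x. w n x > 0"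
  shows "invariant_prob (borel_of_metric (bernoulli_metric d \<theta>)) left_shift (orbit_measure d \<theta> w N)"
proof -
  let ?B = "borel_of_metric (bernoulli_metric d \<theta>)"
  let ?O = "orbit_measure d \<theta> w N"
  let ?W = "orbit_weight_total d w N"
  let ?P = "point_measure (orbit_index d N) (\<lambda>(n, x, i). ennreal (w n x / real n / ?W))"
  have W: "?W > 0" by (rule orbit_weight_total_pos) (use assms in auto)
  have sp: "space ?O = space ?B" and st: "sets ?O = sets ?B"
    by (simp_all add: orbit_measure_def)
  have fm: "finite_measure ?P"
    by (rule finite_measureI) (auto simp: space_point_measure emeasure_point_measure_finite finite_orbit_index case_prod_unfold)
  have "finite_measure ?O"
    unfolding orbit_measure_def
    by (rule finite_measure.finite_measure_distr[OF fm orbit_measure_map_measurable[OF assms(1,2)]])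
  then interpret finite_measure ?O .
  have meas: "measure ?O A =
      (\<Sum>n=1..N. \<Sum>x\<in>fix_points d n. w n x * (birkhoff_sum left_shift (indicator A) n x / real n)) / ?W"
    if "A \<in> sets ?B" for A
  proof -
    have "measure ?O A = (\<integral>x. indicator A x \<partial>?O)"
      using that sets.sets_into_space[OF that] sp st by (simp add: Int_absorb2)
    then show ?thesis
      using integral_orbit_measure_measurable[OF assms borel_measurable_indicator[OF that]]
      by (simp add: orbit_weight_total_def)
  qed
  have shift_O: "left_shift \<in> measurable ?O ?O"
    using shift_measurable[OF assms(1,2), of d] st by (simp cong: measurable_cong_sets)
  have "measure ?O (space ?B) = 1"
  proof -
    have "birkhoff_sum left_shift (indicator (space ?B)) n x = real n" if "x \<in> fix_points d n" for n x
    proof -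
      have "(left_shift ^^ i) x \<in> space ?B" for i
        using that assms(1,2) by (auto simp: fix_points_def funpow_shift_in_bernoulli_space)
      then show ?thesis by (simp add: birkhoff_sum_def)
    qed
    then have "measure ?O (space ?B) = (\<Sum>n=1..N. \<Sum>x\<in>fix_points d n. w n x) / ?W"
      by (subst meas[OF sets.top]) (auto simp del: space_borel_of_metric intro!: sum.cong arg_cong2[where f="(/)"])
    then show ?thesis using W by (simp add: orbit_weight_total_def)
  qed
  then have prob: "prob_space ?O"
    by (intro prob_spaceI) (simp add: sp emeasure_eq_measure)
  have "distr ?O ?O left_shift = ?O"
  proof (rule measure_eqI)
    fix A assume "A \<in> sets (distr ?O ?O left_shift)"
    then have A: "A \<in> sets ?B" using st by simp
    let ?A = "left_shift -` A \<inter> space ?B"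
    have A': "?A \<in> sets ?B" using A shift_measurable[OF assms(1,2)] by (rule measurable_sets[rotated])
    have "birkhoff_sum left_shift (indicator ?A) n x = birkhoff_sum left_shift (indicator A) n x"
      if x: "x \<in> fix_points d n" for n x
    proof -
      let ?u = "\<lambda>i. indicator A ((left_shift ^^ i) x) :: real"
      have "(left_shift ^^ i) x \<in> space ?B" for i
        using x assms(1,2) by (auto simp: fix_points_def funpow_shift_in_bernoulli_space)
      then have "birkhoff_sum left_shift (indicator ?A) n x = (\<Sum>i<n. ?u (Suc i))"
        by (auto simp: birkhoff_sum_def indicator_def intro!: sum.cong)
      also have "\<dots> = (\<Sum>i<Suc n. ?u i) - ?u 0"
        unfolding sum.lessThan_Suc_shift by linarith
      also have "\<dots> = (\<Sum>i<n. ?u i)"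
        using x by (simp add: fix_points_def)
      finally show ?thesis by (simp add: birkhoff_sum_def)
    qed
    then have "measure ?O ?A = measure ?O A"
      unfolding meas[OF A] meas[OF A'] by (simp cong: sum.cong)
    then show "emeasure (distr ?O ?O left_shift) A = emeasure ?O A"
      using A st sp by (simp add: emeasure_distr[OF shift_O] emeasure_eq_measure)
  qed simp
  then show ?thesis
    using prob sp st shift_O by (simp add: invariant_prob_def)
qed

end

theory Submission
  imports Defs
begin

text \<open>
  Let \<open>\<phi> = c f\<close> and let \<open>L\<close> be its transfer operator. Dividing \<open>L\<close> by an eigenfunction gives a
  Markov operator whose iterates flatten every Lipschitz function \<open>g\<close> to a constant \<open>m\<close>. This
  yields, for the pressure \<open>p\<close>, the one-sided estimate \<open>p (\<phi> + t g) \<le> p (\<phi>) + t m + o(t)\<close>. Both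
  sides of the claim are subgradients at \<open>t = 0\<close>: by Jensen's inequality
  \<open>ln (\<Sum>x\<in>Fix\<^sub>n. exp (\<phi>\<^sup>n x + t g\<^sup>n x))\<close> grows from \<open>t = 0\<close> at least like \<open>t\<close> times \<open>n\<close> times the
  weighted orbit average of \<open>g\<close> over \<open>Fix\<^sub>n\<close>, and by the variational inequality
  \<open>p (\<phi> + t g) \<ge> h(\<mu>) + \<integral>\<phi> d\<mu> + t \<integral>g d\<mu> = p (\<phi>) + t \<integral>g d\<mu>\<close>. Hence the orbit averages tend to \<open>m\<close>
  and \<open>\<integral>g d\<mu> = m\<close>. The measures \<open>\<pi>\<close> and \<open>\<eta>\<close> average the orbit averages over \<open>n \<le> N\<close> with weights
  of divergent sum, so they have the same limit.
\<close>

section \<open>Words, concatenation and the transfer operator\<close>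

text \<open>Bounded distortion determines growth rates but not how they change with
  \<open>t\<close>. The first-order estimate therefore needs an eigenfunction: conjugating with it
  removes the growth exactly, and what remains of \<open>t * g\<close> can be averaged until it is
  nearly constant, with an error of second order in \<open>t\<close>. The estimate holds for small
  \<open>t\<close> of both signs, so it leaves a single value for every subgradient at 0; this
  forces the orbit averages and the integral onto the same \<open>m\<close> without differentiating
  the pressure. Two obstacles shape the rest. The entropy of \<mu> is a supremum over all finite
  measurable partitions, so the variational inequality has to cope with partitions unrelated to
  cylinders; their labels are predicted from cylinders, and wrong predictions are paid for. Bowen's
  pressure is a limit over \<epsilon>, so it has to be matched with the growth rate of the transfer
  operator, by comparing separated sets with words and with periodic points. The estimates are made
  for Lipschitz \<open>g\<close> and reach continuous \<open>g\<close> by uniform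
  approximation.\<close>

definition words :: "'a set \<Rightarrow> nat \<Rightarrow> 'a list set" where
  "words A n = {w. set w \<subseteq> A \<and> length w = n}"

definition conc :: "nat list \<Rightarrow> (nat \<Rightarrow> nat) \<Rightarrow> nat \<Rightarrow> nat" where
  "conc w x = (\<lambda>k. if k < length w then w ! k else x (k - length w))"

definition transfer ::
  "nat \<Rightarrow> ((nat \<Rightarrow> nat) \<Rightarrow> real) \<Rightarrow> ((nat \<Rightarrow> nat) \<Rightarrow> real) \<Rightarrow> (nat \<Rightarrow> nat) \<Rightarrow> real" where
  "transfer d \<phi> u x = (\<Sum>a\<in>{1..d}. exp (\<phi> (conc [a] x)) * u (conc [a] x))"

text \<open>For 0 < \<theta> < 1, agreement in the first \<open>k\<close> coordinates means distance
  at most \<open>\<theta> ^ k\<close>, so this is Lipschitz continuity with constant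
  \<open>C\<close>. The prefix form combines directly with concatenation.\<close>

definition shift_Lipschitz :: "nat \<Rightarrow> real \<Rightarrow> real \<Rightarrow> ((nat \<Rightarrow> nat) \<Rightarrow> real) \<Rightarrow> bool" where
  "shift_Lipschitz d \<theta> C \<phi> \<longleftrightarrow> C \<ge> 0 \<and>
     (\<forall>x\<in>bernoulli_space d. \<forall>y\<in>bernoulli_space d. \<forall>k.
        (\<forall>i<k. x i = y i) \<longrightarrow> \<bar>\<phi> x - \<phi> y\<bar> \<le> C * \<theta> ^ k)"

lemma finite_words: "finite A \<Longrightarrow> finite (words A n)"
  unfolding words_def by (rule finite_lists_length_eq)

lemma words_0 [simp]: "words A 0 = {[]}"
  by (auto simp: words_def)

lemma sum_words_Suc:
  "(\<Sum>w\<in>words A (Suc n). F w) = (\<Sum>w\<in>words A n. \<Sum>a\<in>A. F (a # w))"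
proof -
  have "bij_betw (\<lambda>(w, a). a # w) (words A n \<times> A) (words A (Suc n))"
    by (rule bij_betwI[where g = "\<lambda>w. (tl w, hd w)"])
       (auto simp: words_def length_Suc_conv)
  then have "(\<Sum>w\<in>words A (Suc n). F w) = (\<Sum>(w, a)\<in>words A n \<times> A. F (a # w))"
    by (subst sum.reindex_bij_betw[symmetric]) (auto simp: case_prod_unfold)
  then show ?thesis by (simp add: sum.cartesian_product)
qed

lemma sum_words_add:
  "(\<Sum>w\<in>words A (n + m). F w) = (\<Sum>u\<in>words A n. \<Sum>v\<in>words A m. F (u @ v))"
proof -
  have "bij_betw (\<lambda>(u, v). u @ v) (words A n \<times> words A m) (words A (n + m))"
    by (rule bij_betwI[where g = "\<lambda>w. (take n w, drop n w)"])
       (auto simp: words_def dest: in_set_takeD in_set_dropD)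
  then have "(\<Sum>w\<in>words A (n + m). F w) = (\<Sum>(u, v)\<in>words A n \<times> words A m. F (u @ v))"
    by (subst sum.reindex_bij_betw[symmetric]) (auto simp: case_prod_unfold)
  then show ?thesis by (simp add: sum.cartesian_product)
qed

lemma nth_words: "w \<in> words A n \<Longrightarrow> i < n \<Longrightarrow> w ! i \<in> A"
  by (auto simp: words_def)

lemma prefix_in_words: "x \<in> bernoulli_space d \<Longrightarrow> map x [0..<n] \<in> words {1..d} n"
  by (auto simp: words_def bernoulli_space_def)

lemma conc_Nil [simp]: "conc [] x = x"
  by (simp add: conc_def)

lemma conc_Cons: "conc (a # w) x = conc [a] (conc w x)"
  by (auto simp: conc_def fun_eq_iff nth_Cons split: nat.split)

lemma conc_in_space:
  "w \<in> words {1..d} n \<Longrightarrow> x \<in> bernoulli_space d \<Longrightarrow> conc w x \<in> bernoulli_space d"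
  by (force simp: words_def bernoulli_space_def conc_def Pi_iff in_set_conv_nth)

lemma left_shift_conc_Cons [simp]: "left_shift (conc (a # w) x) = conc w x"
  by (auto simp: left_shift_def conc_def)

lemma conc_agree:
  "length w = n \<Longrightarrow> \<forall>i<k. x i = y i \<Longrightarrow> \<forall>i<n + k. conc w x i = conc w y i"
  by (auto simp: conc_def)

lemma birkhoff_sum_0 [simp]: "birkhoff_sum T g 0 x = 0"
  by (simp add: birkhoff_sum_def)

lemma birkhoff_sum_Suc: "birkhoff_sum T g (Suc n) x = g x + birkhoff_sum T g n (T x)"
  unfolding birkhoff_sum_def sum.lessThan_Suc_shift by (simp add: funpow_swap1)

lemma birkhoff_sum_linear:
  "birkhoff_sum T (\<lambda>x. \<phi> x + t * g x) n x = birkhoff_sum T \<phi> n x + t * birkhoff_sum T g n x"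
  by (simp add: birkhoff_sum_def sum.distrib sum_distrib_left)

text \<open>The maps \<open>conc w\<close> with \<open>w\<close> of length \<open>n\<close> are the
  inverse branches of the \<open>n\<close>-fold shift. The innermost application is peeled off, so
  \<open>u\<close> has to vary in the induction.\<close>

lemma transfer_funpow:
  "(transfer d \<phi> ^^ n) u x =
     (\<Sum>w\<in>words {1..d} n. exp (birkhoff_sum left_shift \<phi> n (conc w x)) * u (conc w x))"
proof (induction n arbitrary: u)
  case (Suc n)
  have "(transfer d \<phi> ^^ Suc n) u x = (transfer d \<phi> ^^ n) (transfer d \<phi> u) x"
    by (simp add: funpow_swap1)
  also have "\<dots> = (\<Sum>w\<in>words {1..d} n. \<Sum>a\<in>{1..d}.
      exp (birkhoff_sum left_shift \<phi> (Suc n) (conc (a # w) x)) * u (conc (a # w) x))"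
    unfolding Suc.IH birkhoff_sum_Suc left_shift_conc_Cons transfer_def sum_distrib_left
    by (intro sum.cong refl) (simp add: conc_Cons[symmetric] exp_add mult_ac)
  finally show ?case by (simp add: sum_words_Suc)
qed simp

section \<open>Lipschitz potentials and bounded distortion\<close>

lemma shift_LipschitzD:
  assumes "shift_Lipschitz d \<theta> C \<phi>" "x \<in> bernoulli_space d" "y \<in> bernoulli_space d"
    "\<forall>i<k. x i = y i"
  shows "\<bar>\<phi> x - \<phi> y\<bar> \<le> C * \<theta> ^ k"
  using assms by (auto simp: shift_Lipschitz_def)

lemma shift_Lipschitz_nonneg: "shift_Lipschitz d \<theta> C \<phi> \<Longrightarrow> C \<ge> 0"
  by (simp add: shift_Lipschitz_def)

lemma shift_Lipschitz_linear:
  assumes "shift_Lipschitz d \<theta> C \<phi>" "shift_Lipschitz d \<theta> C' g" "0 < \<theta>"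
  shows "shift_Lipschitz d \<theta> (C + \<bar>t\<bar> * C') (\<lambda>x. \<phi> x + t * g x)"
  unfolding shift_Lipschitz_def
proof (intro conjI ballI allI impI)
  show "0 \<le> C + \<bar>t\<bar> * C'" using shift_Lipschitz_nonneg[OF assms(1)] shift_Lipschitz_nonneg[OF assms(2)] by simp
  fix x y k assume *: "x \<in> bernoulli_space d" "y \<in> bernoulli_space d" "\<forall>i<k. x i = y i"
  have "\<bar>(\<phi> x + t * g x) - (\<phi> y + t * g y)\<bar> \<le> \<bar>\<phi> x - \<phi> y\<bar> + \<bar>t\<bar> * \<bar>g x - g y\<bar>"
    using abs_triangle_ineq[of "\<phi> x - \<phi> y" "t * (g x - g y)"]
    by (simp add: abs_mult[symmetric] algebra_simps)
  also have "\<dots> \<le> C * \<theta> ^ k + \<bar>t\<bar> * (C' * \<theta> ^ k)"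
    using shift_LipschitzD[OF assms(1) *] shift_LipschitzD[OF assms(2) *]
    by (intro add_mono mult_left_mono) auto
  finally show "\<bar>(\<phi> x + t * g x) - (\<phi> y + t * g y)\<bar> \<le> (C + \<bar>t\<bar> * C') * \<theta> ^ k"
    by (simp add: algebra_simps)
qed

lemma shift_Lipschitz_bounded:
  assumes "shift_Lipschitz d \<theta> C \<phi>" "d \<ge> 1"
  obtains U where "U \<ge> 0" "\<And>x. x \<in> bernoulli_space d \<Longrightarrow> \<bar>\<phi> x\<bar> \<le> U"
proof
  have *: "(\<lambda>_. 1) \<in> bernoulli_space d" using assms by (auto simp: bernoulli_space_def)
  show "C + \<bar>\<phi> (\<lambda>_. 1)\<bar> \<ge> 0" using shift_Lipschitz_nonneg[OF assms(1)] by simp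
  show "\<bar>\<phi> x\<bar> \<le> C + \<bar>\<phi> (\<lambda>_. 1)\<bar>" if "x \<in> bernoulli_space d" for x
    using shift_LipschitzD[OF assms(1) that *, of 0] by simp
qed

text \<open>After \<open>i\<close> shifts the points still agree in \<open>n + k - i\<close>
  coordinates, so the differences form a geometric series whose sum does not grow with
  \<open>n\<close>. This lets one point, word or orbit stand for another at the price of a constant
  factor.\<close>

lemma birkhoff_distortion:
  assumes "shift_Lipschitz d \<theta> C \<phi>" "0 < \<theta>" "\<theta> < 1"
    and "x \<in> bernoulli_space d" "y \<in> bernoulli_space d" "\<forall>i<n + k. x i = y i"
  shows "\<bar>birkhoff_sum left_shift \<phi> n x - birkhoff_sum left_shift \<phi> n y\<bar> \<le> C / (1 - \<theta>) * \<theta> ^ k"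
proof -
  have C: "C \<ge> 0" using assms(1) by (rule shift_Lipschitz_nonneg)
  have "\<bar>birkhoff_sum left_shift \<phi> n x - birkhoff_sum left_shift \<phi> n y\<bar>
      \<le> C * \<theta> ^ k * (\<Sum>i<n. \<theta> ^ i)"
    using assms(4-6)
  proof (induction n arbitrary: x y)
    case (Suc n)
    have "\<bar>\<phi> x - \<phi> y\<bar> \<le> C * \<theta> ^ (Suc n + k)"
      using Suc.prems by (intro shift_LipschitzD[OF assms(1)])
    \<comment> \<open>One power of \<theta> is given away to fit the new term to the partial sum of
      the geometric series.\<close>
    also have "\<dots> \<le> C * \<theta> ^ (n + k)"
      using C assms by (intro mult_left_mono) (auto simp: mult_left_le_one_le)
    finally have "\<bar>\<phi> x - \<phi> y\<bar> \<le> C * \<theta> ^ k * \<theta> ^ n"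
      by (simp add: power_add mult_ac)
    moreover have "\<bar>birkhoff_sum left_shift \<phi> n (left_shift x) -
        birkhoff_sum left_shift \<phi> n (left_shift y)\<bar> \<le> C * \<theta> ^ k * (\<Sum>i<n. \<theta> ^ i)"
      using Suc.prems by (intro Suc.IH shift_in_bernoulli_space) (auto simp: left_shift_def)
    ultimately show ?case
      by (simp add: birkhoff_sum_Suc algebra_simps)
  qed simp
  also have "\<dots> \<le> C * \<theta> ^ k * (1 / (1 - \<theta>))"
  proof (rule mult_left_mono)
    show "(\<Sum>i<n. \<theta> ^ i) \<le> 1 / (1 - \<theta>)"
      using assms by (simp add: sum_gp_strict divide_right_mono)
  qed (use C assms in auto)
  finally show ?thesis by simp
qed

lemma transfer_funpow_mono:
  assumes "\<And>y. y \<in> bernoulli_space d \<Longrightarrow> u y \<le> v y" "x \<in> bernoulli_space d"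
  shows "(transfer d \<phi> ^^ n) u x \<le> (transfer d \<phi> ^^ n) v x"
  unfolding transfer_funpow
  by (intro sum_mono mult_left_mono assms(1) conc_in_space[OF _ assms(2)]) auto

lemma transfer_funpow_cmult:
  "(transfer d \<phi> ^^ n) (\<lambda>y. c * u y) x = c * (transfer d \<phi> ^^ n) u x"
  unfolding transfer_funpow sum_distrib_left by (simp add: mult_ac)

text \<open>Branches with the same word are compared term by term, and a common factor survives
  summation. The hypothesis on \<open>u\<close> concerns only such pairs of preimages, and
  \<open>B\<close> is a plain number: it is 0 for constant functions and proportional to
  \<open>\<theta> ^ k\<close> for an eigenfunction.\<close>

lemma transfer_funpow_distortion:
  assumes "shift_Lipschitz d \<theta> C \<phi>" "0 < \<theta>" "\<theta> < 1"
    and xy: "x \<in> bernoulli_space d" "y \<in> bernoulli_space d" "\<forall>i<k. x i = y i"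
    and u: "\<And>w. w \<in> words {1..d} n \<Longrightarrow> u (conc w x) \<le> exp B * u (conc w y)"
    and u0: "\<And>z. z \<in> bernoulli_space d \<Longrightarrow> 0 \<le> u z"
  shows "(transfer d \<phi> ^^ n) u x \<le> exp (C / (1 - \<theta>) * \<theta> ^ k + B) * (transfer d \<phi> ^^ n) u y"
  unfolding transfer_funpow sum_distrib_left
proof (rule sum_mono)
  fix w assume w: "w \<in> words {1..d} n"
  let ?s = "birkhoff_sum left_shift \<phi> n"
  have "\<bar>?s (conc w x) - ?s (conc w y)\<bar> \<le> C / (1 - \<theta>) * \<theta> ^ k"
    using w xy conc_agree[of w n k x y]
    by (intro birkhoff_distortion[OF assms(1-3)] conc_in_space) (auto simp: words_def)
  then have "exp (?s (conc w x)) * u (conc w x)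
      \<le> exp (C / (1 - \<theta>) * \<theta> ^ k + ?s (conc w y)) * (exp B * u (conc w y))"
    using u[OF w] u0[OF conc_in_space[OF w xy(1)]] by (intro mult_mono) auto
  also have "\<dots> = exp (C / (1 - \<theta>) * \<theta> ^ k + B) * (exp (?s (conc w y)) * u (conc w y))"
    by (simp add: exp_add mult_ac)
  finally show "exp (?s (conc w x)) * u (conc w x) \<le> \<dots>" .
qed


section \<open>Pressure and an eigenfunction of the transfer operator\<close>

text \<open>
  The growth rate of an almost additive sequence is found without passing to a
  limit: the upper bounds \<open>(a m + K) / m\<close> dominate the lower bounds \<open>(a n - K) / n\<close>.
\<close>

lemma almost_additive_rate:
  fixes a :: "nat \<Rightarrow> real"
  assumes "\<And>n m. \<bar>a (n + m) - a n - a m\<bar> \<le> K" and "K \<ge> 0"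
  shows "\<exists>p. \<forall>n. \<bar>a n - real n * p\<bar> \<le> K"
proof -
  \<comment> \<open>Adding \<open>K\<close> makes the sequence subadditive, subtracting it makes it
    superadditive.\<close>
  have up: "a (n * m) + K \<le> n * (a m + K)" and lo: "n * (a m - K) \<le> a (n * m) - K"
    if "n \<ge> 1" for n m
    using that
  proof (induction n rule: dec_induct)
    case (step n)
    { case 1 then show ?case using step(3) assms(1)[of m "n * m"] by (simp add: algebra_simps abs_le_iff) }
    { case 2 then show ?case using step(4) assms(1)[of m "n * m"] by (simp add: algebra_simps abs_le_iff) }
  qed auto
  \<comment> \<open>Both quotients are compared through \<open>a (n * m)\<close>, seen once as
    \<open>n\<close> blocks of length \<open>m\<close> and once as \<open>m\<close> blocks of length
    \<open>n\<close>.\<close>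
  have le: "(a n - K) / n \<le> (a m + K) / m" if "n \<ge> 1" "m \<ge> 1" for n m
  proof -
    have "m * (a n - K) \<le> n * (a m + K)"
      using up[OF that(1), of m] lo[OF that(2), of n] assms(2) by (simp add: mult.commute)
    then show ?thesis using that by (simp add: field_simps)
  qed
  define p where "p = (INF m\<in>{1..}. (a m + K) / real m)"
  have "\<bar>a n - real n * p\<bar> \<le> K" for n :: nat
  proof (cases "n = 0")
    case True
    then show ?thesis using assms(1)[of 0 0] by simp
  next
    case False
    have "(a n - K) / n \<le> p" "p \<le> (a n + K) / n"
      unfolding p_def using False le
      by (auto intro!: cINF_greatest cINF_lower bdd_belowI2[of _ "a 1 - K"] dest: le[of 1, simplified])
    then show ?thesis using False by (simp add: field_simps abs_le_iff)
  qed
  then show ?thesis by blast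
qed

locale shift_potential =
  fixes d :: nat and \<theta> C :: real and \<phi> :: "(nat \<Rightarrow> nat) \<Rightarrow> real"
  assumes d: "d \<ge> 1" and \<theta>: "0 < \<theta>" "\<theta> < 1" and Lip: "shift_Lipschitz d \<theta> C \<phi>"
begin

abbreviation "L \<equiv> transfer d \<phi>"
abbreviation "X \<equiv> bernoulli_space d"
text \<open>The distortion bound for \<open>k = 0\<close>: Birkhoff sums of length \<open>n\<close>
  differ by at most \<open>D\<close> when the first \<open>n\<close> coordinates agree.\<close>

definition "D = C / (1 - \<theta>)"

lemma D_nonneg: "D \<ge> 0"
  using shift_Lipschitz_nonneg[OF Lip] \<theta> by (simp add: D_def)

lemma const_in_space: "(\<lambda>_. 1) \<in> X"
  using d by (auto simp: bernoulli_space_def)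

lemma words_nonempty: "words {1..d} n \<noteq> {}"
proof -
  have "replicate n 1 \<in> words {1..d} n" using d by (auto simp: words_def)
  then show ?thesis by blast
qed

lemma transfer_funpow_one_pos: "0 < (L ^^ n) (\<lambda>_. 1) x"
  unfolding transfer_funpow
  using finite_words[of "{1..d}" n] words_nonempty by (intro sum_pos) auto

lemma transfer_funpow_one_distortion:
  assumes "x \<in> X" "y \<in> X" "\<forall>i<k. x i = y i"
  shows "(L ^^ n) (\<lambda>_. 1) x \<le> exp (D * \<theta> ^ k) * (L ^^ n) (\<lambda>_. 1) y"
  using transfer_funpow_distortion[OF Lip \<theta> assms, of n "\<lambda>_. 1" 0] by (simp add: D_def)

text \<open>\<open>L ^^ m\<close> maps 1 to a function that is constant up to the factor
  \<open>exp D\<close>, so the logarithms of \<open>(L ^^ n) (\<lambda>_. 1)\<close> at one point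
  are almost additive. One \<open>D\<close> in the bound is the error of almost additivity, the
  other pays for moving the base point.\<close>

lemma pressure_exists:
  "\<exists>p. \<forall>n. \<forall>x\<in>X.
    exp (n * p - 2 * D) \<le> (L ^^ n) (\<lambda>_. 1) x \<and> (L ^^ n) (\<lambda>_. 1) x \<le> exp (n * p + 2 * D)"
proof -
  let ?o = "\<lambda>_. 1 :: nat"
  define A where "A n = (L ^^ n) (\<lambda>_. 1) ?o" for n
  have A0: "A n > 0" for n
    unfolding A_def by (rule transfer_funpow_one_pos)
  have cmp: "exp (- D) * A n \<le> (L ^^ n) (\<lambda>_. 1) x" "(L ^^ n) (\<lambda>_. 1) x \<le> exp D * A n"
    if "x \<in> X" for n x
    using transfer_funpow_one_distortion[OF const_in_space that, of 0 n]
      transfer_funpow_one_distortion[OF that const_in_space, of 0 n]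
    by (simp_all add: A_def exp_minus field_simps)
  have "A (n + m) \<le> exp D * A m * A n" "exp (- D) * A m * A n \<le> A (n + m)" for n m
  proof -
    have "A (n + m) = (L ^^ n) ((L ^^ m) (\<lambda>_. 1)) ?o"
      by (simp add: A_def funpow_add)
    moreover have "\<dots> \<le> (L ^^ n) (\<lambda>_. (exp D * A m) * 1) ?o"
      using cmp by (intro transfer_funpow_mono const_in_space) simp
    moreover have "(L ^^ n) (\<lambda>_. (exp (- D) * A m) * 1) ?o \<le> (L ^^ n) ((L ^^ m) (\<lambda>_. 1)) ?o"
      using cmp by (intro transfer_funpow_mono const_in_space) simp
    ultimately show "A (n + m) \<le> exp D * A m * A n" "exp (- D) * A m * A n \<le> A (n + m)"
      unfolding transfer_funpow_cmult by (simp_all add: A_def)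
  qed
  then have "ln (A (n + m)) \<le> ln (exp D * A m * A n)" "ln (exp (- D) * A m * A n) \<le> ln (A (n + m))"
    for n m using A0 by (simp_all add: ln_mono)
  moreover have "ln (exp s * A m * A n) = s + ln (A m) + ln (A n)" for s n m
    using A0[of n] A0[of m] by (simp add: ln_mult_pos)
  ultimately have ab: "ln (A (n + m)) \<le> D + ln (A m) + ln (A n)"
    "- D + ln (A m) + ln (A n) \<le> ln (A (n + m))" for n m
    by metis+
  have add: "\<bar>ln (A (n + m)) - ln (A n) - ln (A m)\<bar> \<le> D" for n m
    using ab(1)[of n m] ab(2)[of m n] by linarith
  obtain p where p: "\<forall>n. \<bar>ln (A n) - real n * p\<bar> \<le> D"
    using almost_additive_rate[OF add D_nonneg] by blast
  have "exp (real n * p - 2 * D) \<le> (L ^^ n) (\<lambda>_. 1) x \<and> (L ^^ n) (\<lambda>_. 1) x \<le> exp (real n * p + 2 * D)"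
    if "x \<in> X" for n x
  proof -
    have A: "A n = exp (ln (A n))" using A0 by simp
    have "exp (n * p - 2 * D) \<le> exp (- D) * exp (ln (A n))"
      "exp D * exp (ln (A n)) \<le> exp (n * p + 2 * D)"
      using spec[OF p, of n] by (auto simp: exp_add[symmetric] abs_le_iff)
    then show ?thesis using cmp[OF that, of n] A by auto
  qed
  then show ?thesis by blast
qed

end

section \<open>Normalised iterates and the positive eigenfunction\<close>

locale shift_pressure = shift_potential +
  fixes p :: real
  assumes pressure: "\<And>n x. x \<in> X \<Longrightarrow>
    exp (n * p - 2 * D) \<le> (L ^^ n) (\<lambda>_. 1) x \<and> (L ^^ n) (\<lambda>_. 1) x \<le> exp (n * p + 2 * D)"
begin

definition "normalized n u x = exp (- (n * p)) * (L ^^ n) u x"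

lemma normalized_mono:
  "(\<And>y. y \<in> X \<Longrightarrow> u y \<le> v y) \<Longrightarrow> x \<in> X \<Longrightarrow> normalized n u x \<le> normalized n v x"
  by (auto simp: normalized_def intro!: transfer_funpow_mono)

lemma normalized_add: "normalized (n + m) u x = normalized n (normalized m u) x"
  unfolding normalized_def[abs_def] transfer_funpow_cmult funpow_add
  by (simp add: exp_add[symmetric] algebra_simps)

lemma normalized_const: "normalized n (\<lambda>_. c) x = c * normalized n (\<lambda>_. 1) x"
  using transfer_funpow_cmult[where u = "\<lambda>_. 1" and c = c] by (simp add: normalized_def)

lemma normalized_one_bounds:
  assumes "x \<in> X"
  shows "exp (- 2 * D) \<le> normalized n (\<lambda>_. 1) x" "normalized n (\<lambda>_. 1) x \<le> exp (2 * D)"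
  using pressure[OF assms, of n]
  by (simp_all add: normalized_def exp_diff exp_add exp_minus field_simps)

lemma normalized_tendsto:
  assumes "\<And>y. y \<in> X \<Longrightarrow> (\<lambda>k. u k y) \<longlonglongrightarrow> v y" "x \<in> X"
  shows "(\<lambda>k. normalized n (u k) x) \<longlonglongrightarrow> normalized n v x"
  unfolding normalized_def transfer_funpow
  by (intro tendsto_intros assms conc_in_space[OF _ assms(2)])

text \<open>
  A supersolution is the pointwise \<open>lim inf\<close> of the normalized iterates of \<open>1\<close>; its own
  iterates decrease to an eigenfunction. Since \<open>L\<close> is a finite sum, pointwise limits suffice.
\<close>

lemma eigenfunction_exists:
  "\<exists>h. (\<forall>x\<in>X. exp (- 4 * D) \<le> h x \<and> h x \<le> exp (2 * D)) \<and>
    (\<forall>x\<in>X. L h x = exp p * h x) \<and>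
    (\<forall>x\<in>X. \<forall>y\<in>X. \<forall>k. (\<forall>i<k. x i = y i) \<longrightarrow> h x \<le> exp (2 * D * \<theta> ^ k) * h y)"
proof -
  define N where "N n = normalized n (\<lambda>_. 1)" for n
  define U where "U k x = (INF n\<in>{k..}. N n x)" for k x
  have bdd: "bdd_below ((\<lambda>n. N n x) ` {k..})" if "x \<in> X" for k x
    unfolding N_def using normalized_one_bounds(1)[OF that] by (intro bdd_belowI2) auto
  have U_le: "U k x \<le> N n x" if "x \<in> X" "k \<le> n" for k n x
    unfolding U_def using that bdd by (intro cINF_lower) auto
  have U_ge: "c \<le> U k x" if "\<And>n. n \<ge> k \<Longrightarrow> c \<le> N n x" for k c x
    unfolding U_def using that by (intro cINF_greatest) auto
  have U_bounds: "exp (- 2 * D) \<le> U k x" "U k x \<le> exp (2 * D)" if "x \<in> X" for k x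
    using that U_le[OF that order_refl, of k] normalized_one_bounds(2)[OF that, of k]
      normalized_one_bounds(1)[OF that] by (auto simp: N_def intro!: U_ge)
  have U_inc: "incseq (\<lambda>k. U k x)" if "x \<in> X" for x
    using that by (intro incseq_SucI U_ge U_le) auto
  define h0 where "h0 x = lim (\<lambda>k. U k x)" for x
  have h0: "(\<lambda>k. U k x) \<longlonglongrightarrow> h0 x" if "x \<in> X" for x
    using incseq_convergent[OF U_inc[OF that]] U_bounds[OF that]
    by (metis h0_def limI)
  have h0_bounds: "exp (- 2 * D) \<le> h0 x" "h0 x \<le> exp (2 * D)" if "x \<in> X" for x
    using h0[OF that] U_bounds[OF that] by (auto intro: LIMSEQ_le_const LIMSEQ_le_const2)
  have U_dist: "U k x \<le> exp (D * \<theta> ^ j) * U k y"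
    if "x \<in> X" "y \<in> X" "\<forall>i<j. x i = y i" for k x y j
  proof -
    have "exp (- (D * \<theta> ^ j)) * U k x \<le> U k y"
    proof (rule U_ge)
      fix n assume "n \<ge> k"
      have "U k x \<le> N n x" using that \<open>n \<ge> k\<close> by (intro U_le)
      also have "\<dots> \<le> exp (D * \<theta> ^ j) * N n y"
        using transfer_funpow_one_distortion[OF that, of n] by (simp add: N_def normalized_def)
      finally show "exp (- (D * \<theta> ^ j)) * U k x \<le> N n y" by (simp add: exp_minus field_simps)
    qed
    then show ?thesis by (simp add: exp_minus field_simps)
  qed
  have h0_dist: "h0 x \<le> exp (D * \<theta> ^ j) * h0 y"
    if "x \<in> X" "y \<in> X" "\<forall>i<j. x i = y i" for x y j
    using U_dist[OF that] by (intro tendsto_le[OF _ tendsto_mult[OF tendsto_const h0] h0]) (auto simp: that)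
  have super: "normalized 1 h0 x \<le> h0 x" if "x \<in> X" for x
  proof (rule tendsto_le[OF sequentially_bot])
    show "(\<lambda>k. U (Suc k) x) \<longlonglongrightarrow> h0 x" using h0[OF that] by (rule LIMSEQ_Suc)
    show "(\<lambda>k. normalized 1 (U k) x) \<longlonglongrightarrow> normalized 1 h0 x"
      using that by (intro normalized_tendsto h0)
    \<comment> \<open>One step sends \<open>N (n - 1)\<close> to \<open>N n\<close>, so a lower
      bound of the tail from \<open>k\<close> becomes one of the tail from \<open>Suc k\<close>.
      Only an inequality results, since an infimum need not commute with the sum over
      branches.\<close>
    have "normalized 1 (U k) x \<le> U (Suc k) x" for k
    proof (rule U_ge)
      fix n assume n: "Suc k \<le> n"
      have "normalized 1 (U k) x \<le> normalized 1 (N (n - 1)) x"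
        using n that by (intro normalized_mono U_le) auto
      also have "\<dots> = N n x"
        using n unfolding N_def normalized_add[symmetric] by simp
      finally show "normalized 1 (U k) x \<le> N n x" .
    qed
    then show "\<forall>\<^sub>F k in sequentially. normalized 1 (U k) x \<le> U (Suc k) x" by simp
  qed
  define V where "V n = normalized n h0" for n
  have V_dec: "decseq (\<lambda>n. V n x)" if "x \<in> X" for x
  proof (rule decseq_SucI)
    fix n show "V (Suc n) x \<le> V n x"
      unfolding V_def using normalized_add[of n 1 h0 x] normalized_mono[of "normalized 1 h0" h0 x n]
        super that by simp
  qed
  \<comment> \<open>This keeps the decreasing limit away from 0. The exponent \<open>- 4 * D\<close>
    of the statement arises here: the lower bound of \<open>h0\<close> times that of the normalised
    iterates of 1.\<close>
  have V_lower: "exp (- 2 * D) * exp (- 2 * D) \<le> V n x" if "x \<in> X" for n x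
  proof -
    have "exp (- 2 * D) * exp (- 2 * D) \<le> exp (- 2 * D) * normalized n (\<lambda>_. 1) x"
      using normalized_one_bounds(1)[OF that, of n] by simp
    also have "\<dots> = normalized n (\<lambda>_. exp (- 2 * D)) x" by (rule normalized_const[symmetric])
    also have "\<dots> \<le> V n x" unfolding V_def using h0_bounds that by (intro normalized_mono)
    finally show ?thesis .
  qed
  define h where "h x = lim (\<lambda>n. V n x)" for x
  have h: "(\<lambda>n. V n x) \<longlonglongrightarrow> h x" if "x \<in> X" for x
    using decseq_convergent[OF V_dec[OF that]] V_lower[OF that] by (metis h_def limI)
  \<comment> \<open>One \<open>D\<close> comes from the Birkhoff sums and one from the distortion of
    \<open>h0\<close>; the bound is independent of \<open>n\<close> and passes to the limit.\<close>
  have V_dist: "V n x \<le> exp (2 * D * \<theta> ^ j) * V n y"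
    if "x \<in> X" "y \<in> X" "\<forall>i<j. x i = y i" for n x y j
  proof -
    have "h0 (conc w x) \<le> exp (D * \<theta> ^ j) * h0 (conc w y)" if w: "w \<in> words {1..d} n" for w
      using w that \<open>x \<in> X\<close> \<open>y \<in> X\<close> conc_agree[of w n j x y] \<open>\<forall>i<j. x i = y i\<close>
      by (intro h0_dist conc_in_space) (auto simp: words_def)
    then have "(L ^^ n) h0 x \<le> exp (C / (1 - \<theta>) * \<theta> ^ j + D * \<theta> ^ j) * (L ^^ n) h0 y"
      using h0_bounds by (intro transfer_funpow_distortion[OF Lip \<theta> that]) (auto intro: order_trans[OF exp_ge_zero])
    then show ?thesis by (simp add: V_def normalized_def D_def algebra_simps)
  qed
  have "exp (- 4 * D) \<le> h x \<and> h x \<le> exp (2 * D)" if "x \<in> X" for x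
  proof
    show "exp (- 4 * D) \<le> h x"
      using h[OF that] V_lower[OF that] by (intro LIMSEQ_le_const) (auto simp: exp_add[symmetric])
    have "V 0 x \<le> exp (2 * D)" using h0_bounds[OF that] by (simp add: V_def normalized_def)
    then show "h x \<le> exp (2 * D)"
      using h[OF that] decseqD[OF V_dec[OF that], of 0]
      by (intro LIMSEQ_le_const2) (auto intro: order_trans)
  qed
  moreover have "L h x = exp p * h x" if "x \<in> X" for x
  proof -
    have "(\<lambda>n. normalized 1 (V n) x) \<longlonglongrightarrow> normalized 1 h x"
      using that by (intro normalized_tendsto h)
    moreover have "(\<lambda>n. normalized 1 (V n) x) = (\<lambda>n. V (Suc n) x)"
      unfolding V_def normalized_add[symmetric] by simp
    ultimately have "normalized 1 h x = h x"
      using LIMSEQ_Suc[OF h[OF that]] LIMSEQ_unique by metis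
    then show ?thesis by (simp add: normalized_def exp_minus field_simps)
  qed
  moreover have "h x \<le> exp (2 * D * \<theta> ^ j) * h y"
    if "x \<in> X" "y \<in> X" "\<forall>i<j. x i = y i" for x y j
    using V_dist[OF that] by (intro tendsto_le[OF _ tendsto_mult[OF tendsto_const h] h]) (auto simp: that)
  ultimately show ?thesis by blast
qed

end


section \<open>The normalised operator and perturbation of the potential\<close>

text \<open>For negative \<open>y\<close> this is the reciprocal of
  \<open>1 - y \<le> exp (- y)\<close> combined with
  \<open>(1 + y + y ^ 2) * (1 - y) = 1 - y ^ 3\<close>. The exact first-order term is what makes the
  perturbation error quadratic in \<open>t\<close> later.\<close>

lemma exp_le_quadratic:
  fixes y :: real
  assumes "\<bar>y\<bar> \<le> 1"
  shows "exp y \<le> 1 + y + y\<^sup>2"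
proof (cases "y \<ge> 0")
  case True
  then show ?thesis using exp_bound[of y] assms by simp
next
  case False
  have "1 - y \<le> exp (- y)" using exp_ge_add_one_self[of "- y"] by simp
  then have "exp y \<le> 1 / (1 - y)"
    using False by (simp add: exp_minus field_simps)
  also have "\<dots> \<le> 1 + y + y\<^sup>2"
  proof -
    have "y * y\<^sup>2 \<le> 0" using False by (intro mult_nonpos_nonneg) auto
    then have "1 \<le> (1 + y + y\<^sup>2) * (1 - y)" by (simp add: algebra_simps power2_eq_square)
    then show ?thesis using False by (simp add: pos_divide_le_eq)
  qed
  finally show ?thesis .
qed

locale shift_eigenfunction = shift_pressure +
  fixes h :: "(nat \<Rightarrow> nat) \<Rightarrow> real"
  assumes h_bounds: "\<And>x. x \<in> X \<Longrightarrow> exp (- 4 * D) \<le> h x \<and> h x \<le> exp (2 * D)"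
    and h_eigen: "\<And>x. x \<in> X \<Longrightarrow> L h x = exp p * h x"
    and h_distortion: "\<And>x y k. x \<in> X \<Longrightarrow> y \<in> X \<Longrightarrow> \<forall>i<k. x i = y i \<Longrightarrow>
      h x \<le> exp (2 * D * \<theta> ^ k) * h y"
begin

text \<open>Conjugation by \<open>h\<close> (a Doob transform): the weights of the inverse branches
  now sum to 1 at every point of \<open>X\<close>.\<close>

definition "markov n u x = normalized n (\<lambda>y. h y * u y) x / h x"

lemma h_pos: "x \<in> X \<Longrightarrow> h x > 0"
  using h_bounds[of x] by (meson exp_gt_zero less_le_trans)

lemma markov_mono:
  assumes "\<And>y. y \<in> X \<Longrightarrow> u y \<le> v y" "x \<in> X"
  shows "markov n u x \<le> markov n v x"
  unfolding markov_def
  by (intro divide_right_mono normalized_mono mult_left_mono assms less_imp_le h_pos)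

lemma markov_cong:
  assumes "\<And>y. y \<in> X \<Longrightarrow> u y = v y" "x \<in> X"
  shows "markov n u x = markov n v x"
  by (intro antisym markov_mono) (use assms in auto)

lemma markov_plus: "markov n (\<lambda>y. u y + v y) x = markov n u x + markov n v x"
  by (simp add: markov_def normalized_def transfer_funpow sum.distrib algebra_simps add_divide_distrib)

lemma markov_cmult: "markov n (\<lambda>y. c * u y) x = c * markov n u x"
  by (simp add: markov_def normalized_def transfer_funpow sum_distrib_left mult_ac)

lemma markov_sum: "markov n (\<lambda>y. \<Sum>i<(k::nat). u i y) x = (\<Sum>i<k. markov n (u i) x)"
  by (induction k) (auto simp: markov_plus, simp add: markov_def normalized_def transfer_funpow)

lemma markov_add:
  assumes "x \<in> X"
  shows "markov (n + m) u x = markov n (markov m u) x"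
proof -
  have "normalized n (\<lambda>y. h y * markov m u y) x = normalized n (normalized m (\<lambda>y. h y * u y)) x"
    by (intro antisym normalized_mono assms) (auto simp: markov_def dest: h_pos)
  then show ?thesis by (simp add: markov_def normalized_add)
qed

lemma markov_one:
  assumes "x \<in> X"
  shows "markov n (\<lambda>_. 1) x = 1"
  using assms
proof (induction n)
  case 0
  then show ?case using h_pos[OF assms] by (simp add: markov_def normalized_def)
next
  case (Suc n)
  have one: "markov 1 (\<lambda>_. 1) y = 1" if "y \<in> X" for y
    using h_pos[OF that] h_eigen[OF that]
    by (simp add: markov_def normalized_def exp_minus)
  have "markov (n + 1) (\<lambda>_. 1) x = markov n (\<lambda>_. 1) x"
    unfolding markov_add[OF assms] by (intro markov_cong one assms)
  then show ?case using Suc by simp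
qed

lemma markov_const: "x \<in> X \<Longrightarrow> markov n (\<lambda>_. c) x = c"
  using markov_cmult[of n c "\<lambda>_. 1" x] by (simp add: markov_one)

text \<open>All branch terms are nonnegative, so one of them may be kept and the rest dropped. The
  constant bounds that term from below: the Birkhoff sum is at least \<open>- n * U\<close>, the
  eigenfunction at least \<open>exp (- 4 * D)\<close> on the branch and at most
  \<open>exp (2 * D)\<close> at \<open>x\<close>. That it depends on neither \<open>x\<close> nor
  \<open>w\<close> is the uniform mixing behind the convergence.\<close>

lemma markov_cylinder_lower:
  "\<exists>\<delta>>0. \<forall>x\<in>X. \<forall>w\<in>words {1..d} n. \<forall>u. (\<forall>y\<in>X. 0 \<le> u y) \<longrightarrow> \<delta> * u (conc w x) \<le> markov n u x"
proof -
  obtain U where U: "U \<ge> 0" "\<And>x. x \<in> X \<Longrightarrow> \<bar>\<phi> x\<bar> \<le> U"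
    using shift_Lipschitz_bounded[OF Lip d] by metis
  define \<delta> where "\<delta> = exp (- (n * p)) * exp (- (n * U)) * exp (- 4 * D) / exp (2 * D)"
  have "\<delta> * u (conc w x) \<le> markov n u x"
    if x: "x \<in> X" and w: "w \<in> words {1..d} n" and u: "\<forall>y\<in>X. 0 \<le> u y" for x w u
  proof -
    let ?s = "birkhoff_sum left_shift \<phi> n"
    have "\<bar>?s (conc w x)\<bar> \<le> (\<Sum>i<n. U)"
      unfolding birkhoff_sum_def
      by (intro sum_abs[THEN order_trans] sum_mono U funpow_shift_in_bernoulli_space conc_in_space[OF w x])
    then have "exp (- (n * U)) * exp (- 4 * D) * u (conc w x)
        \<le> exp (?s (conc w x)) * h (conc w x) * u (conc w x)"
      using u conc_in_space[OF w x] h_bounds[of "conc w x"] by (intro mult_mono mult_right_mono) auto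
    also have "\<dots> \<le> (L ^^ n) (\<lambda>y. h y * u y) x"
      unfolding transfer_funpow mult.assoc
      using u conc_in_space[OF _ x] h_pos w finite_words[of "{1..d}" n]
      by (intro member_le_sum) (auto intro!: mult_nonneg_nonneg less_imp_le[OF h_pos])
    finally have "exp (- (n * p)) * (exp (- (n * U)) * exp (- 4 * D) * u (conc w x)) / exp (2 * D)
        \<le> normalized n (\<lambda>y. h y * u y) x / h x"
      unfolding normalized_def
      using h_pos[OF x] h_bounds[OF x] u conc_in_space[OF w x]
      by (intro frac_le mult_left_mono mult_nonneg_nonneg) (auto intro: order_trans[rotated])
    then show ?thesis by (simp add: \<delta>_def markov_def mult_ac)
  qed
  moreover have "\<delta> > 0" by (simp add: \<delta>_def)
  ultimately show ?thesis by blast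
qed

text \<open>Of the \<open>5 * D\<close>, one \<open>D\<close> is the distortion of the Birkhoff
  sums, \<open>2 * D\<close> that of \<open>h\<close> on the preimages and \<open>2 * D\<close> that
  of \<open>h\<close> in the denominator. The bound does not grow with \<open>n\<close>, so all
  iterates of \<open>u\<close> oscillate equally little on long cylinders.\<close>

lemma markov_distortion:
  assumes u0: "\<And>y. y \<in> X \<Longrightarrow> 0 \<le> u y" and B: "B \<ge> 0"
    and u: "\<And>x y k. x \<in> X \<Longrightarrow> y \<in> X \<Longrightarrow> \<forall>i<k. x i = y i \<Longrightarrow> u x \<le> exp (B * \<theta> ^ k) * u y"
    and xy: "x \<in> X" "y \<in> X" "\<forall>i<k. x i = y i"
  shows "markov n u x \<le> exp ((5 * D + B) * \<theta> ^ k) * markov n u y"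
proof -
  have "(L ^^ n) (\<lambda>y. h y * u y) x
      \<le> exp (C / (1 - \<theta>) * \<theta> ^ k + (2 * D + B) * \<theta> ^ k) * (L ^^ n) (\<lambda>y. h y * u y) y"
  proof (rule transfer_funpow_distortion[OF Lip \<theta> xy])
    fix w assume w: "w \<in> words {1..d} n"
    note in_X = conc_in_space[OF w xy(1)] conc_in_space[OF w xy(2)]
    have ag: "\<forall>i<k. conc w x i = conc w y i"
      using conc_agree[of w n k x y] w xy(3) by (auto simp: words_def)
    have "h (conc w x) * u (conc w x)
        \<le> (exp (2 * D * \<theta> ^ k) * h (conc w y)) * (exp (B * \<theta> ^ k) * u (conc w y))"
      using h_pos in_X u0 by (intro mult_mono h_distortion u ag mult_nonneg_nonneg) (auto simp: less_imp_le)
    then show "h (conc w x) * u (conc w x) \<le> exp ((2 * D + B) * \<theta> ^ k) * (h (conc w y) * u (conc w y))"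
      unfolding distrib_right exp_add by (simp only: mult_ac)
  qed (use u0 h_pos in \<open>auto intro!: mult_nonneg_nonneg simp: less_imp_le\<close>)
  then have "normalized n (\<lambda>y. h y * u y) x
      \<le> exp ((3 * D + B) * \<theta> ^ k) * normalized n (\<lambda>y. h y * u y) y"
    by (simp add: normalized_def D_def algebra_simps)
  also have "\<dots> = exp ((3 * D + B) * \<theta> ^ k) * markov n u y * h y"
    using h_pos[OF xy(2)] by (simp add: markov_def)
  also have "\<dots> \<le> exp ((3 * D + B) * \<theta> ^ k) * markov n u y * (exp (2 * D * \<theta> ^ k) * h x)"
    using markov_mono[of "\<lambda>_. 0" u y n] markov_const[OF xy(2), of n 0] u0 xy
    by (intro mult_left_mono h_distortion mult_nonneg_nonneg) auto
  also have "\<dots> = exp ((5 * D + B) * \<theta> ^ k) * markov n u y * h x"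
  proof -
    have "(5 * D + B) * \<theta> ^ k = (3 * D + B) * \<theta> ^ k + 2 * D * \<theta> ^ k" by (simp add: algebra_simps)
    then show ?thesis by (simp only: exp_add mult_ac)
  qed
  finally show ?thesis
    using h_pos[OF xy(1)] by (simp add: markov_def field_simps)
qed

text \<open>
  On the \<open>k\<close>-cylinder of a point where \<open>markov n u\<close> is nearly maximal it is, by distortion, nearly
  maximal everywhere. Every point sees that cylinder with a probability bounded below, so \<open>k\<close>
  further steps raise the infimum by a fixed proportion of the oscillation.
\<close>

lemma markov_converges_nonneg:
  assumes u0: "\<And>y. y \<in> X \<Longrightarrow> 0 \<le> u y" "\<And>y. y \<in> X \<Longrightarrow> u y \<le> U" and B: "B \<ge> 0"
    and u: "\<And>x y k. x \<in> X \<Longrightarrow> y \<in> X \<Longrightarrow> \<forall>i<k. x i = y i \<Longrightarrow> u x \<le> exp (B * \<theta> ^ k) * u y"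
  shows "\<exists>m. \<forall>\<epsilon>>0. \<exists>N. \<forall>n\<ge>N. \<forall>x\<in>X. \<bar>markov n u x - m\<bar> \<le> \<epsilon>"
proof -
  have Xne: "X \<noteq> {}" using const_in_space by blast
  define l where "l n = (INF x\<in>X. markov n u x)" for n
  define r where "r n = (SUP x\<in>X. markov n u x)" for n
  have bd: "0 \<le> markov n u x" "markov n u x \<le> U" if "x \<in> X" for n x
    using markov_mono[of "\<lambda>_. 0" u x n] markov_mono[of u "\<lambda>_. U" x n] markov_const[OF that] u0 that
    by auto
  have bdd: "bdd_below ((\<lambda>x. markov n u x) ` X)" "bdd_above ((\<lambda>x. markov n u x) ` X)" for n
    using bd by (auto intro!: bdd_belowI2 bdd_aboveI2)
  have l_le: "l n \<le> markov n u x" and r_ge: "markov n u x \<le> r n" if "x \<in> X" for n x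
    unfolding l_def r_def using that bdd by (auto intro: cINF_lower cSUP_upper)
  have l_inc: "incseq l"
  proof (rule incseq_SucI)
    fix n
    have "l n \<le> markov (1 + n) u x" if "x \<in> X" for x
      unfolding markov_add[OF that]
      using markov_mono[of "\<lambda>_. l n" "markov n u" x 1] l_le markov_const[OF that] that by auto
    then show "l n \<le> l (Suc n)" unfolding l_def[of "Suc n"] using Xne by (auto intro: cINF_greatest)
  qed
  have r_dec: "decseq r"
  proof (rule decseq_SucI)
    fix n
    have "markov (1 + n) u x \<le> r n" if "x \<in> X" for x
      unfolding markov_add[OF that]
      using markov_mono[of "markov n u" "\<lambda>_. r n" x 1] r_ge markov_const[OF that] that by auto
    then show "r (Suc n) \<le> r n" unfolding r_def[of "Suc n"] using Xne by (auto intro: cSUP_least)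
  qed
  have lr: "l n \<le> r n" "0 \<le> l n" "r n \<le> U" for n
    using l_le[OF const_in_space, of n] r_ge[OF const_in_space, of n] bd Xne
    by (auto simp: l_def r_def intro: cINF_greatest cSUP_least)
  obtain a where a: "l \<longlonglongrightarrow> a"
    using incseq_convergent[OF l_inc, of U] lr by (meson order_trans)
  obtain b where b: "r \<longlonglongrightarrow> b"
    using decseq_convergent[OF r_dec, of 0] lr by (meson order_trans)
  have ba: "b \<le> exp ((5 * D + B) * \<theta> ^ k) * a" for k
  proof -
    let ?E = "exp ((5 * D + B) * \<theta> ^ k)"
    obtain \<delta> where \<delta>: "\<delta> > 0" "\<And>x w v. x \<in> X \<Longrightarrow> w \<in> words {1..d} k \<Longrightarrow> \<forall>y\<in>X. 0 \<le> v y \<Longrightarrow>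
        \<delta> * v (conc w x) \<le> markov k v x"
      using markov_cylinder_lower[of k] by blast
    have step: "r n \<le> ?E * (l n + (l (k + n) - l n) / \<delta>)" for n
      unfolding r_def
    proof (rule cSUP_least[OF Xne])
      fix y assume y: "y \<in> X"
      define w where "w = map y [0..<k]"
      have w: "w \<in> words {1..d} k"
        using y by (auto simp: w_def words_def bernoulli_space_def)
      have "l n + \<delta> * (markov n u y / ?E - l n) \<le> markov (k + n) u x" if x: "x \<in> X" for x
      proof -
        have "\<forall>i<k. y i = conc w x i" by (auto simp: w_def conc_def)
        then have "markov n u y \<le> ?E * markov n u (conc w x)"
          by (intro markov_distortion[OF u0(1) B u] y conc_in_space[OF w x])
        then have "markov n u y / ?E \<le> markov n u (conc w x)"
          by (simp add: pos_divide_le_eq mult.commute)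
        then have "\<delta> * (markov n u y / ?E - l n) \<le> \<delta> * (markov n u (conc w x) - l n)"
          using \<delta>(1) by (intro mult_left_mono) auto
        \<comment> \<open>Subtracting the infimum leaves a nonnegative function, as the cylinder
          bound requires.\<close>
        also have "\<dots> \<le> markov k (\<lambda>z. markov n u z + (- l n)) x"
          using \<delta>(2)[OF x w, of "\<lambda>z. markov n u z + (- l n)"] l_le by auto
        also have "\<dots> = markov (k + n) u x - l n"
          unfolding markov_plus markov_add[OF x] using markov_const[OF x] by simp
        finally show ?thesis by simp
      qed
      then have "l n + \<delta> * (markov n u y / ?E - l n) \<le> l (k + n)"
        unfolding l_def[of "k + n"] using Xne by (intro cINF_greatest)
      then have "markov n u y / ?E \<le> l n + (l (k + n) - l n) / \<delta>"
        using \<delta>(1) by (simp add: field_simps)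
      then show "markov n u y \<le> ?E * (l n + (l (k + n) - l n) / \<delta>)"
        by (simp add: pos_divide_le_eq mult.commute)
    qed
    \<comment> \<open>For fixed \<open>k\<close> the gain \<open>l (k + n) - l n\<close> tends to 0
      because \<open>l\<close> converges, however small \<delta> is. The factor \<open>?E\<close> is
      removed afterwards by letting \<open>k\<close> grow.\<close>
    have "(\<lambda>n. l (k + n)) \<longlonglongrightarrow> a"
      using LIMSEQ_ignore_initial_segment[OF a, of k] by (simp add: add.commute)
    then have "(\<lambda>n. ?E * (l n + (l (k + n) - l n) / \<delta>)) \<longlonglongrightarrow> ?E * (a + (a - a) / \<delta>)"
      using \<delta>(1) by (intro tendsto_intros a) auto
    then show ?thesis using LIMSEQ_le[OF b] step by fastforce
  qed
  have "(\<lambda>k. exp ((5 * D + B) * \<theta> ^ k) * a) \<longlonglongrightarrow> exp ((5 * D + B) * 0) * a"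
    using \<theta> by (intro tendsto_intros LIMSEQ_realpow_zero) auto
  then have "b \<le> a" using ba by (intro LIMSEQ_le_const) auto
  moreover have "a \<le> b" using a b lr by (intro LIMSEQ_le) auto
  ultimately have ab: "b = a" by simp
  have "\<exists>N. \<forall>n\<ge>N. \<forall>x\<in>X. \<bar>markov n u x - a\<bar> \<le> \<epsilon>" if \<epsilon>: "\<epsilon> > 0" for \<epsilon>
  proof -
    have "\<forall>\<^sub>F n in sequentially. \<bar>l n - a\<bar> < \<epsilon> \<and> \<bar>r n - a\<bar> < \<epsilon>"
      using tendstoD[OF a \<epsilon>] tendstoD[OF b \<epsilon>] by eventually_elim (simp add: ab dist_real_def)
    then obtain N where "\<And>n. n \<ge> N \<Longrightarrow> \<bar>l n - a\<bar> < \<epsilon> \<and> \<bar>r n - a\<bar> < \<epsilon>"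
      by (auto simp: eventually_sequentially)
    then have "\<bar>markov n u x - a\<bar> \<le> \<epsilon>" if "n \<ge> N" "x \<in> X" for n x
      using that l_le[of x n] r_ge[of x n] by (smt (verit))
    then show ?thesis by blast
  qed
  then show ?thesis by blast
qed

text \<open>Adding a constant that makes the function at least 1 turns the additive Lipschitz bound
  into the multiplicative one used for nonnegative functions. Constants pass through
  \<open>markov n\<close> unchanged and are subtracted again from the limit.\<close>

lemma markov_converges:
  assumes g: "shift_Lipschitz d \<theta> C' g"
  shows "\<exists>m. \<forall>\<epsilon>>0. \<exists>N. \<forall>n\<ge>N. \<forall>x\<in>X. \<bar>markov n g x - m\<bar> \<le> \<epsilon>"
proof -
  obtain U where U: "U \<ge> 0" "\<And>x. x \<in> X \<Longrightarrow> \<bar>g x\<bar> \<le> U"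
    using shift_Lipschitz_bounded[OF g d] by metis
  let ?u = "\<lambda>x. g x + (U + 1)"
  have "\<exists>m. \<forall>\<epsilon>>0. \<exists>N. \<forall>n\<ge>N. \<forall>x\<in>X. \<bar>markov n ?u x - m\<bar> \<le> \<epsilon>"
  proof (rule markov_converges_nonneg[where U = "2 * U + 1"])
    show "0 \<le> ?u y" "?u y \<le> 2 * U + 1" if "y \<in> X" for y using U(2)[OF that] by auto
    show "C' \<ge> 0" using g by (rule shift_Lipschitz_nonneg)
    fix x y k assume *: "x \<in> X" "y \<in> X" "\<forall>i<k. x i = y i"
    have "?u x \<le> ?u y + C' * \<theta> ^ k * 1" using shift_LipschitzD[OF g *] by auto
    also have "\<dots> \<le> ?u y + C' * \<theta> ^ k * ?u y"
      using U(2)[OF *(2)] shift_Lipschitz_nonneg[OF g] \<theta> by (intro add_left_mono mult_left_mono) auto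
    also have "\<dots> = (1 + C' * \<theta> ^ k) * ?u y" by (simp add: algebra_simps)
    also have "\<dots> \<le> exp (C' * \<theta> ^ k) * ?u y"
      using U(2)[OF *(2)] by (intro mult_right_mono exp_ge_add_one_self) auto
    finally show "?u x \<le> exp (C' * \<theta> ^ k) * ?u y" .
  qed
  then obtain m where m: "\<forall>\<epsilon>>0. \<exists>N. \<forall>n\<ge>N. \<forall>x\<in>X. \<bar>markov n ?u x - m\<bar> \<le> \<epsilon>" by blast
  have "markov n ?u x = markov n g x + (U + 1)" if "x \<in> X" for n x
    unfolding markov_plus using markov_const[OF that] by simp
  then have "\<forall>\<epsilon>>0. \<exists>N. \<forall>n\<ge>N. \<forall>x\<in>X. \<bar>markov n g x - (m - (U + 1))\<bar> \<le> \<epsilon>"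
    using m by (simp add: algebra_simps)
  then show ?thesis by blast
qed

text \<open>
  With \<open>\<zeta> = \<Sum>i=1..s. markov i g\<close> the sum \<open>g + \<zeta>\<close> is mapped by one step to \<open>\<zeta>\<close> plus a nearly
  constant function, so \<open>h * exp (t * \<zeta>)\<close> is almost an eigenfunction for the potential \<open>\<phi> + t * g\<close>.
\<close>

lemma perturbed_transfer_upper:
  assumes g: "shift_Lipschitz d \<theta> C' g"
  shows "\<exists>m. \<forall>\<epsilon>>0. \<exists>\<delta>>0. \<forall>t. \<bar>t\<bar> < \<delta> \<longrightarrow> (\<exists>K>0. \<forall>n. \<forall>x\<in>X.
    (transfer d (\<lambda>x. \<phi> x + t * g x) ^^ n) (\<lambda>_. 1) x \<le> K * exp (n * (p + t * m + \<bar>t\<bar> * \<epsilon>)))"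
proof -
  obtain m where m: "\<And>\<epsilon>. \<epsilon> > 0 \<Longrightarrow> \<exists>N. \<forall>n\<ge>N. \<forall>x\<in>X. \<bar>markov n g x - m\<bar> \<le> \<epsilon>"
    using markov_converges[OF g] by blast
  obtain U where U: "U \<ge> 0" "\<And>x. x \<in> X \<Longrightarrow> \<bar>g x\<bar> \<le> U"
    using shift_Lipschitz_bounded[OF g d] by metis
  have "\<exists>\<delta>>0. \<forall>t. \<bar>t\<bar> < \<delta> \<longrightarrow> (\<exists>K>0. \<forall>n. \<forall>x\<in>X.
    (transfer d (\<lambda>x. \<phi> x + t * g x) ^^ n) (\<lambda>_. 1) x \<le> K * exp (n * (p + t * m + \<bar>t\<bar> * \<epsilon>)))"
    if \<epsilon>: "\<epsilon> > 0" for \<epsilon>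
  proof -
    \<comment> \<open>Half of the error is reserved for the distance to \<open>m\<close>, the other
      half for the quadratic term in \<open>t\<close>.\<close>
    obtain s where s: "\<And>x. x \<in> X \<Longrightarrow> \<bar>markov (Suc s) g x - m\<bar> \<le> \<epsilon> / 2"
      using m[of "\<epsilon> / 2"] \<epsilon> by (metis half_gt_zero le_Suc_eq order_refl)
    define \<zeta> where "\<zeta> x = (\<Sum>i<s. markov (Suc i) g x)" for x
    define B where "B = (Suc s) * U + 1"
    have B: "B \<ge> 1" using U by (simp add: B_def)
    have mk: "\<bar>markov i g x\<bar> \<le> U" if "x \<in> X" for i x
      using markov_mono[of "\<lambda>_. - U" g x i] markov_mono[of g "\<lambda>_. U" x i] U(2) markov_const[OF that] that
      by (auto simp: abs_le_iff minus_le_iff)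
    have \<zeta>: "\<bar>\<zeta> x\<bar> \<le> s * U" if "x \<in> X" for x
      unfolding \<zeta>_def using sum_mono[of "{..<s}" "\<lambda>i. \<bar>markov (Suc i) g x\<bar>" "\<lambda>_. U"] mk[OF that]
      by (intro sum_abs[THEN order_trans]) auto
    have gz: "\<bar>g x + \<zeta> x\<bar> \<le> B" "\<bar>\<zeta> x\<bar> \<le> B" if "x \<in> X" for x
      using U(2)[OF that] \<zeta>[OF that] U(1) by (auto simp: B_def algebra_simps)
    \<comment> \<open>The first entry keeps the exponents in the range of
      \<open>exp_le_quadratic\<close>; the second makes \<open>t ^ 2 * B ^ 2\<close> at most half of
      \<open>\<bar>t\<bar> * \<epsilon>\<close>.\<close>
    define \<delta> where "\<delta> = min (1 / B) (\<epsilon> / (2 * B\<^sup>2))"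
    have "\<exists>K>0. \<forall>n. \<forall>x\<in>X.
        (transfer d (\<lambda>x. \<phi> x + t * g x) ^^ n) (\<lambda>_. 1) x \<le> K * exp (n * (p + t * m + \<bar>t\<bar> * \<epsilon>))"
      if t: "\<bar>t\<bar> < \<delta>" for t
    proof -
      let ?L = "transfer d (\<lambda>x. \<phi> x + t * g x)"
      let ?r = "p + t * m + \<bar>t\<bar> * \<epsilon>"
      have tB: "\<bar>t\<bar> * B \<le> 1" "\<bar>t\<bar> * B\<^sup>2 \<le> \<epsilon> / 2"
        using t B by (auto simp: \<delta>_def field_simps power2_eq_square)
      have t2: "t\<^sup>2 * B\<^sup>2 \<le> \<bar>t\<bar> * (\<epsilon> / 2)"
        using mult_left_mono[OF tB(2), of "\<bar>t\<bar>"] by (simp add: power2_eq_square abs_mult[symmetric] mult.assoc[symmetric])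
      have tz: "\<bar>t * \<zeta> x\<bar> \<le> 1" "\<bar>t * (g x + \<zeta> x)\<bar> \<le> 1" if "x \<in> X" for x
        using mult_left_mono[OF gz(2)[OF that], of "\<bar>t\<bar>"] mult_left_mono[OF gz(1)[OF that], of "\<bar>t\<bar>"] tB(1)
        by (auto simp: abs_mult)
      define H where "H x = h x * exp (t * \<zeta> x)" for x
      have step: "?L H x \<le> exp ?r * H x" if x: "x \<in> X" for x
      proof -
        have "markov 1 (\<lambda>y. exp (t * (g y + \<zeta> y))) x \<le> markov 1 (\<lambda>y. (1 + t\<^sup>2 * B\<^sup>2) + t * (g y + \<zeta> y)) x"
        proof (rule markov_mono[OF _ x])
          fix y assume y: "y \<in> X"
          have "(t * (g y + \<zeta> y))\<^sup>2 \<le> t\<^sup>2 * B\<^sup>2"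
            unfolding power_mult_distrib using gz(1)[OF y] B
            by (intro mult_left_mono) (auto simp: abs_le_square_iff[symmetric])
          then show "exp (t * (g y + \<zeta> y)) \<le> (1 + t\<^sup>2 * B\<^sup>2) + t * (g y + \<zeta> y)"
            using exp_le_quadratic[OF tz(2)[OF y]] by linarith
        qed
        also have "\<dots> = 1 + t\<^sup>2 * B\<^sup>2 + t * (markov 1 g x + (\<Sum>i<s. markov 1 (markov (Suc i) g) x))"
          unfolding markov_plus markov_cmult \<zeta>_def markov_sum using markov_const[OF x] by simp
        also have "(\<Sum>i<s. markov 1 (markov (Suc i) g) x) = (\<Sum>i<s. markov (Suc (Suc i)) g x)"
          unfolding markov_add[OF x, symmetric] by simp
        also have "markov 1 g x + \<dots> = \<zeta> x + markov (Suc s) g x"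
          using sum.lessThan_Suc_shift[of "\<lambda>i. markov (Suc i) g x" s]
          by (simp add: \<zeta>_def)
        also have "1 + t\<^sup>2 * B\<^sup>2 + t * (\<zeta> x + markov (Suc s) g x)
            \<le> exp (t\<^sup>2 * B\<^sup>2 + t * (\<zeta> x + markov (Suc s) g x))"
          by (rule order_trans[OF _ exp_ge_add_one_self]) (simp only: add.assoc order_refl)
        also have "\<dots> \<le> exp (t * \<zeta> x + t * m + \<bar>t\<bar> * \<epsilon>)"
        proof -
          have "t * (markov (Suc s) g x - m) \<le> \<bar>t\<bar> * (\<epsilon> / 2)"
            using mult_left_mono[OF s[OF x], of "\<bar>t\<bar>"] by (simp add: abs_mult[symmetric])
          then show ?thesis using t2 by (simp add: algebra_simps)
        qed
        finally have *: "markov 1 (\<lambda>y. exp (t * (g y + \<zeta> y))) x \<le> exp (t * \<zeta> x + t * m + \<bar>t\<bar> * \<epsilon>)" .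
        have "?L H x = L (\<lambda>y. h y * exp (t * (g y + \<zeta> y))) x"
          unfolding transfer_def H_def by (intro sum.cong refl) (simp add: exp_add algebra_simps)
        also have "\<dots> = exp p * h x * markov 1 (\<lambda>y. exp (t * (g y + \<zeta> y))) x"
          using h_pos[OF x] by (simp add: markov_def normalized_def exp_minus)
        also have "\<dots> \<le> exp p * h x * exp (t * \<zeta> x + t * m + \<bar>t\<bar> * \<epsilon>)"
          using * h_pos[OF x] by (intro mult_left_mono) auto
        also have "\<dots> = exp ?r * H x" by (simp add: H_def exp_add mult_ac)
        finally show ?thesis .
      qed
      have iter: "(?L ^^ n) H x \<le> exp (n * ?r) * H x" if "x \<in> X" for n x
        using that
      proof (induction n arbitrary: x)
        case (Suc n)
        have "(?L ^^ Suc n) H x = (?L ^^ n) (?L H) x" by (simp add: funpow_swap1)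
        also have "\<dots> \<le> (?L ^^ n) (\<lambda>y. exp ?r * H y) x"
          using Suc.prems by (intro transfer_funpow_mono step)
        also have "\<dots> \<le> exp ?r * (exp (n * ?r) * H x)"
          unfolding transfer_funpow_cmult using Suc by (intro mult_left_mono) auto
        also have "\<dots> = exp (Suc n * ?r) * H x" by (simp add: exp_add[symmetric] algebra_simps)
        finally show ?case .
      qed simp
      have Hb: "exp (- 4 * D) * exp (- 1) \<le> H x" "H x \<le> exp (2 * D) * exp 1" if "x \<in> X" for x
        unfolding H_def using h_bounds[OF that] h_pos[OF that] tz(1)[OF that]
        by (auto intro!: mult_mono simp: abs_le_iff)
      \<comment> \<open>The factors pay for bounding 1 by a multiple of \<open>H\<close> before
        iterating and \<open>H\<close> by a constant afterwards; the additional 1 in each exponent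
        bounds \<open>t * \<zeta> x\<close>.\<close>
      define K where "K = exp (4 * D + 1) * exp (2 * D + 1)"
      have "(?L ^^ n) (\<lambda>_. 1) x \<le> K * exp (n * ?r)" if x: "x \<in> X" for n x
      proof -
        have "(?L ^^ n) (\<lambda>_. 1) x \<le> (?L ^^ n) (\<lambda>y. exp (4 * D + 1) * H y) x"
          using Hb(1) x by (intro transfer_funpow_mono) (auto simp: exp_add exp_minus field_simps)
        also have "\<dots> \<le> exp (4 * D + 1) * (exp (n * ?r) * H x)"
          unfolding transfer_funpow_cmult using iter[OF x] by (intro mult_left_mono) auto
        also have "\<dots> \<le> exp (4 * D + 1) * (exp (n * ?r) * exp (2 * D + 1))"
          using Hb(2)[OF x] by (intro mult_left_mono) (auto simp: exp_add)
        finally show ?thesis by (simp add: K_def mult_ac)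
      qed
      moreover have "K > 0" by (simp add: K_def)
      ultimately show ?thesis by blast
    qed
    moreover have "\<delta> > 0" using B \<epsilon> by (simp add: \<delta>_def)
    ultimately show ?thesis by blast
  qed
  then show ?thesis by blast
qed

end

text \<open>No eigenfunction occurs in the conclusion, so its mere existence allows leaving the
  locale that fixes one.\<close>

lemma (in shift_pressure) perturbed_transfer_upper:
  assumes "shift_Lipschitz d \<theta> C' g"
  shows "\<exists>m. \<forall>\<epsilon>>0. \<exists>\<delta>>0. \<forall>t. \<bar>t\<bar> < \<delta> \<longrightarrow> (\<exists>K>0. \<forall>n. \<forall>x\<in>X.
    (transfer d (\<lambda>x. \<phi> x + t * g x) ^^ n) (\<lambda>_. 1) x \<le> K * exp (n * (p + t * m + \<bar>t\<bar> * \<epsilon>)))"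
proof -
  obtain h where h: "\<forall>x\<in>X. exp (- 4 * D) \<le> h x \<and> h x \<le> exp (2 * D)"
    "\<forall>x\<in>X. L h x = exp p * h x"
    "\<forall>x\<in>X. \<forall>y\<in>X. \<forall>k. (\<forall>i<k. x i = y i) \<longrightarrow> h x \<le> exp (2 * D * \<theta> ^ k) * h y"
    using eigenfunction_exists by blast
  interpret shift_eigenfunction d \<theta> C \<phi> p h
    by unfold_locales (use h in blast)+
  show ?thesis by (rule perturbed_transfer_upper[OF assms])
qed


section \<open>Periodic points and topological pressure\<close>

definition periodic :: "nat list \<Rightarrow> nat \<Rightarrow> nat" where
  "periodic w = (\<lambda>k. w ! (k mod length w))"

definition orbit_average ::
  "nat \<Rightarrow> ((nat \<Rightarrow> nat) \<Rightarrow> real) \<Rightarrow> ((nat \<Rightarrow> nat) \<Rightarrow> real) \<Rightarrow> nat \<Rightarrow> real" where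
  "orbit_average d \<phi> g n =
     (\<Sum>x\<in>fix_points d n. exp (birkhoff_sum left_shift \<phi> n x) * (birkhoff_sum left_shift g n x / n)) /
     (\<Sum>x\<in>fix_points d n. exp (birkhoff_sum left_shift \<phi> n x))"

lemma periodic_in_space: "w \<in> words {1..d} n \<Longrightarrow> n \<ge> 1 \<Longrightarrow> periodic w \<in> bernoulli_space d"
  unfolding bernoulli_space_def periodic_def
  by (intro Pi_I nth_words[of _ _ n]) (simp_all add: words_def)

text \<open>A point fixed by the \<open>n\<close>-fold shift is the periodic repetition of its first
  \<open>n\<close> symbols, and every word of length \<open>n\<close> arises in this way.\<close>

lemma sum_fix_points:
  assumes "n \<ge> 1"
  shows "(\<Sum>x\<in>fix_points d n. F x) = (\<Sum>w\<in>words {1..d} n. F (periodic w))"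
proof (rule sum.reindex_bij_witness[where j = "\<lambda>x. map x [0..<n]" and i = periodic])
  fix x assume x: "x \<in> fix_points d n"
  then have per: "x (k + n) = x k" for k
    using funpow_shift[of n x] by (auto simp: fix_points_def fun_eq_iff)
  have per': "x (k + j * n) = x k" for k j
  proof (induction j)
    case (Suc j)
    then show ?case using per[of "k + j * n"] by (simp add: algebra_simps)
  qed simp
  have "x (k mod n) = x k" for k
    using per'[of "k mod n" "k div n"] by simp
  then show eq: "periodic (map x [0..<n]) = x"
    using assms by (auto simp: periodic_def fun_eq_iff)
  show "map x [0..<n] \<in> words {1..d} n"
    using x by (auto simp: fix_points_def words_def bernoulli_space_def)
  show "F (periodic (map x [0..<n])) = F x" using eq by simp
next
  fix w assume w: "w \<in> words {1..d} n"
  then have "length w = n" by (simp add: words_def)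
  then show "map (periodic w) [0..<n] = w"
    by (auto simp: periodic_def intro!: nth_equalityI)
  show "periodic w \<in> fix_points d n"
    using periodic_in_space[OF w assms] \<open>length w = n\<close>
    by (auto simp: fix_points_def funpow_shift periodic_def fun_eq_iff)
qed

context shift_potential
begin

text \<open>\<open>periodic w\<close> and \<open>conc w x\<close> share their first \<open>n\<close>
  symbols, so their Birkhoff sums differ by at most \<open>D\<close>, whatever \<open>x\<close>
  is.\<close>

lemma orbit_sum_bounds:
  assumes "n \<ge> 1" "x \<in> X"
  shows "(\<Sum>z\<in>fix_points d n. exp (birkhoff_sum left_shift \<phi> n z)) \<le> exp D * (L ^^ n) (\<lambda>_. 1) x"
    and "exp (- D) * (L ^^ n) (\<lambda>_. 1) x \<le> (\<Sum>z\<in>fix_points d n. exp (birkhoff_sum left_shift \<phi> n z))"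
proof -
  let ?s = "birkhoff_sum left_shift \<phi> n"
  have "\<bar>?s (periodic w) - ?s (conc w x)\<bar> \<le> D" if w: "w \<in> words {1..d} n" for w
  proof -
    have "\<forall>i<n + 0. periodic w i = conc w x i"
      using w by (auto simp: words_def periodic_def conc_def)
    then have "\<bar>?s (periodic w) - ?s (conc w x)\<bar> \<le> C / (1 - \<theta>) * \<theta> ^ 0"
      by (intro birkhoff_distortion[OF Lip \<theta>] periodic_in_space[OF w assms(1)] conc_in_space[OF w assms(2)])
    then show ?thesis by (simp add: D_def)
  qed
  then have "exp (?s (periodic w)) \<le> exp D * exp (?s (conc w x))"
    "exp (- D) * exp (?s (conc w x)) \<le> exp (?s (periodic w))" if "w \<in> words {1..d} n" for w
    using that by (auto simp: exp_add[symmetric] abs_le_iff algebra_simps)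
  then show "(\<Sum>z\<in>fix_points d n. exp (?s z)) \<le> exp D * (L ^^ n) (\<lambda>_. 1) x"
    "exp (- D) * (L ^^ n) (\<lambda>_. 1) x \<le> (\<Sum>z\<in>fix_points d n. exp (?s z))"
    unfolding sum_fix_points[OF assms(1)] transfer_funpow sum_distrib_left
    by (auto intro: sum_mono)
qed

text \<open>The weights sum only \<open>n\<close> terms while the words are \<open>k\<close> longer;
  each missing term costs at most a factor \<open>exp U\<close>. The extra symbols are needed
  wherever something observed along \<open>n\<close> shifts reads \<open>k\<close> coordinates
  ahead.\<close>

lemma sum_longer_words_le:
  "\<exists>K>0. \<forall>n. \<forall>x\<in>X.
     (\<Sum>w\<in>words {1..d} (n + k). exp (birkhoff_sum left_shift \<phi> n (conc w x))) \<le> K * (L ^^ (n + k)) (\<lambda>_. 1) x"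
proof -
  obtain U where U: "U \<ge> 0" "\<And>x. x \<in> X \<Longrightarrow> \<bar>\<phi> x\<bar> \<le> U"
    using shift_Lipschitz_bounded[OF Lip d] by metis
  have le: "birkhoff_sum left_shift \<phi> n y \<le> birkhoff_sum left_shift \<phi> (n + j) y + j * U" if "y \<in> X" for n j y
  proof (induction j)
    case (Suc j)
    have "- U \<le> \<phi> ((left_shift ^^ (n + j)) y)"
      using U(2)[OF funpow_shift_in_bernoulli_space[OF that], of "n + j"] by (simp add: abs_le_iff)
    then show ?case using Suc by (simp add: birkhoff_sum_def algebra_simps)
  qed simp
  have "(\<Sum>w\<in>words {1..d} (n + k). exp (birkhoff_sum left_shift \<phi> n (conc w x)))
      \<le> exp (k * U) * (L ^^ (n + k)) (\<lambda>_. 1) x" if "x \<in> X" for n x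
    unfolding transfer_funpow sum_distrib_left
  proof (rule sum_mono)
    fix w assume "w \<in> words {1..d} (n + k)"
    from le[OF conc_in_space[OF this that], of n k]
    show "exp (birkhoff_sum left_shift \<phi> n (conc w x))
        \<le> exp (k * U) * (exp (birkhoff_sum left_shift \<phi> (n + k) (conc w x)) * 1)"
      by (simp add: exp_add[symmetric] add.commute)
  qed
  then show ?thesis by (intro exI[of _ "exp (k * U)"]) auto
qed

end

section \<open>Bowen's pressure of the shift\<close>

context shift_pressure
begin

text \<open>Once \<open>\<theta> ^ k < \<epsilon>\<close>, the points of a separated set are told
  apart by their first \<open>n + k\<close> symbols and so inject into the words of that length. Of
  the \<open>3 * D\<close> in the constant chosen in the proof, one \<open>D\<close> replaces each
  point by a representative of its word and \<open>2 * D\<close> is the error in the growth of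
  \<open>L ^^ (n + k)\<close>.\<close>

lemma separated_sum_le:
  assumes "\<epsilon> > 0"
  shows "\<exists>K. \<forall>n E. dyn_separated (bernoulli_metric d \<theta>) left_shift n \<epsilon> E \<longrightarrow>
    (\<Sum>x\<in>E. exp (birkhoff_sum left_shift \<phi> n x)) \<le> exp (n * p + K)"
proof -
  let ?o = "\<lambda>_. 1 :: nat"
  obtain k where k: "\<theta> ^ k < \<epsilon>" using real_arch_pow_inv[OF assms \<theta>(2)] by blast
  obtain K where K: "K > 0" "\<And>n x. x \<in> X \<Longrightarrow> (\<Sum>w\<in>words {1..d} (n + k).
      exp (birkhoff_sum left_shift \<phi> n (conc w x))) \<le> K * (L ^^ (n + k)) (\<lambda>_. 1) x"
    using sum_longer_words_le[of k] by blast
  have "(\<Sum>x\<in>E. exp (birkhoff_sum left_shift \<phi> n x)) \<le> exp (n * p + (k * p + ln K + 3 * D))"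
    if E: "dyn_separated (bernoulli_metric d \<theta>) left_shift n \<epsilon> E" for n E
  proof -
    let ?s = "birkhoff_sum left_shift \<phi> n"
    let ?pre = "\<lambda>x. map x [0..<n + k]"
    have EX: "E \<subseteq> X" "finite E" using E \<theta> by (auto simp: dyn_separated_def)
    have inj: "inj_on ?pre E"
    proof (rule inj_onI, rule ccontr)
      fix x y assume xy: "x \<in> E" "y \<in> E" "?pre x = ?pre y" "x \<noteq> y"
      then have "\<exists>i<n. bernoulli_dist \<theta> ((left_shift ^^ i) x) ((left_shift ^^ i) y) > \<epsilon>"
        using E \<theta> unfolding dyn_separated_def by (metis mdist_bernoulli_metric)
      then obtain i where i: "i < n" "bernoulli_dist \<theta> ((left_shift ^^ i) x) ((left_shift ^^ i) y) > \<epsilon>"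
        by blast
      have "x j = y j" if "j < n + k" for j
        using that xy(3) by (metis add_cancel_right_left nth_map_upt minus_nat.diff_0)
      then have "\<forall>j<k. (left_shift ^^ i) x j = (left_shift ^^ i) y j"
        using i(1) by (simp add: funpow_shift)
      then show False using bernoulli_dist_le_iff[OF \<theta>] i(2) k by (smt (verit))
    qed
    have "(\<Sum>x\<in>E. exp (?s x)) \<le> (\<Sum>x\<in>E. exp D * exp (?s (conc (?pre x) ?o)))"
    proof (rule sum_mono)
      fix x assume "x \<in> E"
      then have x: "x \<in> X" using EX by auto
      have w: "?pre x \<in> words {1..d} (n + k)" using x by (rule prefix_in_words)
      have "\<bar>?s x - ?s (conc (?pre x) ?o)\<bar> \<le> C / (1 - \<theta>) * \<theta> ^ k"
        by (intro birkhoff_distortion[OF Lip \<theta>] x conc_in_space[OF w const_in_space]) (auto simp: conc_def)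
      also have "\<dots> \<le> D"
        using mult_left_mono[OF power_le_one[of \<theta> k] D_nonneg] \<theta> by (simp add: D_def)
      finally show "exp (?s x) \<le> exp D * exp (?s (conc (?pre x) ?o))"
        by (auto simp: exp_add[symmetric] abs_le_iff)
    qed
    also have "\<dots> = exp D * (\<Sum>w\<in>?pre ` E. exp (?s (conc w ?o)))"
      by (simp add: sum.reindex[OF inj] sum_distrib_left)
    also have "\<dots> \<le> exp D * (\<Sum>w\<in>words {1..d} (n + k). exp (?s (conc w ?o)))"
      using EX finite_words[of "{1..d}" "n + k"] prefix_in_words[of _ d "n + k"]
      by (intro mult_left_mono sum_mono2) auto
    also have "\<dots> \<le> exp D * (K * exp ((n + k) * p + 2 * D))"
      using pressure[OF const_in_space, of "n + k"] K(1)
      by (intro mult_left_mono order_trans[OF K(2)[OF const_in_space]]) auto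
    also have "\<dots> = exp (n * p + (k * p + ln K + 3 * D))"
    proof -
      have "n * p + (k * p + ln K + 3 * D) = D + (ln K + ((n + k) * p + 2 * D))"
        by (simp add: algebra_simps)
      then show ?thesis using K(1) by (simp only: exp_add exp_ln)
    qed
    finally show ?thesis .
  qed
  then show ?thesis by blast
qed

text \<open>Distinct points of period \<open>n\<close> differ at some index below \<open>n\<close>;
  shifting by that index brings the difference to coordinate 0, where the distance is 1.\<close>

lemma fix_points_separated:
  assumes "n \<ge> 1" "\<epsilon> < 1"
  shows "dyn_separated (bernoulli_metric d \<theta>) left_shift n \<epsilon> (fix_points d n)"
  unfolding dyn_separated_def
proof (intro conjI ballI impI)
  show "finite (fix_points d n)" using assms(1) by (rule finite_fix_points)
  show "fix_points d n \<subseteq> mspace (bernoulli_metric d \<theta>)" using \<theta> by (auto simp: fix_points_def)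
  fix x y assume xy: "x \<in> fix_points d n" "y \<in> fix_points d n" "x \<noteq> y"
  have per: "z (k mod n) = z k" if z: "z \<in> fix_points d n" for z k
  proof -
    have "z (k + n) = z k" for k
      using z funpow_shift[of n z] by (auto simp: fix_points_def fun_eq_iff)
    then have "z (k + j * n) = z k" for k j
      by (induction j) (auto simp: add.assoc[symmetric] add.commute[of n])
    then show ?thesis by (metis mod_mult_div_eq mult.commute)
  qed
  obtain k where "x k \<noteq> y k" using xy(3) by auto
  then have "x (k mod n) \<noteq> y (k mod n)" using per[OF xy(1), of k] per[OF xy(2), of k] by simp
  then obtain i where i: "i < n" "x i \<noteq> y i" using assms(1) by (metis mod_less_divisor less_eq_Suc_le One_nat_def)
  then have ne: "(left_shift ^^ i) x 0 \<noteq> (left_shift ^^ i) y 0" by (simp add: funpow_shift)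
  then have "(LEAST k. (left_shift ^^ i) x k \<noteq> (left_shift ^^ i) y k) = 0" by simp
  then have "bernoulli_dist \<theta> ((left_shift ^^ i) x) ((left_shift ^^ i) y) = 1"
    using ne by (auto simp: bernoulli_dist_def)
  then show "\<exists>i<n. \<epsilon> < mdist (bernoulli_metric d \<theta>) ((left_shift ^^ i) x) ((left_shift ^^ i) y)"
    using i(1) assms(2) \<theta> by auto
qed

lemma orbit_sum_pressure:
  assumes "n \<ge> 1"
  shows "exp (n * p - 3 * D) \<le> (\<Sum>x\<in>fix_points d n. exp (birkhoff_sum left_shift \<phi> n x))"
proof -
  have "exp (n * p - 3 * D) = exp (- D) * exp (n * p - 2 * D)" by (simp add: exp_add[symmetric])
  also have "\<dots> \<le> exp (- D) * (L ^^ n) (\<lambda>_. 1) (\<lambda>_. 1)"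
    using pressure[OF const_in_space, of n] by (intro mult_left_mono) auto
  also have "\<dots> \<le> (\<Sum>x\<in>fix_points d n. exp (birkhoff_sum left_shift \<phi> n x))"
    by (rule orbit_sum_bounds(2)[OF assms const_in_space])
  finally show ?thesis .
qed

text \<open>Words bound the separated sums from above and the separated set of periodic points
  bounds them from below, both with rate \<open>p\<close>. The growth rate is thus \<open>p\<close>
  for every \<epsilon> in (0, 1), and the limit over \<epsilon> is that of an eventually constant
  function.\<close>

lemma topological_pressure_eq:
  "topological_pressure (bernoulli_metric d \<theta>) left_shift \<phi> = ereal p"
proof -
  let ?S = "separated_sum (bernoulli_metric d \<theta>) left_shift \<phi>"
  have lim: "limsup (\<lambda>n. ereal (ln (?S n \<epsilon>) / real n)) = ereal p" if \<epsilon>: "0 < \<epsilon>" "\<epsilon> < 1" for \<epsilon>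
  proof -
    obtain K where K: "\<And>n E. dyn_separated (bernoulli_metric d \<theta>) left_shift n \<epsilon> E \<Longrightarrow>
        (\<Sum>x\<in>E. exp (birkhoff_sum left_shift \<phi> n x)) \<le> exp (n * p + K)"
      using separated_sum_le[OF \<epsilon>(1)] by blast
    have bounds: "exp (n * p - 3 * D) \<le> ?S n \<epsilon>" "?S n \<epsilon> \<le> exp (n * p + K)" if n: "n \<ge> 1" for n
    proof -
      show "?S n \<epsilon> \<le> exp (n * p + K)"
        unfolding separated_sum_def using K fix_points_separated[OF n \<epsilon>(2)] by (intro cSUP_least) auto
      have "(\<Sum>x\<in>fix_points d n. exp (birkhoff_sum left_shift \<phi> n x)) \<le> ?S n \<epsilon>"
        unfolding separated_sum_def using K fix_points_separated[OF n \<epsilon>(2)]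
        by (intro cSUP_upper bdd_aboveI2) auto
      then show "exp (n * p - 3 * D) \<le> ?S n \<epsilon>"
        using orbit_sum_pressure[OF n] by linarith
    qed
    have "p - 3 * D / n \<le> ln (?S n \<epsilon>) / n \<and> ln (?S n \<epsilon>) / n \<le> p + K / n" if n: "n \<ge> 1" for n
    proof -
      have "?S n \<epsilon> > 0" using bounds(1)[OF n] by (meson exp_gt_zero less_le_trans)
      then have "n * p - 3 * D \<le> ln (?S n \<epsilon>)" "ln (?S n \<epsilon>) \<le> n * p + K"
        using bounds[OF n] ln_le_cancel_iff[of "?S n \<epsilon>" "exp (n * p + K)"] by (auto simp: ln_ge_iff)
      then have "(n * p - 3 * D) / n \<le> ln (?S n \<epsilon>) / n" "ln (?S n \<epsilon>) / n \<le> (n * p + K) / n"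
        by (auto intro: divide_right_mono)
      then show ?thesis using n by (simp add: diff_divide_distrib add_divide_distrib)
    qed
    then have ev: "\<forall>\<^sub>F n in sequentially. p - 3 * D / n \<le> ln (?S n \<epsilon>) / n"
      "\<forall>\<^sub>F n in sequentially. ln (?S n \<epsilon>) / n \<le> p + K / n"
      by (auto simp: eventually_sequentially intro!: exI[of _ 1])
    have "(\<lambda>n. p - 3 * D / real n) \<longlonglongrightarrow> p - 0" "(\<lambda>n. p + K / real n) \<longlonglongrightarrow> p + 0"
      by (intro tendsto_intros lim_const_over_n)+
    then have "(\<lambda>n. ln (?S n \<epsilon>) / n) \<longlonglongrightarrow> p"
      using tendsto_sandwich[OF ev] by simp
    then show ?thesis by (intro lim_imp_Limsup) auto
  qed
  have "\<forall>\<^sub>F \<epsilon> in at_right 0. limsup (\<lambda>n. ereal (ln (?S n \<epsilon>) / real n)) = ereal p"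
    unfolding eventually_at_right_field using lim by (intro exI[of _ 1]) auto
  then have "((\<lambda>\<epsilon>. limsup (\<lambda>n. ereal (ln (?S n \<epsilon>) / real n))) \<longlongrightarrow> ereal p) (at_right 0)"
    by (rule tendsto_eventually)
  then show ?thesis
    unfolding topological_pressure_def by (intro tendsto_Lim) auto
qed

text \<open>The first-order upper bound on the pressure of \<open>\<phi> + t * g\<close>, put as a
  growth rate, for small \<open>t\<close> of either sign. The factor \<open>K\<close> may depend on
  \<open>t\<close>; it disappears from the rate at fixed \<open>t\<close>.\<close>

definition "tangent_slope g m \<longleftrightarrow> (\<forall>\<epsilon>>0. \<exists>\<delta>>0. \<forall>t. \<bar>t\<bar> < \<delta> \<longrightarrow> (\<exists>K>0. \<forall>n. \<forall>x\<in>X.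
    (transfer d (\<lambda>x. \<phi> x + t * g x) ^^ n) (\<lambda>_. 1) x \<le> K * exp (n * (p + t * m + \<bar>t\<bar> * \<epsilon>))))"

text \<open>Jensen's inequality bounds the slope of \<open>t \<mapsto> ln (\<Sum>x\<in>Fix\<^sub>n. exp (\<phi>\<^sup>n x + t * g\<^sup>n x))\<close> at \<open>0\<close>.\<close>

lemma orbit_average_jensen:
  assumes "n \<ge> 1"
  shows "exp (t * n * orbit_average d \<phi> g n) * (\<Sum>x\<in>fix_points d n. exp (birkhoff_sum left_shift \<phi> n x))
    \<le> (\<Sum>x\<in>fix_points d n. exp (birkhoff_sum left_shift (\<lambda>x. \<phi> x + t * g x) n x))"
proof -
  let ?F = "fix_points d n" and ?s = "birkhoff_sum left_shift \<phi> n" and ?g = "birkhoff_sum left_shift g n"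
  define W where "W = (\<Sum>x\<in>?F. exp (?s x))"
  define a where "a = t * n * orbit_average d \<phi> g n"
  have W: "W > 0" unfolding W_def using orbit_sum_pressure[OF assms] by (meson exp_gt_zero less_le_trans)
  have "a * W = (\<Sum>x\<in>?F. exp (?s x) * (t * ?g x))"
  proof -
    have "orbit_average d \<phi> g n * W = (\<Sum>x\<in>?F. exp (?s x) * (?g x / n))"
      using W by (simp add: orbit_average_def W_def)
    then have "a * W = t * n * (\<Sum>x\<in>?F. exp (?s x) * (?g x / n))"
      by (simp add: a_def)
    then show ?thesis
      using assms unfolding sum_distrib_left by (simp add: mult_ac)
  qed
  \<comment> \<open>This is the tangent line of \<open>exp\<close> at the weighted mean
    \<open>a\<close> of \<open>t * ?g x\<close>; by the choice of \<open>a\<close> its linear part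
    averages to 0.\<close>
  moreover have "(\<Sum>x\<in>?F. exp (?s x) * (exp a * (1 + (t * ?g x - a)))) =
      exp a * (W + (\<Sum>x\<in>?F. exp (?s x) * (t * ?g x)) - a * W)"
    by (simp add: W_def sum_distrib_left sum.distrib sum_subtractf algebra_simps)
  ultimately have "exp a * W = (\<Sum>x\<in>?F. exp (?s x) * (exp a * (1 + (t * ?g x - a))))"
    by simp
  also have "\<dots> \<le> (\<Sum>x\<in>?F. exp (?s x) * exp (t * ?g x))"
  proof (intro sum_mono mult_left_mono)
    fix x
    have "exp a * (1 + (t * ?g x - a)) \<le> exp a * exp (t * ?g x - a)"
      by (intro mult_left_mono exp_ge_add_one_self) auto
    then show "exp a * (1 + (t * ?g x - a)) \<le> exp (t * ?g x)" by (simp add: exp_add[symmetric])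
  qed auto
  finally show ?thesis
    by (simp add: a_def W_def birkhoff_sum_linear exp_add)
qed

lemma orbit_average_tendsto:
  assumes g: "shift_Lipschitz d \<theta> C' g" and m: "tangent_slope g m"
  shows "orbit_average d \<phi> g \<longlonglongrightarrow> m"
proof -
  have one_sided: "\<forall>\<^sub>F n in sequentially. sgn t * (orbit_average d \<phi> g n - m) \<le> 2 * \<epsilon>"
    if t: "t \<noteq> 0" and \<epsilon>: "\<epsilon> > 0" and K: "K > 0" "\<forall>n. \<forall>x\<in>X.
      (transfer d (\<lambda>x. \<phi> x + t * g x) ^^ n) (\<lambda>_. 1) x \<le> K * exp (n * (p + t * m + \<bar>t\<bar> * \<epsilon>))" for t \<epsilon> K
  proof -
    \<comment> \<open>The perturbed potential is Lipschitz too, which lets its sum over periodic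
      points be compared with its transfer operator. For fixed \<open>t\<close> its distortion
      constant and \<open>ln K\<close> do not depend on \<open>n\<close> and vanish after division
      by \<open>n\<close>.\<close>
    interpret pert: shift_potential d \<theta> "C + \<bar>t\<bar> * C'" "\<lambda>x. \<phi> x + t * g x"
      by unfold_locales (use d \<theta> shift_Lipschitz_linear[OF Lip g \<theta>(1)] in auto)
    define c where "c = pert.D + ln K + 3 * D"
    have le: "t * (orbit_average d \<phi> g n - m) \<le> c / n + \<bar>t\<bar> * \<epsilon>" if n: "n \<ge> 1" for n
    proof -
      let ?a = "orbit_average d \<phi> g n"
      have "exp (t * n * ?a) * exp (n * p - 3 * D)
          \<le> exp (t * n * ?a) * (\<Sum>x\<in>fix_points d n. exp (birkhoff_sum left_shift \<phi> n x))"
        using orbit_sum_pressure[OF n] by (intro mult_left_mono) auto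
      also have "\<dots> \<le> exp pert.D * (transfer d (\<lambda>x. \<phi> x + t * g x) ^^ n) (\<lambda>_. 1) (\<lambda>_. 1)"
        using orbit_average_jensen[OF n] pert.orbit_sum_bounds(1)[OF n const_in_space] by (rule order_trans)
      also have "\<dots> \<le> exp pert.D * (exp (ln K) * exp (n * (p + t * m + \<bar>t\<bar> * \<epsilon>)))"
        using K const_in_space by (intro mult_left_mono) auto
      finally have "n * (t * (?a - m)) \<le> c + n * (\<bar>t\<bar> * \<epsilon>)"
        unfolding exp_add[symmetric] by (simp add: c_def algebra_simps)
      then show ?thesis using n by (simp add: field_simps)
    qed
    have "(\<lambda>n. c / real n) \<longlonglongrightarrow> 0" by (rule lim_const_over_n)
    then have "\<forall>\<^sub>F n in sequentially. c / real n < \<bar>t\<bar> * \<epsilon>"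
      using t \<epsilon> by (intro order_tendstoD) auto
    then show ?thesis
      using eventually_ge_at_top[of "1::nat"]
    proof eventually_elim
      case (elim n)
      have "\<bar>t\<bar> * (sgn t * (orbit_average d \<phi> g n - m)) \<le> \<bar>t\<bar> * (2 * \<epsilon>)"
        using le[OF elim(2)] elim(1) by (simp add: mult.assoc[symmetric] abs_mult_sgn mult.commute[of _ \<epsilon>])
      then show ?case using t by simp
    qed
  qed
  show ?thesis
  proof (rule tendstoI)
    fix e :: real assume e: "e > 0"
    \<comment> \<open>One \<epsilon> is lost to the slope estimate and one to \<open>c / n\<close>,
      which leaves \<open>2 * \<epsilon> < e\<close>. The values \<open>\<delta> / 2\<close> and
      \<open>- \<delta> / 2\<close> of \<open>t\<close> then give the upper and the lower
      bound.\<close>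
    define \<epsilon> where "\<epsilon> = e / 3"
    have \<epsilon>: "\<epsilon> > 0" using e by (simp add: \<epsilon>_def)
    obtain \<delta> where \<delta>: "\<delta> > 0" "\<And>t. \<bar>t\<bar> < \<delta> \<Longrightarrow> \<exists>K>0. \<forall>n. \<forall>x\<in>X.
      (transfer d (\<lambda>x. \<phi> x + t * g x) ^^ n) (\<lambda>_. 1) x \<le> K * exp (n * (p + t * m + \<bar>t\<bar> * \<epsilon>))"
      using m \<epsilon> unfolding tangent_slope_def by blast
    have "\<forall>\<^sub>F n in sequentially. sgn t * (orbit_average d \<phi> g n - m) \<le> 2 * \<epsilon>"
      if "\<bar>t\<bar> = \<delta> / 2" for t
      using \<delta>(2)[of t] that one_sided[OF _ \<epsilon>] \<delta>(1) by force
    from this[of "\<delta> / 2"] this[of "- \<delta> / 2"]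
    have "\<forall>\<^sub>F n in sequentially. orbit_average d \<phi> g n - m \<le> 2 * \<epsilon>"
      "\<forall>\<^sub>F n in sequentially. - (orbit_average d \<phi> g n - m) \<le> 2 * \<epsilon>"
      using \<delta>(1) by (simp_all add: sgn_if)
    then show "\<forall>\<^sub>F n in sequentially. dist (orbit_average d \<phi> g n) m < e"
      by eventually_elim (use e in \<open>simp add: dist_real_def \<epsilon>_def abs_le_iff\<close>)
  qed
qed

end


section \<open>Entropy of partitions\<close>

text \<open>With \<open>Q\<close> the row sums of \<open>q\<close> and \<open>S\<close> the total of
  \<open>R\<close>, the inequality \<open>ln y \<le> y - 1\<close> is used at
  \<open>y = R i j / (S * Q i)\<close>. Since \<open>q i j \<le> Q i\<close>, the left side may be
  the entropy of the row sums, which is at most that of the joint weights.\<close>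

lemma gibbs_inequality:
  fixes q R :: "'a \<Rightarrow> 'b \<Rightarrow> real"
  assumes fin: "finite I" "finite J"
    and q: "\<And>i j. i \<in> I \<Longrightarrow> j \<in> J \<Longrightarrow> 0 \<le> q i j" "(\<Sum>i\<in>I. \<Sum>j\<in>J. q i j) = 1"
    and R: "\<And>i j. i \<in> I \<Longrightarrow> j \<in> J \<Longrightarrow> 0 \<le> R i j"
      "\<And>i j. i \<in> I \<Longrightarrow> j \<in> J \<Longrightarrow> 0 < q i j \<Longrightarrow> 0 < R i j"
  shows "- (\<Sum>i\<in>I. (\<Sum>j\<in>J. q i j) * ln (\<Sum>j\<in>J. q i j))
    \<le> ln (\<Sum>i\<in>I. \<Sum>j\<in>J. R i j) - (\<Sum>i\<in>I. \<Sum>j\<in>J. q i j * ln (R i j))"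
proof -
  define Q where "Q i = (\<Sum>j\<in>J. q i j)" for i
  define S where "S = (\<Sum>i\<in>I. \<Sum>j\<in>J. R i j)"
  have S: "S > 0"
  proof -
    have "\<exists>i\<in>I. \<exists>j\<in>J. q i j \<noteq> 0"
    proof (rule ccontr)
      assume "\<not> ?thesis"
      then have "(\<Sum>i\<in>I. \<Sum>j\<in>J. q i j) = 0" by simp
      then show False using q(2) by simp
    qed
    then obtain i j where ij: "i \<in> I" "j \<in> J" "q i j \<noteq> 0" by blast
    then have "R i j > 0" using R(2) q(1) by (simp add: less_le)
    then have "(\<Sum>j\<in>J. R i j) > 0" using R(1) ij fin by (intro sum_pos2[of _ j]) auto
    then show ?thesis unfolding S_def using R(1) ij fin by (intro sum_pos2[of _ i]) (auto intro: sum_nonneg)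
  qed
  have "q i j * ln (R i j) - q i j * ln S - q i j * ln (Q i) \<le> R i j / S - q i j"
    if ij: "i \<in> I" "j \<in> J" for i j
  proof (cases "q i j = 0")
    case True
    then show ?thesis using R(1)[OF ij] S by simp
  next
    case False
    then have q0: "q i j > 0" using q(1)[OF ij] by simp
    have qQ: "q i j \<le> Q i" unfolding Q_def using ij fin q(1) by (intro member_le_sum) auto
    have pos: "R i j > 0" "Q i > 0" using R(2)[OF ij q0] q0 qQ by auto
    have "ln (R i j / (S * Q i)) \<le> R i j / (S * Q i) - 1"
      using pos S by (intro ln_le_minus_one) auto
    then have "q i j * ln (R i j / (S * Q i)) \<le> q i j * (R i j / (S * Q i) - 1)"
      using q0 by (intro mult_left_mono) auto
    also have "\<dots> = (q i j / Q i) * (R i j / S) - q i j" by (simp add: algebra_simps)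
    also have "\<dots> \<le> 1 * (R i j / S) - q i j"
      using qQ pos S by (intro diff_right_mono mult_right_mono) auto
    finally show ?thesis using pos S by (simp add: ln_div ln_mult algebra_simps)
  qed
  then have "(\<Sum>i\<in>I. \<Sum>j\<in>J. q i j * ln (R i j) - q i j * ln S - q i j * ln (Q i))
      \<le> (\<Sum>i\<in>I. \<Sum>j\<in>J. R i j / S - q i j)"
    by (intro sum_mono)
  also have "\<dots> = 0"
    using S by (simp add: sum_subtractf sum_divide_distrib[symmetric] S_def[symmetric] q(2))
  also have "(\<Sum>i\<in>I. \<Sum>j\<in>J. q i j * ln (R i j) - q i j * ln S - q i j * ln (Q i)) =
      (\<Sum>i\<in>I. \<Sum>j\<in>J. q i j * ln (R i j)) - ln S - (\<Sum>i\<in>I. Q i * ln (Q i))"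
    using q(2) by (simp add: sum_subtractf sum_distrib_right[symmetric] Q_def)
  finally show ?thesis by (simp add: Q_def S_def)
qed

text \<open>Fekete's lemma: the quotients tend to their infimum, which nonnegativity makes finite.
  With \<open>n\<close> divided by a nearly optimal \<open>m\<close>, the remainder contributes at
  most a constant.\<close>

lemma subadditive_convergent:
  fixes a :: "nat \<Rightarrow> real"
  assumes sub: "\<And>n m. a (n + m) \<le> a n + a m" and nonneg: "\<And>n. 0 \<le> a n"
  shows "convergent (\<lambda>n. a n / n)"
proof -
  define L where "L = (INF n\<in>{1..}. a n / real n)"
  have L: "L \<le> a n / n" if "n \<ge> 1" for n
    unfolding L_def using that nonneg by (intro cINF_lower bdd_belowI2[of _ 0]) auto
  have "(\<lambda>n. a n / n) \<longlonglongrightarrow> L"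
  proof (rule tendstoI)
    fix e :: real assume e: "e > 0"
    have "\<exists>m\<in>{1..}. a m / real m < L + e / 2"
    proof (rule ccontr)
      assume "\<not> ?thesis"
      then have "L + e / 2 \<le> L" unfolding L_def[symmetric]
        by (subst (2) L_def) (auto intro!: cINF_greatest simp: not_less)
      then show False using e by simp
    qed
    then obtain m where m: "m \<ge> 1" "a m / real m < L + e / 2" by auto
    define M where "M = (\<Sum>r<m. a r)"
    have mult: "a (k * m + r) \<le> k * a m + a r" for k r
    proof (induction k)
      case (Suc k)
      then show ?case using sub[of m "k * m + r"] by (simp add: algebra_simps)
    qed simp
    have le: "a n / n \<le> a m / m + M / n" if n: "n \<ge> 1" for n
    proof -
      have "a n \<le> (n div m) * a m + a (n mod m)" using mult[of "n div m" "n mod m"] by simp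
      also have "a (n mod m) \<le> M"
        unfolding M_def using m nonneg by (intro member_le_sum) auto
      also have "real (n div m) * a m \<le> (n / m) * a m"
        using nonneg of_nat_div_le_of_nat[of n m, where 'a = real] by (intro mult_right_mono) auto
      finally show ?thesis using n m by (simp add: field_simps)
    qed
    have "(\<lambda>n. M / real n) \<longlonglongrightarrow> 0" by (rule lim_const_over_n)
    then have "\<forall>\<^sub>F n in sequentially. M / real n < e / 2" using e by (intro order_tendstoD) auto
    then show "\<forall>\<^sub>F n in sequentially. dist (a n / n) L < e"
      using eventually_ge_at_top[of "1::nat"]
    proof eventually_elim
      case (elim n)
      then show ?case using le[of n] L[of n] m(2) unfolding dist_real_def by linarith
    qed
  qed
  then show ?thesis by (auto simp: convergent_def)
qed

section \<open>Itineraries and entropy of a measure-preserving map\<close>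

locale measure_preserving_partition = prob_space \<mu> for \<mu> :: "'a measure" +
  fixes T :: "'a \<Rightarrow> 'a" and \<xi> :: "'a set set"
  assumes T_measurable [measurable]: "T \<in> measurable \<mu> \<mu>" and T_invariant: "distr \<mu> \<mu> T = \<mu>"
    and \<xi>_finite: "finite \<xi>" and \<xi>_sets: "\<xi> \<subseteq> sets \<mu>" and \<xi>_partition: "partition_on (space \<mu>) \<xi>"
begin

definition "label x = (THE A. A \<in> \<xi> \<and> x \<in> A)"
text \<open>The itinerary of \<open>x\<close>. Indexing the atoms of the join by words turns
  entropies into sums over \<open>words \<xi> n\<close>, which split under concatenation.\<close>

definition "name n x = map (\<lambda>i. label ((T ^^ i) x)) [0..<n]"
definition "cell n w = {x \<in> space \<mu>. name n x = w}"
definition "H n = partition_entropy \<mu> (iterated_join \<mu> T \<xi> n)"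

lemma label_unique: "x \<in> A \<Longrightarrow> A \<in> \<xi> \<Longrightarrow> label x = A"
  unfolding label_def using \<xi>_partition
  by (intro the_equality) (auto simp: partition_on_def disjoint_def)

lemma label: "x \<in> space \<mu> \<Longrightarrow> label x \<in> \<xi> \<and> x \<in> label x"
  using \<xi>_partition label_unique by (metis UnionE partition_onD1)

lemma funpow_T [measurable]: "(T ^^ n) \<in> measurable \<mu> \<mu>"
  by (rule measurable_compose_n) (rule T_measurable)

lemma funpow_T_space: "x \<in> space \<mu> \<Longrightarrow> (T ^^ n) x \<in> space \<mu>"
  using funpow_T by (rule measurable_space)

lemma funpow_T_invariant: "distr \<mu> \<mu> (T ^^ n) = \<mu>"
proof (induction n)
  case 0
  have "distr \<mu> \<mu> (\<lambda>x. x) = \<mu>" by (rule distr_id)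
  then show ?case by (simp add: id_def)
next
  case (Suc n)
  have "distr \<mu> \<mu> (T ^^ Suc n) = distr (distr \<mu> \<mu> (T ^^ n)) \<mu> T"
    using distr_distr[OF T_measurable funpow_T, of n] by simp
  then show ?case unfolding Suc T_invariant .
qed

lemma measure_vimage: "A \<in> sets \<mu> \<Longrightarrow> measure \<mu> ((T ^^ n) -` A \<inter> space \<mu>) = measure \<mu> A"
  using measure_distr[OF funpow_T, of A n] by (simp add: funpow_T_invariant)

lemma integral_birkhoff_sum:
  fixes f :: "'a \<Rightarrow> real"
  assumes "integrable \<mu> f"
  shows "integrable \<mu> (birkhoff_sum T f n)" "(\<integral>x. birkhoff_sum T f n x \<partial>\<mu>) = n * (\<integral>x. f x \<partial>\<mu>)"
proof -
  have i: "integrable \<mu> (\<lambda>x. f ((T ^^ i) x))" for i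
    using integrable_distr[OF funpow_T, of i f] assms by (simp add: funpow_T_invariant)
  have e: "(\<integral>x. f ((T ^^ i) x) \<partial>\<mu>) = (\<integral>x. f x \<partial>\<mu>)" for i
    using integral_distr[OF funpow_T, of f i] assms by (simp add: funpow_T_invariant)
  show "integrable \<mu> (birkhoff_sum T f n)" unfolding birkhoff_sum_def[abs_def] using i by simp
  show "(\<integral>x. birkhoff_sum T f n x \<partial>\<mu>) = n * (\<integral>x. f x \<partial>\<mu>)"
    unfolding birkhoff_sum_def using i by (simp add: e)
qed

lemma name_in_words: "x \<in> space \<mu> \<Longrightarrow> name n x \<in> words \<xi> n"
  using label funpow_T_space by (auto simp: name_def words_def)

lemma cell_eq: "w \<in> words \<xi> n \<Longrightarrow> cell n w = {x \<in> space \<mu>. \<forall>i<n. (T ^^ i) x \<in> w ! i}"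
proof -
  assume w: "w \<in> words \<xi> n"
  have "name n x = w \<longleftrightarrow> (\<forall>i<n. (T ^^ i) x \<in> w ! i)" if "x \<in> space \<mu>" for x
  proof -
    have "name n x = w \<longleftrightarrow> (\<forall>i<n. label ((T ^^ i) x) = w ! i)"
      using w by (auto simp: name_def words_def list_eq_iff_nth_eq)
    also have "\<dots> \<longleftrightarrow> (\<forall>i<n. (T ^^ i) x \<in> w ! i)"
      using label[OF funpow_T_space[OF that]] label_unique nth_words[OF w] by metis
    finally show ?thesis .
  qed
  then show ?thesis by (auto simp: cell_def)
qed

lemma cell_sets [measurable]: "cell n w \<in> sets \<mu>"
proof (cases "w \<in> words \<xi> n")
  case True
  have "{x \<in> space \<mu>. (T ^^ i) x \<in> w ! i} \<in> sets \<mu>" if "i < n" for i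
  proof -
    have "w ! i \<in> sets \<mu>" using nth_words[OF True that] \<xi>_sets by auto
    then show ?thesis by measurable
  qed
  then have "{x \<in> space \<mu>. \<forall>i\<in>{..<n}. (T ^^ i) x \<in> w ! i} \<in> sets \<mu>"
    by (intro sets.sets_Collect_finite_All) auto
  moreover have "cell n w = {x \<in> space \<mu>. \<forall>i\<in>{..<n}. (T ^^ i) x \<in> w ! i}"
    unfolding cell_eq[OF True] by blast
  ultimately show ?thesis by (simp only:)
next
  case False
  then have "cell n w = {}" using name_in_words by (auto simp: cell_def)
  then show ?thesis by simp
qed

lemma finite_words_\<xi>: "finite (words \<xi> n)"
  by (rule finite_words) (rule \<xi>_finite)

lemma measure_fibres:
  assumes "A \<in> sets \<mu>" "finite J" "\<And>x. x \<in> space \<mu> \<Longrightarrow> F x \<in> J"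
    "\<And>j. j \<in> J \<Longrightarrow> {x \<in> space \<mu>. F x = j} \<in> sets \<mu>"
  shows "measure \<mu> A = (\<Sum>j\<in>J. measure \<mu> (A \<inter> {x \<in> space \<mu>. F x = j}))"
  using assms by (intro measure_real_sum_image_fn) auto

text \<open>A nonempty cell determines its word, so each atom of the join is counted once; a word
  with empty cell contributes 0, as a zero factor stands before the logarithm.\<close>

lemma H_eq: "H n = - (\<Sum>w\<in>words \<xi> n. measure \<mu> (cell n w) * ln (measure \<mu> (cell n w)))"
proof -
  let ?N = "{w \<in> words \<xi> n. cell n w \<noteq> {}}"
  have join: "iterated_join \<mu> T \<xi> n = cell n ` ?N"
  proof -
    have "(\<lambda>a. {x \<in> space \<mu>. \<forall>i<n. (T ^^ i) x \<in> a i}) ` ({..<n} \<rightarrow>\<^sub>E \<xi>) = cell n ` words \<xi> n"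
    proof (intro equalityI subsetI)
      fix A assume "A \<in> (\<lambda>a. {x \<in> space \<mu>. \<forall>i<n. (T ^^ i) x \<in> a i}) ` ({..<n} \<rightarrow>\<^sub>E \<xi>)"
      then obtain a where a: "a \<in> {..<n} \<rightarrow>\<^sub>E \<xi>" "A = {x \<in> space \<mu>. \<forall>i<n. (T ^^ i) x \<in> a i}" by auto
      then have w: "map a [0..<n] \<in> words \<xi> n" by (auto simp: words_def)
      have "A = cell n (map a [0..<n])" unfolding cell_eq[OF w] a(2) by auto
      then show "A \<in> cell n ` words \<xi> n" using w by auto
    next
      fix A assume "A \<in> cell n ` words \<xi> n"
      then obtain w where w: "w \<in> words \<xi> n" "A = cell n w" by auto
      have "restrict ((!) w) {..<n} \<in> {..<n} \<rightarrow>\<^sub>E \<xi>" using nth_words[OF w(1)] by auto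
      moreover have "A = {x \<in> space \<mu>. \<forall>i<n. (T ^^ i) x \<in> restrict ((!) w) {..<n} i}"
        using cell_eq[OF w(1)] w(2) by auto
      ultimately show "A \<in> (\<lambda>a. {x \<in> space \<mu>. \<forall>i<n. (T ^^ i) x \<in> a i}) ` ({..<n} \<rightarrow>\<^sub>E \<xi>)" by blast
    qed
    then show ?thesis unfolding iterated_join_def by auto
  qed
  have "inj_on (cell n) ?N" by (rule inj_onI) (auto simp: cell_def)
  then have "(\<Sum>A\<in>iterated_join \<mu> T \<xi> n. measure \<mu> A * ln (measure \<mu> A)) =
      (\<Sum>w\<in>?N. measure \<mu> (cell n w) * ln (measure \<mu> (cell n w)))"
    unfolding join by (simp add: sum.reindex)
  also have "\<dots> = (\<Sum>w\<in>words \<xi> n. measure \<mu> (cell n w) * ln (measure \<mu> (cell n w)))"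
    using finite_words_\<xi> by (intro sum.mono_neutral_left) auto
  finally show ?thesis by (simp add: H_def partition_entropy_def)
qed

lemma H_nonneg: "0 \<le> H n"
proof -
  have "(\<Sum>w\<in>words \<xi> n. measure \<mu> (cell n w) * ln (measure \<mu> (cell n w))) \<le> 0"
  proof (rule sum_nonpos)
    fix w
    have "ln (measure \<mu> (cell n w)) \<le> 0"
      using ln_le_zero_iff[of "measure \<mu> (cell n w)"] prob_le_1[of "cell n w"]
      by (cases "measure \<mu> (cell n w) = 0") (auto simp: zero_less_measure_iff)
    then show "measure \<mu> (cell n w) * ln (measure \<mu> (cell n w)) \<le> 0"
      by (intro mult_nonneg_nonpos) auto
  qed
  then show ?thesis by (simp add: H_eq)
qed

lemma sum_measure_cells: "(\<Sum>w\<in>words \<xi> n. measure \<mu> (cell n w)) = 1"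
proof -
  have "measure \<mu> (space \<mu>) = (\<Sum>w\<in>words \<xi> n. measure \<mu> (space \<mu> \<inter> {x \<in> space \<mu>. name n x = w}))"
    using cell_sets[unfolded cell_def] name_in_words
    by (intro measure_fibres finite_words_\<xi>) auto
  then show ?thesis by (simp add: cell_def prob_space Int_def)
qed

lemma cell_append:
  assumes "u \<in> words \<xi> n"
  shows "cell (n + m) (u @ v) = cell n u \<inter> ((T ^^ n) -` cell m v \<inter> space \<mu>)"
proof -
  have "name (n + m) x = name n x @ name m ((T ^^ n) x)" for x
    by (auto simp: name_def list_eq_iff_nth_eq nth_append funpow_add[symmetric, THEN fun_cong, unfolded comp_def])
  moreover have "length (name n x) = length u" for x
    using assms by (simp add: name_def words_def)
  ultimately show ?thesis using funpow_T_space by (auto simp: cell_def)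
qed

text \<open>The reference weight of a word is the product of the measures of its two parts, as if
  these were independent. Invariance gives the second part the same marginal as a word starting at
  time 0.\<close>

lemma H_subadditive: "H (n + m) \<le> H n + H m"
proof -
  let ?q = "\<lambda>k w. measure \<mu> (cell k w)"
  have split: "measure \<mu> (cell (n + m) (u @ v)) \<le> ?q n u" "measure \<mu> (cell (n + m) (u @ v)) \<le> ?q m v"
    if "u \<in> words \<xi> n" for u v
  proof -
    show "?q (n + m) (u @ v) \<le> ?q n u"
      unfolding cell_append[OF that] by (intro finite_measure_mono) auto
    have "?q (n + m) (u @ v) \<le> measure \<mu> ((T ^^ n) -` cell m v \<inter> space \<mu>)"
      unfolding cell_append[OF that] by (intro finite_measure_mono) auto
    then show "?q (n + m) (u @ v) \<le> ?q m v" by (simp add: measure_vimage)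
  qed
  have left: "(\<Sum>v\<in>words \<xi> m. ?q (n + m) (u @ v)) = ?q n u" if u: "u \<in> words \<xi> n" for u
  proof -
    have "?q n u = (\<Sum>v\<in>words \<xi> m. measure \<mu> (cell n u \<inter> {x \<in> space \<mu>. name m ((T ^^ n) x) = v}))"
    proof (intro measure_fibres finite_words_\<xi>)
      fix v
      have "(T ^^ n) -` cell m v \<inter> space \<mu> \<in> sets \<mu>" by measurable
      also have "(T ^^ n) -` cell m v \<inter> space \<mu> = {x \<in> space \<mu>. name m ((T ^^ n) x) = v}"
        using funpow_T_space by (auto simp: cell_def)
      finally show "{x \<in> space \<mu>. name m ((T ^^ n) x) = v} \<in> sets \<mu>" .
    qed (auto intro: name_in_words funpow_T_space)
    also have "\<dots> = (\<Sum>v\<in>words \<xi> m. ?q (n + m) (u @ v))"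
      unfolding cell_append[OF u] using funpow_T_space
      by (intro sum.cong refl arg_cong[where f = "measure \<mu>"]) (auto simp: cell_def)
    finally show ?thesis ..
  qed
  have right: "(\<Sum>u\<in>words \<xi> n. ?q (n + m) (u @ v)) = ?q m v" for v
  proof -
    have "?q m v = measure \<mu> ((T ^^ n) -` cell m v \<inter> space \<mu>)" by (simp add: measure_vimage)
    also have "\<dots> = (\<Sum>u\<in>words \<xi> n. measure \<mu> ((T ^^ n) -` cell m v \<inter> space \<mu> \<inter> {x \<in> space \<mu>. name n x = u}))"
      using cell_sets[unfolded cell_def] name_in_words
      by (intro measure_fibres finite_words_\<xi>) auto
    also have "\<dots> = (\<Sum>u\<in>words \<xi> n. ?q (n + m) (u @ v))"
      by (intro sum.cong refl arg_cong[where f = "measure \<mu>"]) (auto simp: cell_append, auto simp: cell_def)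
    finally show ?thesis ..
  qed
  let ?R = "\<lambda>w. ?q n (take n w) * ?q m (drop n w)"
  have len: "length u = n" if "u \<in> words \<xi> n" for u using that by (simp add: words_def)
  have total: "(\<Sum>w\<in>words \<xi> (n + m). ?R w) = 1"
    unfolding sum_words_add by (simp add: len sum_distrib_left[symmetric] sum_measure_cells)
  have pos: "0 < ?q n (take n w)" "0 < ?q m (drop n w)"
    if "w \<in> words \<xi> (n + m)" "0 < ?q (n + m) w" for w
    using split[of "take n w" "drop n w"] that
    by (auto simp: words_def dest: in_set_takeD intro: less_le_trans)
  \<comment> \<open>The one-point second index reduces Gibbs' inequality to its usual form; the
    reference weights sum to 1, so the first logarithm vanishes.\<close>
  have "H (n + m) \<le> ln (\<Sum>w\<in>words \<xi> (n + m). \<Sum>_\<in>{()}. ?R w)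
      - (\<Sum>w\<in>words \<xi> (n + m). \<Sum>_\<in>{()}. ?q (n + m) w * ln (?R w))"
    using gibbs_inequality[of "words \<xi> (n + m)" "{()}" "\<lambda>w _. ?q (n + m) w" "\<lambda>w _. ?R w"]
      finite_words_\<xi> sum_measure_cells pos by (simp add: H_eq)
  also have "\<dots> = - (\<Sum>w\<in>words \<xi> (n + m). ?q (n + m) w * ln (?R w))"
    by (simp add: total)
  also have "\<dots> = - (\<Sum>w\<in>words \<xi> (n + m).
      ?q (n + m) w * ln (?q n (take n w)) + ?q (n + m) w * ln (?q m (drop n w)))"
  proof (intro arg_cong[where f = uminus] sum.cong refl)
    fix w assume w: "w \<in> words \<xi> (n + m)"
    show "?q (n + m) w * ln (?R w) = ?q (n + m) w * ln (?q n (take n w)) + ?q (n + m) w * ln (?q m (drop n w))"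
    proof (cases "?q (n + m) w = 0")
      case False
      then have "0 < ?q (n + m) w" by (simp add: zero_less_measure_iff)
      then show ?thesis using pos[OF w] by (simp add: ln_mult algebra_simps)
    qed simp
  qed
  also have "\<dots> = - (\<Sum>u\<in>words \<xi> n. \<Sum>v\<in>words \<xi> m. ?q (n + m) (u @ v) * ln (?q n u))
      - (\<Sum>u\<in>words \<xi> n. \<Sum>v\<in>words \<xi> m. ?q (n + m) (u @ v) * ln (?q m v))"
    unfolding sum_words_add by (simp add: len sum.distrib)
  also have "(\<Sum>u\<in>words \<xi> n. \<Sum>v\<in>words \<xi> m. ?q (n + m) (u @ v) * ln (?q n u)) = - H n"
    by (simp add: H_eq sum_distrib_right[symmetric] left)
  also have "(\<Sum>u\<in>words \<xi> n. \<Sum>v\<in>words \<xi> m. ?q (n + m) (u @ v) * ln (?q m v)) = - H m"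
    by (subst sum.swap) (simp add: H_eq sum_distrib_right[symmetric] right)
  finally show ?thesis by simp
qed

text \<open>The rate is defined by \<open>lim\<close>, which carries information only once the limit
  exists; subadditivity provides that.\<close>

lemma entropy_rate_limit: "(\<lambda>n. H n / n) \<longlonglongrightarrow> partition_entropy_rate \<mu> T \<xi>"
  using subadditive_convergent[of H, OF H_subadditive H_nonneg]
  by (simp add: partition_entropy_rate_def H_def convergent_LIMSEQ_iff)

end


section \<open>Approximation by cylinders\<close>

text \<open>Unions of cylinders of length \<open>k\<close>; for fixed \<open>k\<close> they form an
  algebra of sets.\<close>

definition cylinder_set :: "nat \<Rightarrow> nat \<Rightarrow> (nat \<Rightarrow> nat) set \<Rightarrow> bool" where
  "cylinder_set d k A \<longleftrightarrow> A \<subseteq> bernoulli_space d \<and>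
     (\<forall>x\<in>A. \<forall>y\<in>bernoulli_space d. (\<forall>i<k. x i = y i) \<longrightarrow> y \<in> A)"

lemma cylinder_set_mono: "cylinder_set d k A \<Longrightarrow> k \<le> l \<Longrightarrow> cylinder_set d l A"
  unfolding cylinder_set_def by (meson less_le_trans)

lemma cylinder_set_Diff: "cylinder_set d k A \<Longrightarrow> cylinder_set d k (bernoulli_space d - A)"
  unfolding cylinder_set_def by (metis DiffD1 DiffD2 DiffI Diff_subset)

lemma cylinder_set_Un: "cylinder_set d k A \<Longrightarrow> cylinder_set d k B \<Longrightarrow> cylinder_set d k (A \<union> B)"
  unfolding cylinder_set_def by blast

lemma openin_bernoulli:
  assumes "0 < \<theta>" "\<theta> < 1"
  shows "openin (mtopology_of (bernoulli_metric d \<theta>)) U \<longleftrightarrow> U \<subseteq> bernoulli_space d \<and>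
    (\<forall>x\<in>U. \<exists>k. \<forall>y\<in>bernoulli_space d. (\<forall>i<k. x i = y i) \<longrightarrow> y \<in> U)"
proof -
  interpret Metric_space "bernoulli_space d" "bernoulli_dist \<theta>"
    by (rule Metric_space_bernoulli[OF assms])
  have "(\<exists>r>0. mball x r \<subseteq> U) \<longleftrightarrow>
      (\<exists>k. \<forall>y\<in>bernoulli_space d. (\<forall>i<k. x i = y i) \<longrightarrow> y \<in> U)" if x: "x \<in> bernoulli_space d" for x
  proof
    assume "\<exists>r>0. mball x r \<subseteq> U"
    then obtain r where r: "r > 0" "mball x r \<subseteq> U" by blast
    obtain k where k: "\<theta> ^ k < r" using real_arch_pow_inv[OF r(1) assms(2)] by blast
    have "y \<in> U" if "y \<in> bernoulli_space d" "\<forall>i<k. x i = y i" for y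
      using that r(2) x k bernoulli_dist_le_iff[OF assms, of x y k] by (force simp: in_mball)
    then show "\<exists>k. \<forall>y\<in>bernoulli_space d. (\<forall>i<k. x i = y i) \<longrightarrow> y \<in> U" by blast
  next
    assume "\<exists>k. \<forall>y\<in>bernoulli_space d. (\<forall>i<k. x i = y i) \<longrightarrow> y \<in> U"
    then obtain k where k: "\<And>y. y \<in> bernoulli_space d \<Longrightarrow> \<forall>i<k. x i = y i \<Longrightarrow> y \<in> U" by blast
    have "mball x (\<theta> ^ k) \<subseteq> U"
    proof
      fix y assume "y \<in> mball x (\<theta> ^ k)"
      then have "y \<in> bernoulli_space d" "bernoulli_dist \<theta> x y \<le> \<theta> ^ k" by (auto simp: in_mball)
      then show "y \<in> U" using k bernoulli_dist_le_iff[OF assms, of x y k] by blast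
    qed
    then show "\<exists>r>0. mball x r \<subseteq> U" using assms by (intro exI[of _ "\<theta> ^ k"]) auto
  qed
  then have "openin mtopology U \<longleftrightarrow> U \<subseteq> bernoulli_space d \<and>
    (\<forall>x\<in>U. \<exists>k. \<forall>y\<in>bernoulli_space d. (\<forall>i<k. x i = y i) \<longrightarrow> y \<in> U)"
    unfolding openin_mtopology by blast
  then show ?thesis using assms by (simp add: mtopology_of_def)
qed

lemma cylinder_set_open:
  assumes "0 < \<theta>" "\<theta> < 1" "cylinder_set d k A"
  shows "openin (mtopology_of (bernoulli_metric d \<theta>)) A"
  using assms unfolding openin_bernoulli[OF assms(1,2)] cylinder_set_def by blast

lemma cylinder_set_sets:
  assumes "0 < \<theta>" "\<theta> < 1" "cylinder_set d k A"
  shows "A \<in> sets (borel_of_metric (bernoulli_metric d \<theta>))"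
  unfolding sets_borel_of_metric using cylinder_set_open[OF assms] by (auto intro: sigma_sets.Basic)

locale shift_measure = prob_space \<mu> for \<mu> :: "(nat \<Rightarrow> nat) measure" +
  fixes d :: nat and \<theta> :: real
  assumes d: "d \<ge> 1" and \<theta>: "0 < \<theta>" "\<theta> < 1"
    and sets_\<mu>: "sets \<mu> = sets (borel_of_metric (bernoulli_metric d \<theta>))"
    and space_\<mu>: "space \<mu> = bernoulli_space d"
    and shift_meas: "left_shift \<in> measurable \<mu> \<mu>" and shift_invariant: "distr \<mu> \<mu> left_shift = \<mu>"
begin

lemma cylinder_measurable: "cylinder_set d k A \<Longrightarrow> A \<in> sets \<mu>"
  unfolding sets_\<mu> by (rule cylinder_set_sets[OF \<theta>])

text \<open>The sets with this property include the open sets and are closed under complements and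
  countable unions. Complements leave symmetric differences unchanged; countable unions are treated
  as increasing limits of finite ones.\<close>

lemma cylinder_approx:
  assumes "A \<in> sets \<mu>" "\<epsilon> > 0"
  shows "\<exists>k C. cylinder_set d k C \<and> measure \<mu> (sym_diff A C) < \<epsilon>"
proof -
  let ?X = "bernoulli_space d"
  define P where "P A \<longleftrightarrow> A \<in> sets \<mu> \<and> (\<forall>\<epsilon>>0. \<exists>k C. cylinder_set d k C \<and> measure \<mu> (sym_diff A C) < \<epsilon>)" for A
  have mono_limit: "P A" if inc: "incseq U" and U: "\<And>n::nat. P (U n)" and A: "A = (\<Union>n. U n)" for U A
    unfolding P_def
  proof (intro conjI allI impI)
    have Us: "U n \<in> sets \<mu>" for n using U by (simp add: P_def)
    show As: "A \<in> sets \<mu>" unfolding A using Us by auto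
    fix \<epsilon> :: real assume \<epsilon>: "\<epsilon> > 0"
    have "(\<lambda>n. measure \<mu> (U n)) \<longlonglongrightarrow> measure \<mu> A"
      unfolding A using Us by (intro finite_Lim_measure_incseq inc) auto
    then have "\<forall>\<^sub>F n in sequentially. measure \<mu> A - \<epsilon> / 2 < measure \<mu> (U n)"
      using \<epsilon> by (intro order_tendstoD) auto
    then obtain n where n: "measure \<mu> A - \<epsilon> / 2 < measure \<mu> (U n)"
      by (auto simp: eventually_sequentially)
    obtain k C where C: "cylinder_set d k C" "measure \<mu> (sym_diff (U n) C) < \<epsilon> / 2"
      using U[of n] \<epsilon> unfolding P_def by (meson half_gt_zero)
    note Cs = cylinder_measurable[OF C(1)]
    have "measure \<mu> (sym_diff A C) \<le> measure \<mu> ((A - U n) \<union> sym_diff (U n) C)"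
      using As Us Cs A by (intro finite_measure_mono) auto
    also have "\<dots> \<le> measure \<mu> (A - U n) + measure \<mu> (sym_diff (U n) C)"
      using As Us Cs by (intro measure_Un_le) auto
    also have "measure \<mu> (A - U n) = measure \<mu> A - measure \<mu> (U n)"
      using As Us A by (intro finite_measure_Diff) auto
    finally show "\<exists>k C. cylinder_set d k C \<and> measure \<mu> (sym_diff A C) < \<epsilon>"
      using C n by (intro exI[of _ k] exI[of _ C]) auto
  qed
  have P_cyl: "P A" if "cylinder_set d k A" for k A
    unfolding P_def using that cylinder_measurable by (auto intro!: exI[of _ k] exI[of _ A])
  have P_Un: "P (A \<union> B)" if PA: "P A" and PB: "P B" for A B
    unfolding P_def
  proof (intro conjI allI impI)
    have [simp]: "A \<in> sets \<mu>" "B \<in> sets \<mu>" using PA PB by (auto simp: P_def)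
    show "A \<union> B \<in> sets \<mu>" by auto
    fix \<epsilon> :: real assume \<epsilon>: "\<epsilon> > 0"
    obtain k C where C: "cylinder_set d k C" "measure \<mu> (sym_diff A C) < \<epsilon> / 2"
      using PA \<epsilon> unfolding P_def by (meson half_gt_zero)
    obtain l D where D: "cylinder_set d l D" "measure \<mu> (sym_diff B D) < \<epsilon> / 2"
      using PB \<epsilon> unfolding P_def by (meson half_gt_zero)
    note [simp] = cylinder_measurable[OF C(1)] cylinder_measurable[OF D(1)]
    have "measure \<mu> (sym_diff (A \<union> B) (C \<union> D)) \<le> measure \<mu> (sym_diff A C \<union> sym_diff B D)"
      by (intro finite_measure_mono sets.Un sets.Diff) auto
    also have "\<dots> \<le> measure \<mu> (sym_diff A C) + measure \<mu> (sym_diff B D)"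
      by (intro measure_Un_le sets.Un sets.Diff) auto
    finally have "measure \<mu> (sym_diff (A \<union> B) (C \<union> D)) < \<epsilon>" using C D by simp
    moreover have "cylinder_set d (max k l) (C \<union> D)"
      using C(1) D(1) by (intro cylinder_set_Un) (auto elim: cylinder_set_mono)
    ultimately show "\<exists>k C. cylinder_set d k C \<and> measure \<mu> (sym_diff (A \<union> B) C) < \<epsilon>" by blast
  qed
  have "A \<in> sigma_sets ?X {U. openin (mtopology_of (bernoulli_metric d \<theta>)) U}"
    using assms(1) \<theta> by (simp add: sets_\<mu> sets_borel_of_metric)
  then have "P A"
  proof (induction rule: sigma_sets.induct)
    case (Basic U)
    \<comment> \<open>\<open>V k\<close> is the union of the \<open>k\<close>-cylinders inside
      \<open>U\<close>; openness means that these exhaust \<open>U\<close>.\<close>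
    define V where "V k = {x \<in> ?X. \<forall>y\<in>?X. (\<forall>i<k. x i = y i) \<longrightarrow> y \<in> U}" for k
    show ?case
    proof (rule mono_limit)
      show "incseq V" unfolding V_def by (rule monoI) (fastforce dest: less_le_trans)
      show "P (V k)" for k
        by (rule P_cyl[of k]) (auto simp: cylinder_set_def V_def)
      show "U = (\<Union>k. V k)"
        using Basic unfolding mem_Collect_eq openin_bernoulli[OF \<theta>] V_def by blast
    qed
  next
    case Empty
    show ?case by (rule P_cyl[of 0]) (simp add: cylinder_set_def)
  next
    case (Compl A)
    have "sym_diff (?X - A) (?X - C) = sym_diff A C" if "cylinder_set d k C" for k C
      using that Compl(2) sets.sets_into_space[of A \<mu>] by (auto simp: P_def space_\<mu> cylinder_set_def)
    then show ?case
      using Compl(2) cylinder_set_Diff sets.compl_sets[of A \<mu>] unfolding P_def space_\<mu> by metis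
  next
    case (Union A)
    have "P (\<Union>i<n. A i)" for n
    proof (induction n)
      case 0
      show ?case by (rule P_cyl[of 0]) (simp add: cylinder_set_def)
    next
      case (Suc n)
      then show ?case using P_Un[OF Union(2)[of n] Suc] by (simp add: lessThan_Suc)
    qed
    then show ?case
      by (rule mono_limit[rotated]) (auto intro!: monoI simp: less_le_trans, force)
  qed
  then show ?thesis using assms(2) by (simp add: P_def)
qed

lemma integral_le_fibres:
  fixes f :: "(nat \<Rightarrow> nat) \<Rightarrow> real"
  assumes "finite J" "\<And>x. x \<in> space \<mu> \<Longrightarrow> F x \<in> J"
    "\<And>j. j \<in> J \<Longrightarrow> {x \<in> space \<mu>. F x = j} \<in> sets \<mu>"
    "integrable \<mu> f" "\<And>x. x \<in> space \<mu> \<Longrightarrow> f x \<le> c (F x)"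
  shows "(\<integral>x. f x \<partial>\<mu>) \<le> (\<Sum>j\<in>J. measure \<mu> {x \<in> space \<mu>. F x = j} * c j)"
proof -
  have "(\<integral>x. f x \<partial>\<mu>) \<le> (\<integral>x. (\<Sum>j\<in>J. indicator {x \<in> space \<mu>. F x = j} x * c j) \<partial>\<mu>)"
  proof (rule integral_mono)
    show "integrable \<mu> (\<lambda>x. \<Sum>j\<in>J. indicator {x \<in> space \<mu>. F x = j} x * c j)"
      using assms(3) by (intro Bochner_Integration.integrable_sum integrable_mult_left integrable_real_indicator)
        (auto simp: emeasure_eq_measure)
    fix x assume x: "x \<in> space \<mu>"
    have "(\<Sum>j\<in>J. indicator {x \<in> space \<mu>. F x = j} x * c j) = (\<Sum>j\<in>J. if j = F x then c j else 0)"
      using x by (intro sum.cong) (auto simp: indicator_def)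
    then show "f x \<le> (\<Sum>j\<in>J. indicator {x \<in> space \<mu>. F x = j} x * c j)"
      using assms(1,2,5) x by simp
  qed fact
  also have "\<dots> = (\<Sum>j\<in>J. measure \<mu> {x \<in> space \<mu>. F x = j} * c j)"
    using assms(3) by (subst Bochner_Integration.integral_sum) (auto simp: emeasure_eq_measure)
  finally show ?thesis .
qed

end

text \<open>The sum over words factors into a product of sums over letters. The factors may depend
  on the position, which also lets the induction shift them by one.\<close>

lemma sum_words_prod_le:
  fixes f :: "nat \<Rightarrow> 'a \<Rightarrow> real"
  assumes "\<And>i a. a \<in> A \<Longrightarrow> 0 \<le> f i a" "\<And>i. (\<Sum>a\<in>A. f i a) \<le> c"
  shows "(\<Sum>w\<in>words A n. \<Prod>i<n. f i (w ! i)) \<le> c ^ n"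
  using assms
proof (induction n arbitrary: f)
  case (Suc n)
  have c: "0 \<le> c" using Suc.prems sum_nonneg[of A "f 0"] by (meson order_trans)
  have "(\<Sum>w\<in>words A (Suc n). \<Prod>i<Suc n. f i (w ! i)) =
      (\<Sum>w\<in>words A n. \<Sum>a\<in>A. f 0 a * (\<Prod>i<n. f (Suc i) (w ! i)))"
    unfolding sum_words_Suc prod.lessThan_Suc_shift by simp
  also have "\<dots> = (\<Sum>a\<in>A. f 0 a) * (\<Sum>w\<in>words A n. \<Prod>i<n. f (Suc i) (w ! i))"
    by (simp add: sum_distrib_left[symmetric] sum_distrib_right[symmetric] mult.commute)
  also have "\<dots> \<le> c * c ^ n"
    using Suc.prems c by (intro mult_mono Suc.IH sum_nonneg prod_nonneg) (auto intro: nth_words)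
  finally show ?case by simp
qed simp

lemma shift_Lipschitz_continuous_map:
  assumes "shift_Lipschitz d \<theta> C \<phi>" "0 < \<theta>" "\<theta> < 1"
  shows "continuous_map (mtopology_of (bernoulli_metric d \<theta>)) euclidean \<phi>"
proof -
  have "\<bar>\<phi> x - \<phi> y\<bar> \<le> C * bernoulli_dist \<theta> x y"
    if "x \<in> bernoulli_space d" "y \<in> bernoulli_space d" for x y
  proof (cases "x = y")
    case False
    have "\<forall>i<(LEAST k. x k \<noteq> y k). x i = y i" using not_less_Least by blast
    from shift_LipschitzD[OF assms(1) that this] show ?thesis
      using False by (simp add: bernoulli_dist_def)
  qed (simp add: bernoulli_dist_def)
  then have "Lipschitz_continuous_map (bernoulli_metric d \<theta>) euclidean_metric \<phi>"
    unfolding Lipschitz_continuous_map_def using assms(2,3) by (auto simp: dist_real_def)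
  then have "continuous_map (mtopology_of (bernoulli_metric d \<theta>)) (mtopology_of euclidean_metric) \<phi>"
    by (rule Lipschitz_continuous_imp_continuous_map)
  then show ?thesis by simp
qed

lemma Lipschitz_imp_shift_Lipschitz:
  assumes "Lipschitz_continuous_map (bernoulli_metric d \<theta>) euclidean_metric \<phi>" "0 < \<theta>" "\<theta> < 1"
  shows "\<exists>C. shift_Lipschitz d \<theta> C \<phi>"
proof -
  obtain B where B: "\<And>x y. x \<in> bernoulli_space d \<Longrightarrow> y \<in> bernoulli_space d \<Longrightarrow>
      \<bar>\<phi> x - \<phi> y\<bar> \<le> B * bernoulli_dist \<theta> x y" "B > 0"
    using assms unfolding Lipschitz_continuous_map_pos by (auto simp: dist_real_def)
  have "shift_Lipschitz d \<theta> B \<phi>"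
    unfolding shift_Lipschitz_def
  proof (intro conjI ballI allI impI)
    fix x y k assume *: "x \<in> bernoulli_space d" "y \<in> bernoulli_space d" "\<forall>i<k. x i = y i"
    have "\<bar>\<phi> x - \<phi> y\<bar> \<le> B * bernoulli_dist \<theta> x y" by (rule B(1)[OF *(1,2)])
    also have "\<dots> \<le> B * \<theta> ^ k"
      using *(3) bernoulli_dist_le_iff[OF assms(2,3)] B(2) by (intro mult_left_mono) auto
    finally show "\<bar>\<phi> x - \<phi> y\<bar> \<le> B * \<theta> ^ k" .
  qed (use B(2) in simp)
  then show ?thesis by blast
qed

section \<open>Partition labels predicted by cylinders\<close>

locale shift_measure_partition = shift_measure +
  fixes \<xi> :: "(nat \<Rightarrow> nat) set set"
  assumes fin: "finite \<xi>" and sets: "\<xi> \<subseteq> sets \<mu>" and part: "partition_on (space \<mu>) \<xi>"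
begin

sublocale measure_preserving_partition \<mu> left_shift \<xi>
  by unfold_locales (use shift_meas shift_invariant fin sets part in auto)

text \<open>Each atom is approximated by a cylinder set up to an equal share of \<eta>. Off the
  union \<open>V\<close> of the symmetric differences, the approximating sets and the atoms have the
  same points, so the prediction \<gamma> is correct there.\<close>

lemma label_approx:
  assumes \<eta>: "\<eta> > 0"
  shows "\<exists>k V \<gamma>. V \<in> sets \<mu> \<and> measure \<mu> V \<le> \<eta> \<and>
    (\<forall>x\<in>space \<mu>. x \<notin> V \<longrightarrow> \<gamma> x = label x) \<and>
    (\<forall>x\<in>space \<mu>. \<forall>y\<in>space \<mu>. (\<forall>i<k. x i = y i) \<longrightarrow> \<gamma> x = \<gamma> y)"
proof -
  have ne: "\<xi> \<noteq> {}" using part not_empty by (auto simp: partition_on_def)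
  define e where "e = \<eta> / card \<xi>"
  have e: "e > 0" using \<eta> ne fin by (simp add: e_def card_gt_0_iff)
  have "\<forall>A\<in>\<xi>. \<exists>k C. cylinder_set d k C \<and> measure \<mu> (sym_diff A C) < e"
    using cylinder_approx[OF _ e] sets by blast
  then obtain K C where C: "\<And>A. A \<in> \<xi> \<Longrightarrow> cylinder_set d (K A) (C A)"
    "\<And>A. A \<in> \<xi> \<Longrightarrow> measure \<mu> (sym_diff A (C A)) < e" by metis
  define k where "k = (\<Sum>A\<in>\<xi>. K A)"
  have Ck: "cylinder_set d k (C A)" if "A \<in> \<xi>" for A
    using that fin by (intro cylinder_set_mono[OF C(1)]) (auto simp: k_def intro: member_le_sum)
  define V where "V = (\<Union>A\<in>\<xi>. sym_diff A (C A))"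
  \<comment> \<open>The choice is made from a set that depends only on which \<open>C A\<close>
    contain \<open>x\<close>. It therefore agrees for points with a common prefix of length
    \<open>k\<close>, even where this set is empty or has several elements.\<close>
  define \<gamma> where "\<gamma> x = (SOME A. A \<in> {A \<in> \<xi>. x \<in> C A})" for x
  have sd: "sym_diff A (C A) \<in> sets \<mu>" if "A \<in> \<xi>" for A
    using that sets cylinder_measurable[OF Ck[OF that]] by auto
  show ?thesis
  proof (intro exI[of _ k] exI[of _ V] exI[of _ \<gamma>] conjI ballI impI)
    show "V \<in> sets \<mu>" unfolding V_def using fin sd by auto
    have "measure \<mu> V \<le> (\<Sum>A\<in>\<xi>. measure \<mu> (sym_diff A (C A)))"
      unfolding V_def using sd by (intro finite_measure_subadditive_finite fin) auto
    also have "\<dots> \<le> (\<Sum>A\<in>\<xi>. e)" using C(2) by (intro sum_mono) (auto intro: less_imp_le)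
    also have "\<dots> = \<eta>" using ne fin by (simp add: e_def)
    finally show "measure \<mu> V \<le> \<eta>" .
    show "\<gamma> x = label x" if "x \<in> space \<mu>" "x \<notin> V" for x
    proof -
      have "{A \<in> \<xi>. x \<in> C A} = {label x}"
        using that label[OF that(1)] label_unique unfolding V_def by auto
      then show ?thesis by (simp add: \<gamma>_def)
    qed
    show "\<gamma> x = \<gamma> y" if "x \<in> space \<mu>" "y \<in> space \<mu>" "\<forall>i<k. x i = y i" for x y
    proof -
      have "x \<in> C A \<longleftrightarrow> y \<in> C A" if A: "A \<in> \<xi>" for A
        using Ck[OF A] \<open>x \<in> space \<mu>\<close> \<open>y \<in> space \<mu>\<close> \<open>\<forall>i<k. x i = y i\<close>
        unfolding cylinder_set_def space_\<mu> by metis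
      then have "{A \<in> \<xi>. x \<in> C A} = {A \<in> \<xi>. y \<in> C A}" by blast
      then show ?thesis by (simp add: \<gamma>_def)
    qed
  qed
qed

end


section \<open>Equilibrium states and periodic orbits\<close>

context shift_measure_partition
begin

text \<open>
  Gibbs' inequality is applied to the joint partition into \<open>\<xi>\<close>-names of length \<open>n\<close> and cylinders of
  length \<open>n + k\<close>. The reference weight of a name is multiplied by \<open>\<epsilon>\<close> for every position at which
  it differs from the name \<open>\<gamma>\<close> predicted by the cylinder.
\<close>

lemma entropy_upper:
  fixes \<epsilon> \<eta> K r :: real
  assumes \<psi>: "shift_Lipschitz d \<theta> C \<psi>" and K: "K > 0"
    and up: "\<And>n x. x \<in> bernoulli_space d \<Longrightarrow> (transfer d \<psi> ^^ n) (\<lambda>_. 1) x \<le> K * exp (n * r)"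
    and \<epsilon>: "0 < \<epsilon>" "\<epsilon> < 1" and \<eta>: "\<eta> > 0"
  shows "\<exists>c. \<forall>n. H n \<le> n * (r - (\<integral>x. \<psi> x \<partial>\<mu>) + \<epsilon> * card \<xi> - \<eta> * ln \<epsilon>) + c"
proof -
  interpret pot: shift_potential d \<theta> C \<psi>
    by unfold_locales (use d \<theta> \<psi> in auto)
  let ?o = "\<lambda>_. 1 :: nat"
  have o: "?o \<in> bernoulli_space d" by (rule pot.const_in_space)
  obtain k V \<gamma> where V: "V \<in> sets \<mu>" "measure \<mu> V \<le> \<eta>"
    and \<gamma>: "\<forall>x\<in>space \<mu>. x \<notin> V \<longrightarrow> \<gamma> x = label x"
      "\<forall>x\<in>space \<mu>. \<forall>y\<in>space \<mu>. (\<forall>i<k. x i = y i) \<longrightarrow> \<gamma> x = \<gamma> y"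
    using label_approx[OF \<eta>] by blast
  obtain K' where K': "K' > 0" "\<And>n. (\<Sum>w\<in>words {1..d} (n + k). exp (birkhoff_sum left_shift \<psi> n (conc w ?o)))
      \<le> K' * (transfer d \<psi> ^^ (n + k)) (\<lambda>_. 1) ?o"
    using pot.sum_longer_words_le[of k] o by blast
  \<comment> \<open>A positive penalty instead of 0 keeps the logarithm of the reference weight
    finite where the prediction fails.\<close>
  define kap where "kap A A' = (if A = A' then 1 else \<epsilon>)" for A A' :: "(nat \<Rightarrow> nat) set"
  have kap: "\<epsilon> \<le> kap A A'" "0 < kap A A'" for A A' using \<epsilon> by (auto simp: kap_def)
  define R where "R n a w = exp (birkhoff_sum left_shift \<psi> n (conc w ?o)) *
      (\<Prod>i<n. kap (a ! i) (\<gamma> ((left_shift ^^ i) (conc w ?o))))" for n a w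
  have R_pos: "R n a w > 0" for n a w
    unfolding R_def using kap(2) by (intro mult_pos_pos prod_pos) auto
  \<comment> \<open>The prefix has length \<open>n + k\<close> because the prediction at time
    \<open>i < n\<close> reads the coordinates from \<open>i\<close> to
    \<open>i + k - 1\<close>.\<close>
  define pre where "pre n x = map x [0..<n + k]" for n and x :: "nat \<Rightarrow> nat"
  have pre_fibre: "{x \<in> space \<mu>. pre n x = w} \<in> sets \<mu>" for n w
  proof (rule cylinder_measurable[of "n + k"])
    show "cylinder_set d (n + k) {x \<in> space \<mu>. pre n x = w}"
      by (auto simp: cylinder_set_def space_\<mu> pre_def)
  qed
  have pre_words: "pre n x \<in> words {1..d} (n + k)" if "x \<in> space \<mu>" for n x
    using that unfolding pre_def space_\<mu> by (rule prefix_in_words)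
  define q where "q n a w = measure \<mu> {x \<in> space \<mu>. (name n x, pre n x) = (a, w)}" for n a w
  have fibre: "{x \<in> space \<mu>. (name n x, pre n x) = (a, w)} = cell n a \<inter> {x \<in> space \<mu>. pre n x = w}" for n a w
    by (auto simp: cell_def)
  have q_marginal: "(\<Sum>w\<in>words {1..d} (n + k). q n a w) = measure \<mu> (cell n a)" for n a
    unfolding q_def fibre
    using pre_fibre pre_words by (intro measure_fibres[symmetric] finite_words cell_sets) auto
  have fins: "finite (words \<xi> n)" "finite (words {1..d} m)" for n m
    by (auto intro: finite_words fin)
  have sum_R: "(\<Sum>a\<in>words \<xi> n. \<Sum>w\<in>words {1..d} (n + k). R n a w)
      \<le> exp (n * (\<epsilon> * card \<xi>)) * (K' * (K * exp ((n + k) * r)))" for n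
  proof -
    \<comment> \<open>Admitting wrong labels raises the weight per position from at most 1 to at
      most \<open>1 + \<epsilon> * card \<xi>\<close>; this is the source of that term in the
      bound.\<close>
    have row: "(\<Sum>A\<in>\<xi>. kap A A') \<le> exp (\<epsilon> * card \<xi>)" for A'
    proof -
      have "(\<Sum>A\<in>\<xi>. kap A A') \<le> (\<Sum>A\<in>\<xi>. (if A = A' then 1 else 0) + \<epsilon>)"
        using \<epsilon> by (intro sum_mono) (auto simp: kap_def)
      also have "\<dots> \<le> 1 + \<epsilon> * card \<xi>" using fin by (simp add: sum.distrib)
      also have "\<dots> \<le> exp (\<epsilon> * card \<xi>)" by (rule exp_ge_add_one_self)
      finally show ?thesis .
    qed
    have "(\<Sum>a\<in>words \<xi> n. \<Sum>w\<in>words {1..d} (n + k). R n a w) =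
        (\<Sum>w\<in>words {1..d} (n + k). exp (birkhoff_sum left_shift \<psi> n (conc w ?o)) *
          (\<Sum>a\<in>words \<xi> n. \<Prod>i<n. kap (a ! i) (\<gamma> ((left_shift ^^ i) (conc w ?o)))))"
      unfolding R_def sum_distrib_left by (rule sum.swap)
    also have "\<dots> \<le> (\<Sum>w\<in>words {1..d} (n + k). exp (birkhoff_sum left_shift \<psi> n (conc w ?o)) *
          exp (\<epsilon> * card \<xi>) ^ n)"
      using kap row
      by (intro sum_mono mult_left_mono sum_words_prod_le[where f = "\<lambda>i A. kap A (\<gamma> (_ i))"])
        (auto intro: less_imp_le)
    also have "\<dots> = exp (n * (\<epsilon> * card \<xi>)) *
        (\<Sum>w\<in>words {1..d} (n + k). exp (birkhoff_sum left_shift \<psi> n (conc w ?o)))"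
      by (simp add: sum_distrib_left exp_of_nat_mult[symmetric] mult.commute)
    also have "\<dots> \<le> exp (n * (\<epsilon> * card \<xi>)) * (K' * (K * exp ((n + k) * r)))"
      using K' up[OF o, of "n + k"] by (intro mult_left_mono order_trans[OF K'(2)]) auto
    finally show ?thesis .
  qed
  have meas_\<psi>: "\<psi> \<in> borel_measurable \<mu>"
    using continuous_map_borel_of_metric[OF shift_Lipschitz_continuous_map[OF \<psi> \<theta>]] sets_\<mu>
    by (simp cong: measurable_cong_sets)
  obtain U where U: "\<And>x. x \<in> bernoulli_space d \<Longrightarrow> \<bar>\<psi> x\<bar> \<le> U"
    using shift_Lipschitz_bounded[OF \<psi> d] by metis
  have int_\<psi>: "integrable \<mu> \<psi>"
    using U by (intro integrable_const_bound[of _ U] AE_I2 meas_\<psi>) (auto simp: space_\<mu>)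
  have int_V: "integrable \<mu> (indicator V :: _ \<Rightarrow> real)"
    using V by (intro integrable_real_indicator) (auto simp: emeasure_eq_measure)
  \<comment> \<open>A lower bound for the logarithm of the reference weight that can be integrated.
    Only visits to \<open>V\<close> can be mispredicted, each loses at most
    \<open>- ln \<epsilon>\<close>, and by invariance their expected number is
    \<open>n * measure \<mu> V\<close>.\<close>
  define F where "F n x = birkhoff_sum left_shift \<psi> n x - pot.D + ln \<epsilon> * birkhoff_sum left_shift (indicator V) n x"
    for n x
  have F_le: "F n x \<le> ln (R n (name n x) (pre n x))" if x: "x \<in> space \<mu>" for n x
  proof -
    let ?y = "conc (pre n x) ?o"
    have y: "?y \<in> space \<mu>"
      unfolding space_\<mu> by (rule conc_in_space[OF pre_words[OF x] o])
    have agree: "\<forall>i<n + k. x i = ?y i" by (auto simp: pre_def conc_def)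
    have "\<bar>birkhoff_sum left_shift \<psi> n x - birkhoff_sum left_shift \<psi> n ?y\<bar> \<le> C / (1 - \<theta>) * \<theta> ^ k"
      using x y agree by (intro birkhoff_distortion[OF \<psi> \<theta>]) (auto simp: space_\<mu>)
    also have "\<dots> \<le> pot.D"
      using mult_left_mono[OF power_le_one[of \<theta> k] pot.D_nonneg] \<theta> by (simp add: pot.D_def)
    finally have 1: "birkhoff_sum left_shift \<psi> n x - pot.D \<le> birkhoff_sum left_shift \<psi> n ?y" by simp
    have 2: "ln \<epsilon> * indicator V ((left_shift ^^ i) x) \<le> ln (kap (name n x ! i) (\<gamma> ((left_shift ^^ i) ?y)))"
      if i: "i < n" for i
    proof (cases "(left_shift ^^ i) x \<in> V")
      case True
      then show ?thesis using kap \<epsilon> by simp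
    next
      case False
      have sp: "(left_shift ^^ i) x \<in> space \<mu>" "(left_shift ^^ i) ?y \<in> space \<mu>"
        using x y funpow_T_space by auto
      have ag: "\<forall>j<k. (left_shift ^^ i) x j = (left_shift ^^ i) ?y j"
        unfolding funpow_shift using agree i by auto
      have "\<gamma> ((left_shift ^^ i) ?y) = label ((left_shift ^^ i) x)"
        using mp[OF bspec[OF bspec[OF \<gamma>(2) sp(1)] sp(2)] ag] mp[OF bspec[OF \<gamma>(1) sp(1)] False] by (rule subst)
      then show ?thesis using False i by (simp add: kap_def name_def)
    qed
    have "ln \<epsilon> * birkhoff_sum left_shift (indicator V) n x
        \<le> (\<Sum>i<n. ln (kap (name n x ! i) (\<gamma> ((left_shift ^^ i) ?y))))"
      unfolding birkhoff_sum_def sum_distrib_left using 2 by (intro sum_mono) auto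
    also have "\<dots> = ln (\<Prod>i<n. kap (name n x ! i) (\<gamma> ((left_shift ^^ i) ?y)))"
      by (intro ln_prod[symmetric]) (simp_all add: kap(2) less_imp_neq[OF kap(2), THEN not_sym])
    finally show ?thesis
      using 1 prod_pos[of "{..<n}" "\<lambda>i. kap (name n x ! i) (\<gamma> ((left_shift ^^ i) ?y))"] kap(2)
      by (simp add: F_def R_def ln_mult_pos)
  qed
  have int_F: "integrable \<mu> (F n)" "(\<integral>x. F n x \<partial>\<mu>) = n * (\<integral>x. \<psi> x \<partial>\<mu>) - pot.D + ln \<epsilon> * (n * measure \<mu> V)" for n
  proof -
    note i = integral_birkhoff_sum[OF int_\<psi>, of n] integral_birkhoff_sum[OF int_V, of n]
    show "integrable \<mu> (F n)" unfolding F_def[abs_def] using i(1,3) by simp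
    have "V \<inter> space \<mu> = V" using V(1) sets.sets_into_space by auto
    then show "(\<integral>x. F n x \<partial>\<mu>) = n * (\<integral>x. \<psi> x \<partial>\<mu>) - pot.D + ln \<epsilon> * (n * measure \<mu> V)"
      unfolding F_def[abs_def] using i by (simp add: prob_space)
  qed
  define c where "c = ln K' + ln K + k * r + pot.D"
  have "H n \<le> n * (r - (\<integral>x. \<psi> x \<partial>\<mu>) + \<epsilon> * card \<xi> - \<eta> * ln \<epsilon>) + c" for n
  proof -
    let ?I = "words \<xi> n" and ?J = "words {1..d} (n + k)"
    define S where "S = (\<Sum>a\<in>?I. \<Sum>w\<in>?J. R n a w)"
    have "name n ?o \<in> ?I" using o by (intro name_in_words) (simp add: space_\<mu>)
    then have "?I \<noteq> {}" by blast
    then have S: "S > 0"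
      unfolding S_def using fins pot.words_nonempty R_pos by (intro sum_pos) auto
    have "H n = - (\<Sum>a\<in>?I. (\<Sum>w\<in>?J. q n a w) * ln (\<Sum>w\<in>?J. q n a w))"
      unfolding q_marginal by (rule H_eq)
    also have "\<dots> \<le> ln S - (\<Sum>a\<in>?I. \<Sum>w\<in>?J. q n a w * ln (R n a w))"
      unfolding S_def
    proof (rule gibbs_inequality[OF fins])
      show "(\<Sum>a\<in>?I. \<Sum>w\<in>?J. q n a w) = 1" unfolding q_marginal by (rule sum_measure_cells)
    qed (use R_pos in \<open>auto simp: q_def intro: less_imp_le\<close>)
    finally have "H n \<le> ln S - (\<Sum>a\<in>?I. \<Sum>w\<in>?J. q n a w * ln (R n a w))" .
    moreover have "(\<integral>x. F n x \<partial>\<mu>) \<le> (\<Sum>a\<in>?I. \<Sum>w\<in>?J. q n a w * ln (R n a w))"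
    proof -
      have "(\<integral>x. F n x \<partial>\<mu>) \<le> (\<Sum>j\<in>?I \<times> ?J. measure \<mu> {x \<in> space \<mu>. (name n x, pre n x) = j} *
          (case j of (a, w) \<Rightarrow> ln (R n a w)))"
      proof (rule integral_le_fibres[where F = "\<lambda>x. (name n x, pre n x)"])
        show "finite (?I \<times> ?J)" using fins by auto
        show "(name n x, pre n x) \<in> ?I \<times> ?J" if "x \<in> space \<mu>" for x
          using name_in_words[OF that] pre_words[OF that] by auto
        show "{x \<in> space \<mu>. (name n x, pre n x) = j} \<in> sets \<mu>" for j
          using fibre[of n "fst j" "snd j"] pre_fibre[of n "snd j"] cell_sets[of n "fst j"] by (auto intro: sets.Int)
      qed (use int_F F_le in auto)
      also have "\<dots> = (\<Sum>a\<in>?I. \<Sum>w\<in>?J. q n a w * ln (R n a w))"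
        unfolding sum.cartesian_product q_def by (intro sum.cong) auto
      finally show ?thesis .
    qed
    ultimately have "H n \<le> ln S - (\<integral>x. F n x \<partial>\<mu>)" by linarith
    moreover have "ln S \<le> n * (\<epsilon> * card \<xi>) + (ln K' + (ln K + (n + k) * r))"
    proof -
      have "ln S \<le> ln (exp (n * (\<epsilon> * card \<xi>)) * (K' * (K * exp ((n + k) * r))))"
        using sum_R[of n] S unfolding S_def by (intro ln_mono) auto
      also have "\<dots> = n * (\<epsilon> * card \<xi>) + (ln K' + (ln K + (n + k) * r))"
        using K K'(1) by (simp add: ln_mult_pos)
      finally show ?thesis .
    qed
    moreover have "ln \<epsilon> * (n * measure \<mu> V) \<ge> ln \<epsilon> * (n * \<eta>)"
      using V(2) \<epsilon> by (intro mult_left_mono_neg mult_left_mono) auto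
    ultimately show ?thesis unfolding int_F c_def by (simp add: algebra_simps)
  qed
  then show ?thesis by blast
qed

lemma entropy_rate_upper:
  assumes \<psi>: "shift_Lipschitz d \<theta> C \<psi>" and K: "K > 0"
    and up: "\<And>n x. x \<in> bernoulli_space d \<Longrightarrow> (transfer d \<psi> ^^ n) (\<lambda>_. 1) x \<le> K * exp (n * r)"
  shows "partition_entropy_rate \<mu> left_shift \<xi> \<le> r - (\<integral>x. \<psi> x \<partial>\<mu>)"
proof (rule field_le_epsilon)
  fix e :: real assume e: "e > 0"
  \<comment> \<open>The entry \<open>1 / 2\<close> keeps \<open>ln \<epsilon>\<close> negative. With
    the \<eta> chosen below, mispredictions cost exactly \<epsilon>, so the errors add up to
    \<open>\<epsilon> * (card \<xi> + 1)\<close>, which is at most \<open>e\<close>.\<close>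
  define \<epsilon> where "\<epsilon> = min (1 / 2) (e / (card \<xi> + 1))"
  have \<epsilon>: "0 < \<epsilon>" "\<epsilon> < 1" "\<epsilon> \<le> e / (card \<xi> + 1)"
    using e by (auto simp: \<epsilon>_def)
  have \<epsilon>e: "\<epsilon> * (card \<xi> + 1) \<le> e"
    using \<epsilon>(3) by (subst (asm) pos_le_divide_eq) auto
  define \<eta> where "\<eta> = \<epsilon> / (- ln \<epsilon>)"
  have \<eta>: "\<eta> > 0" "- \<eta> * ln \<epsilon> = \<epsilon>" using \<epsilon> ln_less_zero[of \<epsilon>] by (auto simp: \<eta>_def field_simps)
  define A where "A = r - (\<integral>x. \<psi> x \<partial>\<mu>) + \<epsilon> * card \<xi> - \<eta> * ln \<epsilon>"
  obtain c where c: "\<And>n. H n \<le> n * A + c"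
    using entropy_upper[OF \<psi> K up \<epsilon>(1,2) \<eta>(1)] unfolding A_def by blast
  have "(\<lambda>n. A + c / real n) \<longlonglongrightarrow> A + 0"
    by (intro tendsto_intros lim_const_over_n)
  moreover have "\<forall>n\<ge>1. H n / n \<le> A + c / n"
    using c by (auto simp: field_simps)
  ultimately have "partition_entropy_rate \<mu> left_shift \<xi> \<le> A"
    using entropy_rate_limit by (intro LIMSEQ_le[of "\<lambda>n. H n / n" _ "\<lambda>n. A + c / real n"]) auto
  also have "A \<le> r - (\<integral>x. \<psi> x \<partial>\<mu>) + e"
    using \<epsilon>e \<eta>(2) by (simp add: A_def algebra_simps)
  finally show "partition_entropy_rate \<mu> left_shift \<xi> \<le> r - (\<integral>x. \<psi> x \<partial>\<mu>) + e" .
qed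

end

text \<open>The errors that depend on the partition vanish before the supremum is taken, so one
  bound serves all finite partitions. This is the upper half of the variational principle.\<close>

lemma (in shift_measure) ks_entropy_upper:
  assumes "shift_Lipschitz d \<theta> C \<psi>" "K > 0"
    "\<And>n x. x \<in> bernoulli_space d \<Longrightarrow> (transfer d \<psi> ^^ n) (\<lambda>_. 1) x \<le> K * exp (n * r)"
  shows "ks_entropy \<mu> left_shift \<le> ereal (r - (\<integral>x. \<psi> x \<partial>\<mu>))"
  unfolding ks_entropy_def
proof (rule SUP_least)
  fix \<xi> assume \<xi>: "\<xi> \<in> {\<xi>. finite \<xi> \<and> \<xi> \<subseteq> sets \<mu> \<and> partition_on (space \<mu>) \<xi>}"
  interpret shift_measure_partition \<mu> d \<theta> \<xi>
    by unfold_locales (use \<xi> in auto)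
  show "ereal (partition_entropy_rate \<mu> left_shift \<xi>) \<le> ereal (r - (\<integral>x. \<psi> x \<partial>\<mu>))"
    using entropy_rate_upper[OF assms] by simp
qed

section \<open>Integrals with respect to equilibrium states\<close>

lemma (in shift_measure) integrable_continuous:
  assumes "continuous_map (mtopology_of (bernoulli_metric d \<theta>)) euclidean \<psi>"
    and "\<And>x. x \<in> bernoulli_space d \<Longrightarrow> \<bar>\<psi> x\<bar> \<le> (U :: real)"
  shows "integrable \<mu> \<psi>"
proof (rule integrable_const_bound[of _ U])
  show "\<psi> \<in> borel_measurable \<mu>"
    using continuous_map_borel_of_metric[OF assms(1)] sets_\<mu> by (simp cong: measurable_cong_sets)
qed (use assms(2) in \<open>auto simp: space_\<mu>\<close>)

lemma (in shift_pressure) equilibrium_integral_eq: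
  assumes "shift_measure \<mu> d \<theta>" and eq: "ks_entropy \<mu> left_shift + ereal (\<integral>x. \<phi> x \<partial>\<mu>) = ereal p"
    and g: "shift_Lipschitz d \<theta> C' g" and m: "tangent_slope g m"
  shows "(\<integral>x. g x \<partial>\<mu>) = m"
proof -
  interpret shift_measure \<mu> d \<theta> by fact
  have int: "integrable \<mu> u" if u: "shift_Lipschitz d \<theta> B u" for B u
    using shift_Lipschitz_bounded[OF u d] integrable_continuous[OF shift_Lipschitz_continuous_map[OF u \<theta>]] by metis
  \<comment> \<open>A real right-hand side excludes infinite entropy, so the integral may be moved
    across.\<close>
  have ks: "ks_entropy \<mu> left_shift = ereal (p - (\<integral>x. \<phi> x \<partial>\<mu>))"
    using eq by (cases "ks_entropy \<mu> left_shift") auto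
  have one_sided: "t * ((\<integral>x. g x \<partial>\<mu>) - m) \<le> \<bar>t\<bar> * \<epsilon>"
    if K: "K > 0" "\<forall>n. \<forall>x\<in>X. (transfer d (\<lambda>x. \<phi> x + t * g x) ^^ n) (\<lambda>_. 1) x
      \<le> K * exp (n * (p + t * m + \<bar>t\<bar> * \<epsilon>))" for t \<epsilon> K
  proof -
    have "ks_entropy \<mu> left_shift \<le> ereal ((p + t * m + \<bar>t\<bar> * \<epsilon>) - (\<integral>x. \<phi> x + t * g x \<partial>\<mu>))"
      using K by (intro ks_entropy_upper[OF shift_Lipschitz_linear[OF Lip g \<theta>(1)]]) auto
    then show ?thesis
      using int[OF Lip] int[OF g] by (simp add: ks algebra_simps)
  qed
  have close: "\<bar>(\<integral>x. g x \<partial>\<mu>) - m\<bar> \<le> \<epsilon>" if \<epsilon>: "\<epsilon> > 0" for \<epsilon>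
  proof -
    obtain \<delta> where \<delta>: "\<delta> > 0" "\<And>t. \<bar>t\<bar> < \<delta> \<Longrightarrow> \<exists>K>0. \<forall>n. \<forall>x\<in>X.
      (transfer d (\<lambda>x. \<phi> x + t * g x) ^^ n) (\<lambda>_. 1) x \<le> K * exp (n * (p + t * m + \<bar>t\<bar> * \<epsilon>))"
      using m \<epsilon> unfolding tangent_slope_def by blast
    have "t * ((\<integral>x. g x \<partial>\<mu>) - m) \<le> \<bar>t\<bar> * \<epsilon>" if "\<bar>t\<bar> < \<delta>" for t
      using \<delta>(2)[OF that] one_sided by blast
    from this[of "\<delta> / 2"] this[of "- (\<delta> / 2)"]
    have "\<delta> / 2 * ((\<integral>x. g x \<partial>\<mu>) - m) \<le> \<delta> / 2 * \<epsilon>" "- (\<delta> / 2) * ((\<integral>x. g x \<partial>\<mu>) - m) \<le> \<delta> / 2 * \<epsilon>"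
      using \<delta>(1) by simp_all
    moreover have "- (\<delta> / 2) * ((\<integral>x. g x \<partial>\<mu>) - m) = \<delta> / 2 * (- ((\<integral>x. g x \<partial>\<mu>) - m))"
      by (simp only: mult_minus_left mult_minus_right)
    ultimately have "\<delta> / 2 * ((\<integral>x. g x \<partial>\<mu>) - m) \<le> \<delta> / 2 * \<epsilon>" "\<delta> / 2 * (- ((\<integral>x. g x \<partial>\<mu>) - m)) \<le> \<delta> / 2 * \<epsilon>"
      by (simp_all only:)
    then have "(\<integral>x. g x \<partial>\<mu>) - m \<le> \<epsilon>" "- ((\<integral>x. g x \<partial>\<mu>) - m) \<le> \<epsilon>"
      using \<delta>(1) by (blast intro: mult_left_le_imp_le half_gt_zero)+
    then show ?thesis by linarith
  qed
  show ?thesis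
  proof (rule ccontr)
    assume "(\<integral>x. g x \<partial>\<mu>) \<noteq> m"
    then have "0 < \<bar>(\<integral>x. g x \<partial>\<mu>) - m\<bar>" by simp
    from this close[OF half_gt_zero[OF this]] show False by simp
  qed
qed

lemma (in shift_pressure) orbit_average_Lipschitz:
  assumes "shift_measure \<mu> d \<theta>" "ks_entropy \<mu> left_shift + ereal (\<integral>x. \<phi> x \<partial>\<mu>) = ereal p"
    and g: "shift_Lipschitz d \<theta> C' g"
  shows "orbit_average d \<phi> g \<longlonglongrightarrow> (\<integral>x. g x \<partial>\<mu>)"
proof -
  obtain m where m: "tangent_slope g m"
    using perturbed_transfer_upper[OF g] unfolding tangent_slope_def by blast
  show ?thesis
    using orbit_average_tendsto[OF g m] equilibrium_integral_eq[OF assms m] by simp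
qed

text \<open>Uniform continuity by an argument in the style of Koenig's lemma. If no \<open>k\<close>
  works, a bad prefix can always be prolonged by some letter of the finite alphabet and stay bad;
  the infinite sequence so obtained is a point where \<open>g\<close> fails to be
  continuous.\<close>

lemma continuous_uniform_cylinder:
  fixes g :: "(nat \<Rightarrow> nat) \<Rightarrow> real"
  assumes \<theta>: "0 < \<theta>" "\<theta> < 1" and d: "d \<ge> 1"
    and g: "continuous_map (mtopology_of (bernoulli_metric d \<theta>)) euclidean g" and \<epsilon>: "\<epsilon> > 0"
  shows "\<exists>k. \<forall>x\<in>bernoulli_space d. \<forall>y\<in>bernoulli_space d. (\<forall>i<k. x i = y i) \<longrightarrow> \<bar>g x - g y\<bar> \<le> \<epsilon>"
proof (rule ccontr)
  let ?X = "bernoulli_space d"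
  assume contra: "\<not> ?thesis"
  define Split where "Split n z k \<longleftrightarrow> (\<exists>x\<in>?X. \<exists>y\<in>?X. (\<forall>i<n. x i = z i) \<and> (\<forall>i<n. y i = z i) \<and>
      (\<forall>i<k. x i = y i) \<and> \<bar>g x - g y\<bar> > \<epsilon>)" for n z k
  \<comment> \<open>In the cylinder of the first \<open>n\<close> symbols of a bad \<open>z\<close>
    there are pairs with arbitrarily long common prefix whose values differ by more than
    \<epsilon>.\<close>
  define Bad where "Bad n z \<longleftrightarrow> z \<in> ?X \<and> (\<forall>k. Split n z k)" for n z
  have "\<exists>f. \<forall>n. Bad n (f n) \<and> (\<forall>i<n. f (Suc n) i = f n i)"
  proof (rule dependent_nat_choice)
    have "(\<lambda>_. 1) \<in> ?X" using d by (auto simp: bernoulli_space_def)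
    then show "\<exists>z. Bad 0 z" using contra unfolding Bad_def Split_def by (auto simp: not_le)
    fix z n assume z: "Bad n z"
    show "\<exists>z'. Bad (Suc n) z' \<and> (\<forall>i<n. z' i = z i)"
    proof (rule ccontr)
      assume none: "\<not> ?thesis"
      have "\<forall>a\<in>{1..d}. \<exists>k. \<not> Split (Suc n) (z(n := a)) k"
      proof
        fix a assume a: "a \<in> {1..d}"
        have "z(n := a) \<in> ?X" using z a by (auto simp: Bad_def bernoulli_space_def Pi_iff)
        moreover have "\<forall>i<n. (z(n := a)) i = z i" by simp
        ultimately show "\<exists>k. \<not> Split (Suc n) (z(n := a)) k" using none unfolding Bad_def by blast
      qed
      then obtain k where k: "\<forall>a\<in>{1..d}. \<not> Split (Suc n) (z(n := a)) (k a)" by (rule bchoice[THEN exE])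
      \<comment> \<open>\<open>M\<close> exceeds \<open>n\<close>, so \<open>x\<close> and
        \<open>y\<close> share the letter at index \<open>n\<close>, and it is at least the
        threshold of every letter. The pair thus contradicts the threshold of its own
        letter.\<close>
      define M where "M = Suc n + (\<Sum>a\<in>{1..d}. k a)"
      obtain x y where xy: "x \<in> ?X" "y \<in> ?X" "\<forall>i<n. x i = z i" "\<forall>i<n. y i = z i"
        "\<forall>i<M. x i = y i" "\<bar>g x - g y\<bar> > \<epsilon>"
        using z unfolding Bad_def Split_def by blast
      have xn: "x n \<in> {1..d}" using xy(1) by (auto simp: bernoulli_space_def)
      have M: "k (x n) \<le> M" "n < M"
        using member_le_sum[of "x n" "{1..d}" k] xn by (auto simp: M_def)
      have "\<forall>i<Suc n. x i = (z(n := x n)) i" using xy(3) by (simp add: less_Suc_eq)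
      moreover have "\<forall>i<Suc n. y i = (z(n := x n)) i" using xy(4,5) M(2) by (simp add: less_Suc_eq)
      moreover have "\<forall>i<k (x n). x i = y i" using xy(5) M(1) by (meson less_le_trans)
      ultimately have "Split (Suc n) (z(n := x n)) (k (x n))"
        unfolding Split_def using xy(1,2,6) by blast
      then show False using k xn by blast
    qed
  qed
  then obtain f where f: "\<And>n. Bad n (f n)" "\<And>n i. i < n \<Longrightarrow> f (Suc n) i = f n i" by blast
  define z where "z i = f (Suc i) i" for i
  have fz: "f n i = z i" if "i < n" for n i
    using that[THEN Suc_leI]
  proof (induction n rule: dec_induct)
    case (step n)
    then show ?case using f(2)[of i n] by simp
  qed (simp add: z_def)
  have z: "z \<in> ?X" using f(1) by (auto simp: z_def Bad_def bernoulli_space_def Pi_iff)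
  have "openin (mtopology_of (bernoulli_metric d \<theta>)) {x \<in> ?X. g x \<in> ball (g z) (\<epsilon> / 2)}"
    using openin_continuous_map_preimage[OF g, of "ball (g z) (\<epsilon> / 2)"] \<theta> by simp
  moreover have "z \<in> {x \<in> ?X. g x \<in> ball (g z) (\<epsilon> / 2)}" using z \<epsilon> by simp
  ultimately obtain k where k: "\<forall>y\<in>?X. (\<forall>i<k. z i = y i) \<longrightarrow> y \<in> {x \<in> ?X. g x \<in> ball (g z) (\<epsilon> / 2)}"
    unfolding openin_bernoulli[OF \<theta>] by blast
  obtain x y where xy: "x \<in> ?X" "y \<in> ?X" "\<forall>i<k. x i = f k i" "\<forall>i<k. y i = f k i" "\<bar>g x - g y\<bar> > \<epsilon>"
    using f(1)[of k] unfolding Bad_def Split_def by blast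
  have "g x \<in> ball (g z) (\<epsilon> / 2)" "g y \<in> ball (g z) (\<epsilon> / 2)"
    using k xy(1-4) fz by auto
  then show False using xy(5) unfolding mem_ball dist_real_def by linarith
qed

text \<open>With \<open>k\<close> from uniform continuity, replacing all symbols beyond the first
  \<open>k\<close> by 1 changes the value by at most \<epsilon>, and the new function depends on
  \<open>k\<close> coordinates only.\<close>

lemma Lipschitz_approx:
  fixes g :: "(nat \<Rightarrow> nat) \<Rightarrow> real"
  assumes \<theta>: "0 < \<theta>" "\<theta> < 1" and d: "d \<ge> 1"
    and g: "continuous_map (mtopology_of (bernoulli_metric d \<theta>)) euclidean g" and \<epsilon>: "\<epsilon> > 0"
  shows "\<exists>C u. shift_Lipschitz d \<theta> C u \<and> (\<forall>x\<in>bernoulli_space d. \<bar>g x - u x\<bar> \<le> \<epsilon>)"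
proof -
  let ?X = "bernoulli_space d" and ?o = "\<lambda>_. 1 :: nat"
  have o: "?o \<in> ?X" using d by (auto simp: bernoulli_space_def)
  obtain k where k: "\<And>x y. x \<in> ?X \<Longrightarrow> y \<in> ?X \<Longrightarrow> \<forall>i<k. x i = y i \<Longrightarrow> \<bar>g x - g y\<bar> \<le> \<epsilon>"
    using continuous_uniform_cylinder[OF assms] by blast
  define u where "u x = g (conc (map x [0..<k]) ?o)" for x
  define U where "U = (\<Sum>w\<in>words {1..d} k. \<bar>g (conc w ?o)\<bar>)"
  have U: "\<bar>u x\<bar> \<le> U" if "x \<in> ?X" for x
    unfolding u_def U_def using prefix_in_words[OF that] finite_words[of "{1..d}" k]
    by (intro member_le_sum[where f = "\<lambda>w. \<bar>g (conc w ?o)\<bar>"]) auto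
  have "U \<ge> 0" by (simp add: U_def sum_nonneg)
  \<comment> \<open>For \<open>j < k\<close> the trivial bound \<open>2 * U\<close> suffices since
    \<open>\<theta> ^ j \<ge> \<theta> ^ k\<close>; for \<open>j \<ge> k\<close> the two values
    coincide.\<close>
  have "shift_Lipschitz d \<theta> (2 * U / \<theta> ^ k) u"
    unfolding shift_Lipschitz_def
  proof (intro conjI ballI allI impI)
    show "0 \<le> 2 * U / \<theta> ^ k" using \<open>U \<ge> 0\<close> \<theta> by simp
    fix x y j assume xy: "x \<in> ?X" "y \<in> ?X" "\<forall>i<j. x i = y i"
    show "\<bar>u x - u y\<bar> \<le> 2 * U / \<theta> ^ k * \<theta> ^ j"
    proof (cases "k \<le> j")
      case True
      then have "map x [0..<k] = map y [0..<k]" using xy(3) by auto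
      then have "u x = u y" unfolding u_def by (simp only:)
      then show ?thesis using \<open>U \<ge> 0\<close> \<theta> by simp
    next
      case False
      have "\<bar>u x - u y\<bar> \<le> 2 * U * 1" using U[OF xy(1)] U[OF xy(2)] by auto
      also have "\<dots> \<le> 2 * U * (\<theta> ^ j / \<theta> ^ k)"
        using False \<open>U \<ge> 0\<close> \<theta> power_decreasing[of j k \<theta>] by (intro mult_left_mono) auto
      finally show ?thesis by simp
    qed
  qed
  moreover have "\<bar>g x - u x\<bar> \<le> \<epsilon>" if "x \<in> ?X" for x
    unfolding u_def using that by (intro k conc_in_space[OF prefix_in_words o]) (auto simp: conc_def)
  ultimately show ?thesis by blast
qed

text \<open>The weights are positive and normalised, so orbit averages contract the uniform norm;
  this carries limits from Lipschitz functions over to continuous ones.\<close>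

lemma (in shift_pressure) orbit_average_diff:
  assumes "\<And>x. x \<in> X \<Longrightarrow> \<bar>g x - u x\<bar> \<le> \<epsilon>" "n \<ge> 1"
  shows "\<bar>orbit_average d \<phi> g n - orbit_average d \<phi> u n\<bar> \<le> \<epsilon>"
proof -
  let ?F = "fix_points d n" and ?e = "\<lambda>x. exp (birkhoff_sum left_shift \<phi> n x)"
  define W where "W = (\<Sum>x\<in>?F. ?e x)"
  have W: "W > 0" unfolding W_def using orbit_sum_pressure[OF assms(2)] by (meson exp_gt_zero less_le_trans)
  have b: "\<bar>birkhoff_sum left_shift g n x / n - birkhoff_sum left_shift u n x / n\<bar> \<le> \<epsilon>" if x: "x \<in> ?F" for x
  proof -
    have "\<bar>birkhoff_sum left_shift g n x - birkhoff_sum left_shift u n x\<bar> \<le> (\<Sum>i<n. \<epsilon>)"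
      unfolding birkhoff_sum_def sum_subtractf[symmetric] using x
      by (intro sum_abs[THEN order_trans] sum_mono assms funpow_shift_in_bernoulli_space) (auto simp: fix_points_def)
    then show ?thesis
      using assms(2) by (simp add: diff_divide_distrib[symmetric] pos_divide_le_eq mult.commute)
  qed
  have "\<bar>orbit_average d \<phi> g n - orbit_average d \<phi> u n\<bar> =
      \<bar>\<Sum>x\<in>?F. ?e x * (birkhoff_sum left_shift g n x / n - birkhoff_sum left_shift u n x / n)\<bar> / W"
    using W by (simp add: orbit_average_def W_def[symmetric] diff_divide_distrib[symmetric]
        sum_subtractf[symmetric] right_diff_distrib)
  also have "\<dots> \<le> (\<Sum>x\<in>?F. ?e x * \<epsilon>) / W"
    using W b
    by (intro divide_right_mono sum_abs[THEN order_trans] sum_mono) (auto simp: abs_mult)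
  also have "\<dots> = \<epsilon>" using W by (simp add: sum_distrib_right[symmetric] W_def)
  finally show ?thesis .
qed

lemma (in shift_pressure) orbit_average_continuous:
  assumes \<mu>: "shift_measure \<mu> d \<theta>" "ks_entropy \<mu> left_shift + ereal (\<integral>x. \<phi> x \<partial>\<mu>) = ereal p"
    and g: "continuous_map (mtopology_of (bernoulli_metric d \<theta>)) euclidean g"
  shows "orbit_average d \<phi> g \<longlonglongrightarrow> (\<integral>x. g x \<partial>\<mu>)"
proof (rule tendstoI)
  interpret \<mu>: shift_measure \<mu> d \<theta> by fact
  fix e :: real assume e: "e > 0"
  obtain B u where u: "shift_Lipschitz d \<theta> B u" "\<And>x. x \<in> X \<Longrightarrow> \<bar>g x - u x\<bar> \<le> e / 4"
    using Lipschitz_approx[OF \<theta> d g, of "e / 4"] e by auto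
  obtain U where U: "\<And>x. x \<in> X \<Longrightarrow> \<bar>u x\<bar> \<le> U"
    using shift_Lipschitz_bounded[OF u(1) d] by metis
  have iu: "integrable \<mu> u"
    by (rule \<mu>.integrable_continuous[OF shift_Lipschitz_continuous_map[OF u(1) \<theta>] U])
  have "\<bar>g x\<bar> \<le> U + e / 4" if "x \<in> X" for x using U[OF that] u(2)[OF that] by linarith
  then have ig: "integrable \<mu> g" by (rule \<mu>.integrable_continuous[OF g])
  have "\<bar>(\<integral>x. g x \<partial>\<mu>) - (\<integral>x. u x \<partial>\<mu>)\<bar> = \<bar>\<integral>x. g x - u x \<partial>\<mu>\<bar>"
    using ig iu by simp
  also have "\<dots> \<le> (\<integral>x. \<bar>g x - u x\<bar> \<partial>\<mu>)" by (rule integral_abs_bound)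
  also have "\<dots> \<le> (\<integral>x. e / 4 \<partial>\<mu>)"
    using ig iu u(2) by (intro integral_mono) (auto simp: \<mu>.space_\<mu>)
  finally have int: "\<bar>(\<integral>x. g x \<partial>\<mu>) - (\<integral>x. u x \<partial>\<mu>)\<bar> \<le> e / 4" by (simp add: \<mu>.prob_space)
  have "\<forall>\<^sub>F n in sequentially. dist (orbit_average d \<phi> u n) (\<integral>x. u x \<partial>\<mu>) < e / 4"
    using orbit_average_Lipschitz[OF \<mu> u(1)] e by (intro tendstoD) auto
  then show "\<forall>\<^sub>F n in sequentially. dist (orbit_average d \<phi> g n) (\<integral>x. g x \<partial>\<mu>) < e"
    using eventually_ge_at_top[of "1::nat"]
  proof eventually_elim
    case (elim n)
    have "\<bar>orbit_average d \<phi> g n - orbit_average d \<phi> u n\<bar> \<le> e / 4"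
      using u(2) elim(2) by (rule orbit_average_diff)
    then show ?case using elim(1) int e unfolding dist_real_def by linarith
  qed
qed

text \<open>A Cesaro argument: with weights bounded below, their total grows at least linearly and
  outweighs the finitely many terms where \<open>a n\<close> is still far from \<open>m\<close>.
  Exponentially growing weights are covered.\<close>

lemma weighted_average_tendsto:
  fixes a b :: "nat \<Rightarrow> real"
  assumes a: "a \<longlonglongrightarrow> m" and b: "\<And>n. n \<ge> 1 \<Longrightarrow> \<beta> \<le> b n" and \<beta>: "\<beta> > 0"
  shows "(\<lambda>N. (\<Sum>n=1..N. b n * a n) / (\<Sum>n=1..N. b n)) \<longlonglongrightarrow> m"
proof (rule tendstoI)
  fix e :: real assume e: "e > 0"
  obtain M where M: "\<And>n. n \<ge> M \<Longrightarrow> \<bar>a n - m\<bar> < e / 2"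
    using tendstoD[OF a, of "e / 2"] e by (auto simp: eventually_sequentially dist_real_def)
  have b0: "b n > 0" if "n \<ge> 1" for n using b[OF that] \<beta> by linarith
  define R where "R = (\<Sum>n=1..M. b n * \<bar>a n - m\<bar>)"
  have "(\<lambda>N. R / \<beta> / real N) \<longlonglongrightarrow> 0" by (rule lim_const_over_n)
  then have "\<forall>\<^sub>F N in sequentially. R / \<beta> / real N < e / 2" using e by (intro order_tendstoD) auto
  then show "\<forall>\<^sub>F N in sequentially. dist ((\<Sum>n=1..N. b n * a n) / (\<Sum>n=1..N. b n)) m < e"
    using eventually_ge_at_top[of "1::nat"]
  proof eventually_elim
    case (elim N)
    define S where "S = (\<Sum>n=1..N. b n)"
    have "real N * \<beta> \<le> S"
      unfolding S_def using b sum_mono[of "{1..N}" "\<lambda>_. \<beta>" b] by simp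
    moreover have N\<beta>: "0 < real N * \<beta>" using elim(2) \<beta> by simp
    moreover have "0 \<le> R"
      unfolding R_def using b0 by (intro sum_nonneg mult_nonneg_nonneg less_imp_le[OF b0]) auto
    ultimately have S: "S > 0" "R / S \<le> R / (real N * \<beta>)"
      by (auto intro: divide_left_mono)
    have "\<bar>(\<Sum>n=1..N. b n * a n) - m * S\<bar> = \<bar>\<Sum>n=1..N. b n * (a n - m)\<bar>"
      by (simp add: S_def algebra_simps sum_subtractf sum_distrib_left)
    also have "\<dots> \<le> (\<Sum>n=1..N. b n * \<bar>a n - m\<bar>)"
      using b0 by (intro sum_abs[THEN order_trans] sum_mono) (simp add: abs_mult abs_of_pos)
    also have "\<dots> \<le> (\<Sum>n=1..N. (if n \<le> M then b n * \<bar>a n - m\<bar> else 0) + b n * (e / 2))"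
    proof (rule sum_mono)
      fix n assume n: "n \<in> {1..N}"
      show "b n * \<bar>a n - m\<bar> \<le> (if n \<le> M then b n * \<bar>a n - m\<bar> else 0) + b n * (e / 2)"
        using M[of n] b0[of n] n e by (auto intro!: mult_left_mono)
    qed
    also have "\<dots> \<le> R + S * (e / 2)"
    proof -
      have "(\<Sum>n=1..N. if n \<le> M then b n * \<bar>a n - m\<bar> else 0) =
          (\<Sum>n\<in>{n \<in> {1..N}. n \<le> M}. b n * \<bar>a n - m\<bar>)"
        by (rule sum.inter_filter[symmetric]) simp
      also have "\<dots> \<le> R"
        unfolding R_def using less_imp_le[OF b0] by (intro sum_mono2) (auto simp del: One_nat_def)
      finally show ?thesis unfolding sum.distrib S_def sum_distrib_right by simp
    qed
    finally have "\<bar>(\<Sum>n=1..N. b n * a n) - m * S\<bar> / S \<le> R / S + e / 2"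
      using S by (simp add: field_simps)
    moreover have "\<bar>(\<Sum>n=1..N. b n * a n) / S - m\<bar> = \<bar>(\<Sum>n=1..N. b n * a n) - m * S\<bar> / S"
    proof -
      have "(\<Sum>n=1..N. b n * a n) / S - m = ((\<Sum>n=1..N. b n * a n) - m * S) / S"
        using S by (simp add: field_simps)
      then show ?thesis using S by (simp add: abs_divide)
    qed
    moreover have "R / (real N * \<beta>) = R / \<beta> / real N" by simp
    ultimately show ?case
      using S(2) elim(1) unfolding dist_real_def S_def[symmetric] by linarith
  qed
qed

text \<open>The exponent \<open>s\<close> treats both families at once: \<open>s = - p\<close> gives
  \<pi> and \<open>s = 0\<close> gives \<eta>. The double sum regroups into orbit averages weighted
  by \<open>exp (n * s)\<close> times the sum over the points of period \<open>n\<close>, and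
  \<beta> makes the total weight diverge.\<close>

lemma (in shift_pressure) orbit_measure_integral_tendsto:
  fixes g :: "(nat \<Rightarrow> nat) \<Rightarrow> real" and s \<beta> :: real
  assumes \<mu>: "shift_measure \<mu> d \<theta>" "ks_entropy \<mu> left_shift + ereal (\<integral>x. \<phi> x \<partial>\<mu>) = ereal p"
    and g: "continuous_map (mtopology_of (bernoulli_metric d \<theta>)) euclidean g"
    and \<beta>: "\<beta> > 0" "\<And>n. n \<ge> 1 \<Longrightarrow> \<beta> \<le> exp (real n * s) * (\<Sum>x\<in>fix_points d n. exp (birkhoff_sum left_shift \<phi> n x))"
  shows "(\<lambda>N. \<integral>x. g x \<partial>orbit_measure d \<theta> (\<lambda>n x. exp (birkhoff_sum left_shift \<phi> n x + real n * s)) N)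
    \<longlonglongrightarrow> (\<integral>x. g x \<partial>\<mu>)"
proof -
  define Z where "Z n = (\<Sum>x\<in>fix_points d n. exp (birkhoff_sum left_shift \<phi> n x))" for n
  have Z: "Z n > 0" if "n \<ge> 1" for n
    unfolding Z_def using orbit_sum_pressure[OF that] by (meson exp_gt_zero less_le_trans)
  have "(\<lambda>N. (\<Sum>n=1..N. (exp (real n * s) * Z n) * orbit_average d \<phi> g n) / (\<Sum>n=1..N. exp (real n * s) * Z n))
      \<longlonglongrightarrow> (\<integral>x. g x \<partial>\<mu>)"
    using orbit_average_continuous[OF \<mu> g] \<beta>(2) \<beta>(1) unfolding Z_def
    by (rule weighted_average_tendsto)
  moreover have "\<forall>\<^sub>F N in sequentially.
      (\<Sum>n=1..N. (exp (real n * s) * Z n) * orbit_average d \<phi> g n) / (\<Sum>n=1..N. exp (real n * s) * Z n) =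
      (\<integral>x. g x \<partial>orbit_measure d \<theta> (\<lambda>n x. exp (birkhoff_sum left_shift \<phi> n x + real n * s)) N)"
    using eventually_ge_at_top[of "1::nat"]
  proof eventually_elim
    case (elim N)
    have num: "(\<Sum>x\<in>fix_points d n. exp (birkhoff_sum left_shift \<phi> n x + real n * s) * (birkhoff_sum left_shift g n x / n)) =
        (exp (real n * s) * Z n) * orbit_average d \<phi> g n" if "n \<in> {1..N}" for n :: nat
    proof -
      have "(\<Sum>x\<in>fix_points d n. exp (birkhoff_sum left_shift \<phi> n x) * (birkhoff_sum left_shift g n x / n)) =
          Z n * orbit_average d \<phi> g n"
        using that Z[of n] by (simp add: orbit_average_def Z_def)
      then have "(exp (real n * s) * Z n) * orbit_average d \<phi> g n = exp (real n * s) *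
          (\<Sum>x\<in>fix_points d n. exp (birkhoff_sum left_shift \<phi> n x) * (birkhoff_sum left_shift g n x / n))"
        by simp
      then show ?thesis by (simp add: sum_distrib_left exp_add mult_ac)
    qed
    have den: "(\<Sum>x\<in>fix_points d n. exp (birkhoff_sum left_shift \<phi> n x + real n * s)) = exp (real n * s) * Z n" for n :: nat
      by (simp add: Z_def exp_add sum_distrib_left mult_ac)
    have "(\<integral>x. g x \<partial>orbit_measure d \<theta> (\<lambda>n x. exp (birkhoff_sum left_shift \<phi> n x + real n * s)) N) =
        (\<Sum>n=1..N. \<Sum>x\<in>fix_points d n. exp (birkhoff_sum left_shift \<phi> n x + real n * s) *
          (birkhoff_sum left_shift g n x / real n)) /
        (\<Sum>n=1..N. \<Sum>x\<in>fix_points d n. exp (birkhoff_sum left_shift \<phi> n x + real n * s))"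
      by (rule integral_orbit_measure[OF \<theta> d elim _ g]) simp
    also have "\<dots> = (\<Sum>n=1..N. (exp (real n * s) * Z n) * orbit_average d \<phi> g n) /
        (\<Sum>n=1..N. exp (real n * s) * Z n)"
      by (intro arg_cong2[where f = "(/)"] sum.cong refl num den)
    finally show ?case by (rule sym)
  qed
  ultimately show ?thesis by (rule Lim_transform_eventually)
qed

theorem lemma22:
  fixes d :: nat and \<theta> c :: real and f g :: "(nat \<Rightarrow> nat) \<Rightarrow> real"
    and \<mu> :: "(nat \<Rightarrow> nat) measure"
  assumes "d \<ge> 1" and "0 < \<theta>" and "\<theta> < 1"
    and "Lipschitz_continuous_map (bernoulli_metric d \<theta>) euclidean_metric f"
    and "\<And>x. x \<in> bernoulli_space d \<Longrightarrow> f x > 0"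
    and "c > 0"
    and "continuous_map (mtopology_of (bernoulli_metric d \<theta>)) euclidean g"
    and "equilibrium_state (bernoulli_metric d \<theta>) left_shift (\<lambda>x. c * f x) \<mu>"
  shows "(\<lambda>N. \<integral>x. g x \<partial>zeta_measure_pi d \<theta> f c N) \<longlonglongrightarrow> (\<integral>x. g x \<partial>\<mu>) \<and>
         (\<lambda>N. \<integral>x. g x \<partial>zeta_measure_eta d \<theta> f c N) \<longlonglongrightarrow> (\<integral>x. g x \<partial>\<mu>)"
proof -
  let ?\<phi> = "\<lambda>x. c * f x"
  note \<theta> = assms(2,3)
  obtain C where "shift_Lipschitz d \<theta> C f"
    using Lipschitz_imp_shift_Lipschitz[OF assms(4) \<theta>] by blast
  \<comment> \<open>The multiple of \<open>f\<close> is read as a perturbation of the zero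
    potential.\<close>
  then have "shift_Lipschitz d \<theta> (0 + \<bar>c\<bar> * C) (\<lambda>x. 0 + c * f x)"
    using \<theta> by (intro shift_Lipschitz_linear) (auto simp: shift_Lipschitz_def)
  then interpret pot: shift_potential d \<theta> "\<bar>c\<bar> * C" ?\<phi>
    by unfold_locales (use assms in auto)
  obtain p where p: "\<And>n x. x \<in> bernoulli_space d \<Longrightarrow>
      exp (n * p - 2 * pot.D) \<le> (transfer d ?\<phi> ^^ n) (\<lambda>_. 1) x \<and>
      (transfer d ?\<phi> ^^ n) (\<lambda>_. 1) x \<le> exp (n * p + 2 * pot.D)"
    using pot.pressure_exists by blast
  interpret P: shift_pressure d \<theta> "\<bar>c\<bar> * C" ?\<phi> p
    by unfold_locales (use p in blast)
  have inv: "prob_space \<mu>" "space \<mu> = bernoulli_space d" "sets \<mu> = sets (borel_of_metric (bernoulli_metric d \<theta>))"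
    "left_shift \<in> measurable \<mu> \<mu>" "distr \<mu> \<mu> left_shift = \<mu>"
    using assms(8) \<theta> by (auto simp: equilibrium_state_def invariant_prob_def)
  have \<mu>: "shift_measure \<mu> d \<theta>"
    using inv assms(1) \<theta> by (auto simp: shift_measure_def shift_measure_axioms_def)
  have eq: "ks_entropy \<mu> left_shift + ereal (\<integral>x. c * f x \<partial>\<mu>) = ereal p"
    using assms(8) P.topological_pressure_eq by (simp add: equilibrium_state_def)
  have bs: "birkhoff_sum left_shift ?\<phi> n x = c * birkhoff_sum left_shift f n x" for n x
    by (simp add: birkhoff_sum_def sum_distrib_left)
  let ?Z = "\<lambda>n. \<Sum>x\<in>fix_points d n. exp (birkhoff_sum left_shift ?\<phi> n x)"
  \<comment> \<open>For \<pi> the normalisation by the pressure cancels the exponential growth of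
    the periodic sums, and distortion leaves a constant as lower bound.\<close>
  have "exp (- 3 * pot.D) \<le> exp (n * (- p)) * ?Z n" if "n \<ge> 1" for n
    using mult_left_mono[OF P.orbit_sum_pressure[OF that], of "exp (n * (- p))"]
    by (simp add: exp_add[symmetric])
  then have pi: "(\<lambda>N. \<integral>x. g x \<partial>orbit_measure d \<theta> (\<lambda>n x. exp (birkhoff_sum left_shift ?\<phi> n x + n * (- p))) N)
      \<longlonglongrightarrow> (\<integral>x. g x \<partial>\<mu>)"
    by (intro P.orbit_measure_integral_tendsto[OF \<mu> eq assms(7), of "exp (- 3 * pot.D)" "- p"]) auto
  \<comment> \<open>For \<eta> the lower bound comes from the positivity of \<open>f\<close> and
    \<open>c\<close>: the Birkhoff sum at the fixed point 1, 1, 1, ... is nonnegative, so this point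
    alone contributes at least 1.\<close>
  have "1 \<le> exp (n * 0) * ?Z n" if n: "n \<ge> 1" for n
  proof -
    let ?o = "\<lambda>_. 1 :: nat"
    have o: "?o \<in> bernoulli_space d" by (rule pot.const_in_space)
    have o': "?o \<in> fix_points d n" using o by (simp add: fix_points_def funpow_shift)
    have "0 \<le> birkhoff_sum left_shift ?\<phi> n ?o"
      unfolding birkhoff_sum_def using assms(5)[OF o] assms(6) by (intro sum_nonneg) (simp add: funpow_shift)
    then have "1 \<le> exp (birkhoff_sum left_shift ?\<phi> n ?o)" by simp
    also have "\<dots> \<le> ?Z n" using o' finite_fix_points[OF n] by (intro member_le_sum) auto
    finally show ?thesis by simp
  qed
  then have eta: "(\<lambda>N. \<integral>x. g x \<partial>orbit_measure d \<theta> (\<lambda>n x. exp (birkhoff_sum left_shift ?\<phi> n x + real n * 0)) N)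
      \<longlonglongrightarrow> (\<integral>x. g x \<partial>\<mu>)"
    by (intro P.orbit_measure_integral_tendsto[OF \<mu> eq assms(7), of 1 0]) auto
  show ?thesis
    using pi eta by (simp add: zeta_measure_pi_def zeta_measure_eta_def P.topological_pressure_eq bs)
qed

end
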